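(* Let $\zeta\ge0$ and $\kappa\ge0$ satisfy $8\zeta+3\kappa<1$ and $\zeta+3\kappa<1$. Let $\{Z_n\}_{n\in\mathbb{N}}$ be a sequence of diagonal matrices $Z_n=\mathrm{diag}(z_1^{(n)},\ldots,z_n^{(n)})$ with $z_j^{(n)}\geq1$ having bounded squeezing of degree $\zeta$, such that the average energy $\lambda(n)=\frac{1}{2n}\sum_{j=1}^n(z_j^{(n)}+1/z_j^{(n)})$ is uniformly bounded in $n$ and satisfies $\lambda(n)\ge\mu$ for all $n$, for some $\mu>1$. Let $\{k_n\}_{n\in\mathbb{N}}$ be a sequence of subsystem sizes bounded of degree $\kappa$. Let $U$ be drawn from the Haar measure on $U(n)$ and let $S(M_{n,k_n})$ denote the von Neumann entropy of the reduced $k_n$-mode Gaussian state with covariance matrix $M_{n,k_n}(U)$. Then there are constants $C,c>0$ such that for every $\epsilon>0$ with $C\beta(\mu)n^{(\zeta+3\kappa-1)/2}<\epsilon$, $$\Pr\Big\{\big|k_nG(\lambda(n))-S(M_{n,k_n})\big|\le\epsilon\Big\}\ge1-\exp\Big(-c\,\frac{\epsilon^4}{\beta(\mu)^4}\,n^{1-8\zeta-3\kappa}\Big).$$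
   Context: $J_k=\begin{pmatrix}0_k&-I_k\\ I_k&0_k\end{pmatrix}$. For $U\in U(n)$, $\eta(U)=\begin{pmatrix}\mathrm{Re}(U)&\mathrm{Im}(U)\\ -\mathrm{Im}(U)&\mathrm{Re}(U)\end{pmatrix}$, $M_n(U)=\eta(U)(Z_n\oplus Z_n^{-1})\eta(U)^T$, and $M_{n,k}(U)$ is the $2k\times2k$ submatrix of $M_n(U)$ with rows and columns indexed by $\{1,\ldots,k\}\cup\{n+1,\ldots,n+k\}$. If $\lambda_1,\ldots,\lambda_k\ge1$ are the symplectic eigenvalues of a $2k\times 2k$ covariance matrix $M$ (spectrum of $J_kM$ equals $\bigcup_j\{\pm i\lambda_j\}$), then the entropy of the corresponding Gaussian state is $S(M)=\sum_{j=1}^kG(\lambda_j)$, where $G(\lambda)=g((\lambda-1)/2)$ and $g(N)=(N+1)\log(N+1)-N\log N$. $\beta(\lambda)=\log\frac{\lambda+1}{\lambda-1}$ for $\lambda>1$. Bounded squeezing of degree $\zeta$: there is $C>0$ with $\|Z_n\|_\infty\le Cn^\zeta$ for all large $n$. Subsystem sizes $k_n\in\{1,\ldots,n\}$ bounded of degree $\kappa$: there is $K>0$ with $k_n\le Kn^\kappa$ for all large $n$. *)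

theory Defs
  imports "HOL-Probability.Probability" "Jordan_Normal_Form.Char_Poly"
begin

text \<open>Square matrices of size n are represented as functions nat \<Rightarrow> nat \<Rightarrow> 'a
  (indices 0..n-1), and are required to vanish outside the n x n block where relevant.\<close>

definition sqmat_mult :: "nat \<Rightarrow> (nat \<Rightarrow> nat \<Rightarrow> complex) \<Rightarrow> (nat \<Rightarrow> nat \<Rightarrow> complex) \<Rightarrow> (nat \<Rightarrow> nat \<Rightarrow> complex)" where
  "sqmat_mult n A B = (\<lambda>i j. if i < n \<and> j < n then (\<Sum>l<n. A i l * B l j) else 0)"

definition unitary_group :: "nat \<Rightarrow> (nat \<Rightarrow> nat \<Rightarrow> complex) set" where
  "unitary_group n = {U. (\<forall>i j. (n \<le> i \<or> n \<le> j) \<longrightarrow> U i j = 0) \<and>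
      (\<forall>i<n. \<forall>j<n. (\<Sum>l<n. U i l * cnj (U j l)) = (if i = j then 1 else 0))}"

text \<open>Haar measure on U(n): a Borel probability measure concentrated on U(n) that is
  invariant under left multiplication by unitaries (this determines it uniquely).\<close>
definition haar_unitary :: "nat \<Rightarrow> (nat \<Rightarrow> nat \<Rightarrow> complex) measure \<Rightarrow> bool" where
  "haar_unitary n P \<longleftrightarrow> prob_space P \<and> sets P = sets borel \<and>
     emeasure P (unitary_group n) = 1 \<and>
     (\<forall>V\<in>unitary_group n. \<forall>A\<in>sets borel.
        emeasure P ((\<lambda>U. sqmat_mult n V U) -` A) = emeasure P A)"

definition eta :: "nat \<Rightarrow> (nat \<Rightarrow> nat \<Rightarrow> complex) \<Rightarrow> nat \<Rightarrow> nat \<Rightarrow> real" where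
  "eta n U a b =
     (if a < n \<and> b < n then Re (U a b)
      else if a < n \<and> n \<le> b \<and> b < 2*n then Im (U a (b - n))
      else if n \<le> a \<and> a < 2*n \<and> b < n then - Im (U (a - n) b)
      else if n \<le> a \<and> a < 2*n \<and> n \<le> b \<and> b < 2*n then Re (U (a - n) (b - n))
      else 0)"

definition zdiag :: "(nat \<Rightarrow> nat \<Rightarrow> real) \<Rightarrow> nat \<Rightarrow> nat \<Rightarrow> real" where
  "zdiag z n c = (if c < n then z n c else 1 / z n (c - n))"

definition Mcov :: "(nat \<Rightarrow> nat \<Rightarrow> real) \<Rightarrow> nat \<Rightarrow> (nat \<Rightarrow> nat \<Rightarrow> complex) \<Rightarrow> nat \<Rightarrow> nat \<Rightarrow> real" where
  "Mcov z n U a b = (\<Sum>c<2*n. eta n U a c * zdiag z n c * eta n U b c)"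

definition sub_idx :: "nat \<Rightarrow> nat \<Rightarrow> nat \<Rightarrow> nat" where
  "sub_idx n k i = (if i < k then i else n + (i - k))"

definition Mcov_sub :: "(nat \<Rightarrow> nat \<Rightarrow> real) \<Rightarrow> nat \<Rightarrow> nat \<Rightarrow> (nat \<Rightarrow> nat \<Rightarrow> complex) \<Rightarrow> real mat" where
  "Mcov_sub z n k U = mat (2*k) (2*k) (\<lambda>(i, j). Mcov z n U (sub_idx n k i) (sub_idx n k j))"

definition Jmat :: "nat \<Rightarrow> complex mat" where
  "Jmat k = mat (2*k) (2*k) (\<lambda>(i, j). if i < k \<and> j = i + k then -1
                                      else if k \<le> i \<and> j = i - k then 1 else 0)"

text \<open>lams is a list of symplectic eigenvalues of the 2k x 2k matrix M (all \<ge> 1):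
  the spectrum of J_k M (with multiplicities) is the union of {+- i lam_j}.\<close>
definition symplectic_eigenvalues :: "nat \<Rightarrow> real mat \<Rightarrow> real list \<Rightarrow> bool" where
  "symplectic_eigenvalues k M lams \<longleftrightarrow> length lams = k \<and> (\<forall>l\<in>set lams. 1 \<le> l) \<and>
     char_poly (Jmat k * map_mat complex_of_real M) =
       (\<Prod>l\<leftarrow>lams. [:complex_of_real (l^2), 0, 1:])"

definition gfun :: "real \<Rightarrow> real" where
  "gfun N = (if N = 0 then 0 else (N + 1) * ln (N + 1) - N * ln N)"

definition Gfun :: "real \<Rightarrow> real" where
  "Gfun l = gfun ((l - 1) / 2)"

definition beta :: "real \<Rightarrow> real" where
  "beta l = ln ((l + 1) / (l - 1))"

definition gauss_entropy :: "nat \<Rightarrow> real mat \<Rightarrow> real" where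
  "gauss_entropy k M = (THE s. \<exists>lams. symplectic_eigenvalues k M lams \<and> s = (\<Sum>l\<leftarrow>lams. Gfun l))"

definition avg_energy :: "(nat \<Rightarrow> nat \<Rightarrow> real) \<Rightarrow> nat \<Rightarrow> real" where
  "avg_energy z n = (\<Sum>j<n. z n j + 1 / z n j) / (2 * real n)"

end

theory Submission
  imports Defs "Jordan_Normal_Form.Schur_Decomposition"
begin

text \<open>
  The symplectic eigenvalues \<open>\<lambda>\<^sub>j\<close> of \<open>M = M\<^bsub>n,k\<^esub>\<close> satisfy
  \<open>2 \<Sum>\<^sub>j (\<lambda>\<^sub>j\<^sup>2 - \<lambda>\<^sup>2)\<^sup>2 = tr (((J M)\<^sup>2 + \<lambda>\<^sup>2)\<^sup>2)\<close>, and the right-hand side is controlled by the squared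
  Frobenius norm \<open>Y\<close> of \<open>M - \<lambda>\<close>. Since \<open>G\<close> is Lipschitz around \<open>\<lambda> \<ge> \<mu>\<close>, the entropy deviation is at most a constant
  times \<open>sqrt (k Y)\<close> if \<open>Y \<le> 1\<close>, and loses only a factor \<open>n\<^sup>\<zeta>\<close> in general.

  In complex notation \<open>Y / 2\<close> is the sum of the squared Frobenius norms of the \<open>k \<times> k\<close> corners of \<open>U d U\<^sup>*\<close> and
  \<open>U q U\<^sup>T\<close> with real diagonal matrices \<open>d\<close> (of trace 0) and \<open>q\<close>. Let \<open>D\<^sub>b\<^sub>c\<close> be the derivation
  along the generator with a single entry 1 at \<open>(b, c)\<close>; invariance of Haar measure gives \<open>E (D\<^sub>b\<^sub>c f) = 0\<close> for
  polynomials \<open>f\<close> in the entries of \<open>U\<close> and their conjugates. The entries of both matrices are eigenfunctions of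
  \<open>\<Sum> D\<^sub>b\<^sub>c D\<^sub>c\<^sub>b\<close> with eigenvalue about \<open>2 n\<close>, so integration by parts bounds \<open>E \<Phi>\<^sup>p\<^sup>+\<^sup>1\<close> by
  \<open>(4 \<Delta>\<^sup>2 / n) (k\<^sup>2 + p) E \<Phi>\<^sup>p\<close> for each corner norm \<open>\<Phi>\<close>: these are the moments of a chi-square variable
  with about \<open>k\<^sup>2\<close> degrees of freedom, and Markov's inequality yields the tail bound.
\<close>

section \<open>Polynomial functions on the unitary group and their derivations\<close>

text \<open>The threshold for \<epsilon> is a statement about the mean. Bounded energy makes the
  sums of the squared diagonal entries of d and q linear, not quadratic, in the largest
  \<open>z n j\<close>. So the mean of Y is of order k^2 n^(\<zeta>-1), and k times it is of order
  n^(\<zeta>+3\<kappa>-1), the square of the threshold. The exponential tail is coarser: it sets in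
  only at Y of order n^(2\<zeta>+2\<kappa>-1), a factor n^\<zeta> above the mean. When the level
  needed for Y falls between the two scales, only the first moment helps; this suffices because the
  claimed probability is then at most 1/2. Past the start of the tail, a level T has rate T
  n^(1-2\<zeta>), which dominates \<epsilon>^4 n^(1-8\<zeta>-3\<kappa>) in each case.

  Two obstacles are unrelated to concentration. \<open>gauss_entropy\<close> is a definite
  description, so symplectic eigenvalues must be shown to exist and to be unique as a multiset. And
  a non-measurable set has measure 0, so a lower bound on the probability requires the event to be
  Borel in the space of all matrices.\<close>

type_synonym cmatf = "nat \<Rightarrow> nat \<Rightarrow> complex"

text \<open>\<open>polyd n f F\<close>: the function \<open>f\<close> is a polynomial in the entries of \<open>U\<close> and their conjugates, and \<open>F b c\<close>
  is its derivative along the complexified generator \<open>E\<^sub>b\<^sub>c\<close> of left multiplication. Being complex-linear in the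
  generator, it sends \<open>cnj U\<close> to \<open>- (E\<^sub>b\<^sub>c)\<^sup>T (cnj U)\<close>.\<close>

inductive polyd :: "nat \<Rightarrow> (cmatf \<Rightarrow> complex) \<Rightarrow> (nat \<Rightarrow> nat \<Rightarrow> cmatf \<Rightarrow> complex) \<Rightarrow> bool" for n where
  entry: "a < n \<Longrightarrow> j < n \<Longrightarrow> polyd n (\<lambda>U. U a j) (\<lambda>b c U. if a = b then U c j else 0)"
| cnj_entry: "a < n \<Longrightarrow> j < n \<Longrightarrow> polyd n (\<lambda>U. cnj (U a j)) (\<lambda>b c U. if a = c then - cnj (U b j) else 0)"
| const: "polyd n (\<lambda>U. x) (\<lambda>b c U. 0)"
| add: "polyd n f F \<Longrightarrow> polyd n g G \<Longrightarrow> polyd n (\<lambda>U. f U + g U) (\<lambda>b c U. F b c U + G b c U)"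
| mult: "polyd n f F \<Longrightarrow> polyd n g G \<Longrightarrow> polyd n (\<lambda>U. f U * g U) (\<lambda>b c U. F b c U * g U + f U * G b c U)"

lemma polyd_cong:
  assumes "polyd n f F" "\<And>b c U. F b c U = F' b c U"
  shows "polyd n f F'"
proof -
  have "F = F'" using assms(2) by (intro ext)
  then show ?thesis using assms(1) by simp
qed

lemma polyd_cmult: "polyd n f F \<Longrightarrow> polyd n (\<lambda>U. x * f U) (\<lambda>b c U. x * F b c U)"
  by (rule polyd_cong[OF polyd.mult[OF polyd.const]]) auto

lemma polyd_diff: "polyd n f F \<Longrightarrow> polyd n g G \<Longrightarrow> polyd n (\<lambda>U. f U - g U) (\<lambda>b c U. F b c U - G b c U)"
  using polyd.add[of n f F "\<lambda>U. (-1) * g U" "\<lambda>b c U. (-1) * G b c U"] polyd_cmult[of n g G "-1"] by simp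

lemma polyd_sum:
  assumes "\<And>i. i \<in> I \<Longrightarrow> polyd n (f i) (F i)"
  shows "polyd n (\<lambda>U. \<Sum>i\<in>I. f i U) (\<lambda>b c U. \<Sum>i\<in>I. F i b c U)"
  using assms
proof (induction I rule: infinite_finite_induct)
  case (insert x S)
  then have "polyd n (\<lambda>U. f x U + (\<Sum>i\<in>S. f i U)) (\<lambda>b c U. F x b c U + (\<Sum>i\<in>S. F i b c U))"
    by (intro polyd.add) auto
  then show ?case using insert by simp
qed (auto intro: polyd.const)

lemma polyd_power:
  assumes "polyd n f F"
  shows "polyd n (\<lambda>U. f U ^ m) (\<lambda>b c U. of_nat m * f U ^ (m - 1) * F b c U)"
proof (induction m)
  case 0
  then show ?case by (simp add: polyd.const)
next
  case (Suc m)
  show ?case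
    by (simp, rule polyd_cong[OF polyd.mult[OF assms Suc.IH]])
       (cases m; simp add: algebra_simps)
qed

text \<open>For skew-Hermitian X, conjugation commutes with differentiation along X. Extended
  complex-linearly, the derivative of \<open>cnj f\<close> along X is minus the conjugate of the
  derivative of \<open>f\<close> along the adjoint of X. The adjoint of E_bc is E_cb, hence the sign
  and the swapped indices.\<close>

lemma polyd_cnj:
  assumes "polyd n f F"
  shows "polyd n (\<lambda>U. cnj (f U)) (\<lambda>b c U. - cnj (F c b U))"
  using assms
proof induction
  case (entry a j)
  show ?case by (rule polyd_cong[OF polyd.cnj_entry[OF entry]]) auto
next
  case (cnj_entry a j)
  show ?case by (simp, rule polyd_cong[OF polyd.entry[OF cnj_entry]]) auto
next
  case (const x)
  show ?case by (rule polyd_cong[OF polyd.const]) auto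
next
  case (add f F g G)
  show ?case by (simp, rule polyd_cong[OF polyd.add[OF add.IH]]) auto
next
  case (mult f F g G)
  show ?case by (simp, rule polyd_cong[OF polyd.mult[OF mult.IH]]) (auto simp: algebra_simps)
qed

lemma unitary_group_entry_le_1:
  assumes "U \<in> unitary_group n"
  shows "cmod (U a j) \<le> 1"
proof (cases "a < n \<and> j < n")
  case True
  have "(\<Sum>l<n. U a l * cnj (U a l)) = 1" using assms True unfolding unitary_group_def by auto
  then have "complex_of_real (\<Sum>l<n. (cmod (U a l))\<^sup>2) = complex_of_real 1"
    by (simp add: complex_norm_square del: of_real_power)
  then have "(\<Sum>l<n. (cmod (U a l))\<^sup>2) = 1" by (simp only: of_real_eq_iff)
  moreover have "(cmod (U a j))\<^sup>2 \<le> (\<Sum>l<n. (cmod (U a l))\<^sup>2)"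
    using True by (intro member_le_sum) auto
  ultimately have "(cmod (U a j))\<^sup>2 \<le> 1" by simp
  then show ?thesis by (simp add: abs_square_le_1)
next
  case False
  then show ?thesis using assms unfolding unitary_group_def by auto
qed

lemma polyd_bounded:
  assumes "polyd n f F"
  shows "\<exists>K\<ge>0. \<forall>U\<in>unitary_group n. cmod (f U) \<le> K"
  using assms
proof induction
  case (add f F g G)
  then obtain K L where "K \<ge> 0" "\<forall>U\<in>unitary_group n. cmod (f U) \<le> K"
    "L \<ge> 0" "\<forall>U\<in>unitary_group n. cmod (g U) \<le> L" by blast
  then show ?case by (intro exI[of _ "K + L"]) (auto intro: norm_triangle_le add_mono)
next
  case (mult f F g G)
  then obtain K L where "K \<ge> 0" "\<forall>U\<in>unitary_group n. cmod (f U) \<le> K"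
    "L \<ge> 0" "\<forall>U\<in>unitary_group n. cmod (g U) \<le> L" by blast
  then show ?case by (intro exI[of _ "K * L"]) (auto simp: norm_mult intro: mult_mono)
next
  case (const x)
  show ?case by (rule exI[of _ "cmod x"]) simp
next
  case (entry a j)
  show ?case by (rule exI[of _ 1]) (simp add: unitary_group_entry_le_1)
next
  case (cnj_entry a j)
  show ?case by (rule exI[of _ 1]) (simp add: unitary_group_entry_le_1)
qed

lemma continuous_entry: "continuous_on UNIV (\<lambda>U::cmatf. U a j)"
  using continuous_on_product_then_coordinatewise[OF
      continuous_on_product_then_coordinatewise[OF continuous_on_id, of UNIV a], of j] by simp

lemma polyd_borel:
  assumes "polyd n f F"
  shows "f \<in> borel_measurable borel"
  using assms
proof induction
  case (entry a j)
  then show ?case by (intro borel_measurable_continuous_onI continuous_entry)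
next
  case (cnj_entry a j)
  then show ?case by (intro borel_measurable_continuous_onI continuous_intros continuous_entry)
qed auto

lemma polyd_deriv_bounded:
  assumes "polyd n f F"
  shows "\<exists>K\<ge>0. \<forall>U\<in>unitary_group n. cmod (F b c U) \<le> K"
  using assms
proof induction
  case (add f F g G)
  then obtain K L where "K \<ge> 0" "\<forall>U\<in>unitary_group n. cmod (F b c U) \<le> K"
    "L \<ge> 0" "\<forall>U\<in>unitary_group n. cmod (G b c U) \<le> L" by blast
  then show ?case by (intro exI[of _ "K + L"]) (auto intro: norm_triangle_le add_mono)
next
  case (mult f F g G)
  then obtain K L where 1: "K \<ge> 0" "\<forall>U\<in>unitary_group n. cmod (F b c U) \<le> K"
    "L \<ge> 0" "\<forall>U\<in>unitary_group n. cmod (G b c U) \<le> L" by blast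
  obtain K' where 2: "K' \<ge> 0" "\<forall>U\<in>unitary_group n. cmod (f U) \<le> K'" using polyd_bounded mult by blast
  obtain L' where 3: "L' \<ge> 0" "\<forall>U\<in>unitary_group n. cmod (g U) \<le> L'" using polyd_bounded mult by blast
  show ?case using 1 2 3
    by (intro exI[of _ "K * L' + K' * L"]) (auto simp: norm_mult intro!: norm_triangle_le add_mono mult_mono)
next
  case (const x)
  show ?case by (rule exI[of _ 0]) simp
next
  case (entry a j)
  show ?case by (rule exI[of _ 1]) (simp add: unitary_group_entry_le_1)
next
  case (cnj_entry a j)
  show ?case by (rule exI[of _ 1]) (simp add: unitary_group_entry_le_1)
qed

lemma polyd_deriv_borel:
  assumes "polyd n f F"
  shows "F b c \<in> borel_measurable borel"
  using assms
proof induction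
  case (entry a j)
  then show ?case by (cases "a = b") (auto intro!: borel_measurable_continuous_onI continuous_entry)
next
  case (cnj_entry a j)
  then show ?case by (cases "a = c") (auto intro!: borel_measurable_continuous_onI continuous_intros continuous_entry)
next
  case (mult f F g G)
  have [measurable]: "f \<in> borel_measurable borel" "g \<in> borel_measurable borel"
    using mult polyd_borel by auto
  note [measurable] = mult.IH
  show ?case by measurable
qed auto

text \<open>The chain rule along a path with g' = \<alpha> g. The true derivative of
  \<open>cnj (g t)\<close> involves \<open>cnj \<alpha>\<close>, whereas \<open>polyd\<close> is
  complex-linear in the generator; skew-Hermitian \<alpha> reconciles the two.\<close>

lemma polyd_has_vector_derivative:
  assumes "polyd n f F"
    and skew: "\<And>a b. a < n \<Longrightarrow> b < n \<Longrightarrow> \<alpha> b a = - cnj (\<alpha> a b)"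
    and path: "\<And>a j t. a < n \<Longrightarrow> j < n \<Longrightarrow>
       ((\<lambda>t. g t a j) has_vector_derivative (\<Sum>c<n. \<alpha> a c * g t c j)) (at t)"
  shows "((\<lambda>t. f (g t)) has_vector_derivative (\<Sum>b<n. \<Sum>c<n. \<alpha> b c * F b c (g t))) (at t)"
  using assms(1)
proof induction
  case (entry a j)
  have "(\<Sum>b<n. \<Sum>c<n. \<alpha> b c * (if a = b then g t c j else 0)) = (\<Sum>b<n. if b = a then (\<Sum>c<n. \<alpha> a c * g t c j) else 0)"
    by (rule sum.cong) auto
  also have "\<dots> = (\<Sum>c<n. \<alpha> a c * g t c j)" using entry by simp
  finally show ?case using path[OF entry] by simp
next
  case (cnj_entry a j)
  have "(\<Sum>b<n. \<Sum>c<n. \<alpha> b c * (if a = c then - cnj (g t b j) else 0)) = (\<Sum>b<n. - \<alpha> b a * cnj (g t b j))"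
    using cnj_entry by (intro sum.cong) (auto simp: if_distrib sum.delta cong: if_cong)
  also have "\<dots> = cnj (\<Sum>c<n. \<alpha> a c * g t c j)"
    by (simp, intro sum.cong refl) (use skew[OF cnj_entry(1)] in simp)
  finally show ?case
    using bounded_linear.has_vector_derivative[OF bounded_linear_cnj path[OF cnj_entry]] by simp
next
  case (const x)
  then show ?case by simp
next
  case (add f F h G)
  show ?case
    using has_vector_derivative_add[OF add.IH] by (simp add: algebra_simps sum.distrib)
next
  case (mult f F h G)
  show ?case
    using has_vector_derivative_mult[OF mult.IH]
    by (simp add: algebra_simps sum.distrib sum_distrib_left sum_distrib_right)
qed

section \<open>Integration by parts for Haar measure\<close>

lemma haar_AE_unitary:
  assumes "haar_unitary n P"
  shows "AE U in P. U \<in> unitary_group n" and "prob_space P" and "sets P = sets borel"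
    and "unitary_group n \<in> sets P"
proof -
  interpret prob_space P using assms by (simp add: haar_unitary_def)
  show "prob_space P" by unfold_locales
  show "sets P = sets borel" using assms by (simp add: haar_unitary_def)
  have e: "emeasure P (unitary_group n) = 1" using assms by (simp add: haar_unitary_def)
  \<comment> \<open>A set that is not measurable has \<open>emeasure\<close> 0, so the value 1
    forces measurability.\<close>
  then show s: "unitary_group n \<in> sets P" using emeasure_notin_sets by fastforce
  show "AE U in P. U \<in> unitary_group n"
    using AE_prob_1[of "unitary_group n"] e by (simp add: emeasure_eq_measure)
qed

lemma integrable_bounded_on_unitary:
  fixes f :: "cmatf \<Rightarrow> 'b::{banach, second_countable_topology}"
  assumes "haar_unitary n P" "f \<in> borel_measurable borel" "\<And>U. U \<in> unitary_group n \<Longrightarrow> norm (f U) \<le> K"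
  shows "integrable P f"
proof -
  interpret prob_space P using haar_AE_unitary[OF assms(1)] by simp
  have "f \<in> borel_measurable P"
    using assms(2) measurable_cong_sets[OF haar_AE_unitary(3)[OF assms(1)] refl] by blast
  moreover have "AE U in P. norm (f U) \<le> K" using haar_AE_unitary(1)[OF assms(1)] assms(3) by auto
  ultimately show ?thesis by (rule integrable_const_bound[rotated])
qed

lemma polyd_integrable:
  assumes "haar_unitary n P" "polyd n f F"
  shows "integrable P f" "integrable P (F b c)"
proof -
  obtain K where "\<forall>U\<in>unitary_group n. cmod (f U) \<le> K" using polyd_bounded[OF assms(2)] by blast
  then show "integrable P f"
    using integrable_bounded_on_unitary[OF assms(1) polyd_borel[OF assms(2)]] by blast
  obtain K where "\<forall>U\<in>unitary_group n. cmod (F b c U) \<le> K" using polyd_deriv_bounded[OF assms(2)] by blast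
  then show "integrable P (F b c)"
    using integrable_bounded_on_unitary[OF assms(1) polyd_deriv_borel[OF assms(2)]] by blast
qed

lemma unitary_group_rows:
  assumes "U \<in> unitary_group n" "i < n" "j < n"
  shows "(\<Sum>l<n. U i l * cnj (U j l)) = (if i = j then 1 else 0)"
  using assms by (auto simp: unitary_group_def)

lemma unitary_group_mult_closed:
  assumes "V \<in> unitary_group n" "U \<in> unitary_group n"
  shows "sqmat_mult n V U \<in> unitary_group n"
proof -
  have "(\<Sum>l<n. sqmat_mult n V U i l * cnj (sqmat_mult n V U j l)) = (if i = j then 1 else 0)"
    if ij: "i < n" "j < n" for i j
  proof -
    have "(\<Sum>l<n. sqmat_mult n V U i l * cnj (sqmat_mult n V U j l))
      = (\<Sum>l<n. \<Sum>a<n. \<Sum>b<n. V i a * cnj (V j b) * (U a l * cnj (U b l)))"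
      using ij by (intro sum.cong) (auto simp: sqmat_mult_def sum_product algebra_simps)
    also have "\<dots> = (\<Sum>a<n. \<Sum>b<n. \<Sum>l<n. V i a * cnj (V j b) * (U a l * cnj (U b l)))"
      by (subst sum.swap, rule sum.cong[OF refl], rule sum.swap)
    also have "\<dots> = (\<Sum>a<n. \<Sum>b<n. V i a * cnj (V j b) * (\<Sum>l<n. (U a l * cnj (U b l))))"
      by (simp add: sum_distrib_left)
    also have "\<dots> = (\<Sum>a<n. \<Sum>b<n. V i a * cnj (V j b) * (if a = b then 1 else 0))"
      using unitary_group_rows[OF assms(2)] by (intro sum.cong) auto
    also have "\<dots> = (\<Sum>a<n. V i a * cnj (V j a))"
      by (intro sum.cong) (auto simp: if_distrib cong: if_cong)
    finally show ?thesis using unitary_group_rows[OF assms(1) ij] by simp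
  qed
  then show ?thesis by (auto simp: unitary_group_def sqmat_mult_def)
qed

lemma sqmat_mult_measurable: "sqmat_mult n V \<in> borel_measurable borel"
proof (rule borel_measurable_continuous_onI)
  show "continuous_on UNIV (sqmat_mult n V)"
    unfolding sqmat_mult_def
  proof (intro continuous_on_coordinatewise_then_product)
    fix i j
    show "continuous_on UNIV (\<lambda>x. if i < n \<and> j < n then \<Sum>l<n. V i l * x l j else 0)"
      by (cases "i < n \<and> j < n") (auto intro!: continuous_intros continuous_entry)
  qed
qed

lemma haar_integral_invariant:
  fixes f :: "cmatf \<Rightarrow> complex"
  assumes "haar_unitary n P" "V \<in> unitary_group n" and f: "f \<in> borel_measurable borel"
  shows "(\<integral>U. f (sqmat_mult n V U) \<partial>P) = (\<integral>U. f U \<partial>P)"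
proof -
  have s: "sets P = sets borel" using haar_AE_unitary[OF assms(1)] by simp
  have m: "sqmat_mult n V \<in> measurable P P"
    using sqmat_mult_measurable measurable_cong_sets[OF s s] by blast
  have sp: "space P = UNIV" using sets_eq_imp_space_eq[OF s] by simp
  have "distr P P (sqmat_mult n V) = P"
  proof (rule measure_eqI)
    fix A assume "A \<in> sets (distr P P (sqmat_mult n V))"
    then have "A \<in> sets P" "A \<in> sets borel" using s by auto
    then show "emeasure (distr P P (sqmat_mult n V)) A = emeasure P A"
      using assms(1,2) by (simp add: emeasure_distr[OF m] sp haar_unitary_def)
  qed simp
  moreover have "f \<in> borel_measurable P" using f measurable_cong_sets[OF s refl] by blast
  ultimately show ?thesis using integral_distr[OF m, of f] by simp
qed

text \<open>By invariance the integral of f (V_t U) over U does not depend on t; differentiating at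
  t = 0 under the integral sign gives the claim. The unitary path V is supplied explicitly by each
  use, so that no matrix exponential enters.\<close>

lemma haar_integral_flow_deriv:
  assumes P: "haar_unitary n P" and f: "polyd n f F"
    and skew: "\<And>a b. a < n \<Longrightarrow> b < n \<Longrightarrow> \<alpha> b a = - cnj (\<alpha> a b)"
    and V: "\<And>t. V t \<in> unitary_group n" and V0: "\<And>a b. a < n \<Longrightarrow> b < n \<Longrightarrow> V 0 a b = (if a = b then 1 else 0)"
    and dV: "\<And>a b t. a < n \<Longrightarrow> b < n \<Longrightarrow> ((\<lambda>t. V t a b) has_vector_derivative (\<Sum>c<n. \<alpha> a c * V t c b)) (at t)"
  shows "(\<Sum>b<n. \<Sum>c<n. \<alpha> b c * (\<integral>U. F b c U \<partial>P)) = 0"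
proof -
  interpret prob_space P using haar_AE_unitary[OF P] by simp
  have s: "sets P = sets borel" using haar_AE_unitary[OF P] by simp
  define D where "D U = (\<Sum>b<n. \<Sum>c<n. \<alpha> b c * F b c U)" for U
  have deriv: "((\<lambda>t. f (sqmat_mult n (V t) U)) has_vector_derivative D (sqmat_mult n (V t) U)) (at t)" for U t
    unfolding D_def
  proof (rule polyd_has_vector_derivative[OF f skew])
    fix a j t assume aj: "a < n" "j < n"
    have "((\<lambda>t. \<Sum>l<n. V t a l * U l j) has_vector_derivative (\<Sum>l<n. (\<Sum>c<n. \<alpha> a c * V t c l) * U l j)) (at t)"
      using dV aj by (intro has_vector_derivative_sum has_vector_derivative_mult_left) auto
    moreover have "(\<Sum>l<n. (\<Sum>c<n. \<alpha> a c * V t c l) * U l j) = (\<Sum>c<n. \<alpha> a c * sqmat_mult n (V t) U c j)"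
      using aj by (simp add: sqmat_mult_def sum_distrib_left sum_distrib_right mult.assoc)
        (rule sum.swap)
    ultimately show "((\<lambda>t. sqmat_mult n (V t) U a j) has_vector_derivative
        (\<Sum>c<n. \<alpha> a c * sqmat_mult n (V t) U c j)) (at t)"
      using aj by (simp add: sqmat_mult_def)
  qed auto
  have "\<forall>b c. \<exists>K\<ge>0. \<forall>U\<in>unitary_group n. cmod (F b c U) \<le> K" using polyd_deriv_bounded[OF f] by blast
  then obtain K where K: "\<And>b c U. U \<in> unitary_group n \<Longrightarrow> cmod (F b c U) \<le> K b c" by metis
  define B where "B = (\<Sum>b<n. \<Sum>c<n. cmod (\<alpha> b c) * K b c)"
  have DB: "cmod (D U) \<le> B" if "U \<in> unitary_group n" for U
    unfolding D_def B_def
    by (intro order.trans[OF norm_sum] sum_mono) (auto simp: norm_mult intro!: mult_left_mono K that)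
  have id: "sqmat_mult n (V 0) U = U" if "U \<in> unitary_group n" for U
  proof (intro ext)
    fix i j
    have "i < n \<Longrightarrow> j < n \<Longrightarrow> (\<Sum>l<n. V 0 i l * U l j) = (\<Sum>l<n. if l = i then U l j else 0)"
      using V0 by (intro sum.cong) auto
    then show "sqmat_mult n (V 0) U i j = U i j"
      using that by (auto simp: sqmat_mult_def unitary_group_def)
  qed
  have fb: "f \<in> borel_measurable borel" using polyd_borel[OF f] .
  have f2b: "(\<lambda>U. f (sqmat_mult n (V t) U)) \<in> borel_measurable borel" for t
    using measurable_compose[OF sqmat_mult_measurable fb] by simp
  have f2i: "integrable P (\<lambda>U. f (sqmat_mult n (V t) U))" for t
  proof -
    obtain K' where "\<forall>U\<in>unitary_group n. cmod (f U) \<le> K'" using polyd_bounded[OF f] by blast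
    then show ?thesis
      by (intro integrable_bounded_on_unitary[OF P f2b, of _ K']) (auto intro: unitary_group_mult_closed V)
  qed
  define h where "h m = 1 / real (Suc m)" for m
  have h0: "h \<longlonglongrightarrow> 0" unfolding h_def by (rule LIMSEQ_Suc[OF lim_1_over_n])
  have hpos: "h m > 0" for m by (simp add: h_def)
  define q where "q m U = (f (sqmat_mult n (V (h m)) U) - f U) /\<^sub>R h m" for m U
  have int0: "(\<integral>U. q m U \<partial>P) = 0" for m
  proof -
    have "(\<integral>U. q m U \<partial>P) = ((\<integral>U. f (sqmat_mult n (V (h m)) U) \<partial>P) - (\<integral>U. f U \<partial>P)) /\<^sub>R h m"
      unfolding q_def using f2i polyd_integrable(1)[OF P f] by simp
    then show ?thesis using haar_integral_invariant[OF P V fb] by simp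
  qed
  have bm: "g \<in> borel_measurable P" if "g \<in> borel_measurable borel" for g :: "cmatf \<Rightarrow> complex"
    using that measurable_cong_sets[OF s refl] by blast
  have "(\<lambda>m. \<integral>U. q m U \<partial>P) \<longlonglongrightarrow> (\<integral>U. D U \<partial>P)"
  proof (rule integral_dominated_convergence[where w="\<lambda>_. B"])
    show "D \<in> borel_measurable P"
      unfolding D_def by (intro bm borel_measurable_sum borel_measurable_times borel_measurable_const polyd_deriv_borel[OF f])
    show "q m \<in> borel_measurable P" for m
      unfolding q_def by (intro bm borel_measurable_scaleR borel_measurable_const borel_measurable_diff f2b fb)
    show "integrable P (\<lambda>_. B)" by simp
    show "AE U in P. (\<lambda>m. q m U) \<longlonglongrightarrow> D U"
      using haar_AE_unitary(1)[OF P]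
    proof (eventually_elim)
      case (elim U)
      have "((\<lambda>t. f (sqmat_mult n (V t) U)) has_vector_derivative D U) (at 0)"
        using deriv[of U 0] id[OF elim] by simp
      then have "((\<lambda>t. norm (f (sqmat_mult n (V t) U) - f U - t *\<^sub>R D U) / norm t) \<longlongrightarrow> 0) (at 0)"
        unfolding has_vector_derivative_def has_derivative_iff_norm using id[OF elim] by simp
      moreover have "filterlim h (at 0) sequentially"
        using h0 hpos by (intro filterlim_atI) (auto intro!: always_eventually simp: less_imp_neq[THEN not_sym])
      ultimately have "(\<lambda>m. norm (f (sqmat_mult n (V (h m)) U) - f U - h m *\<^sub>R D U) / norm (h m)) \<longlonglongrightarrow> 0"
        by (rule filterlim_compose)
      moreover have "norm (f (sqmat_mult n (V (h m)) U) - f U - h m *\<^sub>R D U) / norm (h m) = norm (q m U - D U)" for m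
      proof -
        have "q m U - D U = (f (sqmat_mult n (V (h m)) U) - f U - h m *\<^sub>R D U) /\<^sub>R h m"
          unfolding q_def using hpos[of m] by (simp add: scaleR_diff_right)
        then show ?thesis using hpos[of m] by (simp only: norm_scaleR) (simp add: divide_inverse mult.commute)
      qed
      ultimately have "(\<lambda>m. norm (q m U - D U)) \<longlonglongrightarrow> 0" by simp
      then show ?case using tendsto_norm_zero_iff LIM_zero_iff by blast
    qed
    show "AE U in P. norm (q m U) \<le> B" for m
      using haar_AE_unitary(1)[OF P]
    proof (eventually_elim)
      case (elim U)
      \<comment> \<open>The mean value inequality dominates the difference quotients: at every time
        the derivative is \<open>D\<close> at a unitary matrix, hence at most \<open>B\<close>,
        uniformly in U and m.\<close>
      have "norm (f (sqmat_mult n (V (h m)) U) - f (sqmat_mult n (V 0) U)) \<le> B * norm (h m - 0)"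
      proof (rule differentiable_bound[of UNIV])
        show "((\<lambda>t. f (sqmat_mult n (V t) U)) has_derivative (\<lambda>x. x *\<^sub>R D (sqmat_mult n (V t) U))) (at t within UNIV)" for t
          using deriv[of U t] by (simp add: has_vector_derivative_def)
        show "onorm (\<lambda>x. x *\<^sub>R D (sqmat_mult n (V t) U)) \<le> B" for t
          by (rule onorm_le) (use DB[OF unitary_group_mult_closed[OF V elim], of t] in
              \<open>simp add: mult.commute[of B] mult_left_mono\<close>)
      qed auto
      then show ?case using hpos[of m] unfolding q_def id[OF elim] norm_scaleR
        by (simp add: divide_inverse[symmetric] mult.commute[of "inverse _"] divide_le_eq)
    qed
  qed
  then have "(\<integral>U. D U \<partial>P) = 0" by (simp add: int0 LIMSEQ_const_iff)
  then show ?thesis unfolding D_def using polyd_integrable(2)[OF P f] by simp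
qed

text \<open>E_bb is not skew-Hermitian, but \<i> E_bb is; its flow is a phase in coordinate
  b.\<close>

lemma haar_integral_deriv_diag:
  assumes P: "haar_unitary n P" and f: "polyd n f F" and b: "b < n"
  shows "(\<integral>U. F b b U \<partial>P) = 0"
proof -
  define \<alpha> where "\<alpha> x y = (if x = b \<and> y = b then \<i> else 0)" for x y
  define V where "V t x y = (if x = y \<and> x < n then (if x = b then cis t else 1) else 0)" for t x y
  have [simp]: "cis t * cnj (cis t) = 1" for t by (simp add: cis_cnj cis_mult)
  have "(\<Sum>x<n. \<Sum>y<n. \<alpha> x y * (\<integral>U. F x y U \<partial>P)) = 0"
  proof (rule haar_integral_flow_deriv[OF P f])
    show "\<alpha> x y = - cnj (\<alpha> y x)" for x y by (auto simp: \<alpha>_def)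
    show "V t \<in> unitary_group n" for t
    proof -
      have "(\<Sum>l<n. V t i l * cnj (V t j l)) = (\<Sum>l<n. if l = i then (if i = j then 1 else 0) else 0)" if "i < n" "j < n" for i j
        using that by (intro sum.cong) (auto simp: V_def)
      then have "(\<Sum>l<n. V t i l * cnj (V t j l)) = (if i = j then 1 else 0)" if "i < n" "j < n" for i j
        using that by simp
      moreover have "V t i j = 0" if "n \<le> i \<or> n \<le> j" for i j using that by (auto simp: V_def)
      ultimately show ?thesis by (simp add: unitary_group_def)
    qed
    show "V 0 x y = (if x = y then 1 else 0)" if "x < n" "y < n" for x y
      using that by (auto simp: V_def)
    show "((\<lambda>t. V t x y) has_vector_derivative (\<Sum>c<n. \<alpha> x c * V t c y)) (at t)" if "x < n" "y < n" for x y t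
    proof -
      have "(\<Sum>c<n. \<alpha> x c * V t c y) = (\<Sum>c<n. if c = b then (if x = b \<and> y = b then \<i> * cis t else 0) else 0)"
        by (rule sum.cong) (auto simp: \<alpha>_def V_def)
      then have e: "(\<Sum>c<n. \<alpha> x c * V t c y) = (if x = b \<and> y = b then \<i> * cis t else 0)" using b by simp
      have "(cis has_vector_derivative \<i> * cis t) (at t)"
        unfolding cis.ctr has_vector_derivative_complex_iff by (auto intro!: derivative_eq_intros)
      then show ?thesis unfolding e unfolding V_def using b that by (cases "x = y"; cases "x = b") auto
    qed
  qed
  moreover have "(\<Sum>x<n. \<Sum>y<n. \<alpha> x y * (\<integral>U. F x y U \<partial>P)) = (\<Sum>x<n. if x = b then \<i> * (\<integral>U. F b b U \<partial>P) else 0)"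
    using b by (intro sum.cong) (auto simp: \<alpha>_def if_distrib[of "\<lambda>x. x * _"] cong: if_cong)
  ultimately show ?thesis using b by simp
qed

text \<open>The flow of w E_bc - cnj w E_cb is a rotation in the plane of coordinates b and c. E_bc
  alone generates no unitary flow, so invariance yields one linear relation between the two
  integrals for each w of modulus 1.\<close>

lemma haar_integral_deriv_rotation:
  assumes P: "haar_unitary n P" and f: "polyd n f F" and bc: "b < n" "c < n" "b \<noteq> c" and w: "w * cnj w = 1"
  shows "w * (\<integral>U. F b c U \<partial>P) = cnj w * (\<integral>U. F c b U \<partial>P)"
proof -
  define \<alpha> where "\<alpha> x y = (if x = b \<and> y = c then w else if x = c \<and> y = b then - cnj w else 0)" for x y
  define V where "V t x y = (if x < n \<and> y < n then
      (if x = b \<and> y = c then w * complex_of_real (sin t) else if x = c \<and> y = b then - cnj w * complex_of_real (sin t)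
       else if x = y then (if x = b \<or> x = c then complex_of_real (cos t) else 1) else 0) else 0)" for t x y
  have two: "(\<Sum>l<n. g l) = g b + g c" if "\<And>l. l \<noteq> b \<Longrightarrow> l \<noteq> c \<Longrightarrow> g l = 0" for g :: "nat \<Rightarrow> complex"
  proof -
    have "(\<Sum>l<n. g l) = (\<Sum>l\<in>{b, c}. g l)" using bc that by (intro sum.mono_neutral_right) auto
    then show ?thesis using bc by simp
  qed
  have w': "cnj w * w = 1" using w by (simp add: mult.commute)
  have sc: "complex_of_real (sin t) * complex_of_real (sin t) + complex_of_real (cos t) * complex_of_real (cos t) = 1" for t
    by (metis of_real_1 of_real_add of_real_mult power2_eq_square sin_cos_squared_add)
  have e1: "w * s * (cnj w * s) = s * s" "cnj w * s * (w * s) = s * s" for s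
  proof -
    have "w * s * (cnj w * s) = (w * cnj w) * (s * s)" by (simp only: ac_simps)
    then show "w * s * (cnj w * s) = s * s" by (simp only: w mult_1)
    then show "cnj w * s * (w * s) = s * s" by (simp only: ac_simps)
  qed
  have Vv: "V t b b = complex_of_real (cos t)" "V t c c = complex_of_real (cos t)"
    "V t b c = w * complex_of_real (sin t)" "V t c b = - cnj w * complex_of_real (sin t)" for t
    using bc by (simp_all add: V_def)
  have Vo: "V t j b = 0" "V t j c = 0" "V t b j = 0" "V t c j = 0" if "\<not> (j = b \<or> j = c)" for t j
    using that by (simp_all add: V_def)
  have Vd: "V t i j = (if i = j \<and> i < n then 1 else 0)" if "\<not> (i = b \<or> i = c)" for t i j
    using that by (simp add: V_def)
  have av: "\<alpha> b b = 0" "\<alpha> c c = 0" "\<alpha> b c = w" "\<alpha> c b = - cnj w" using bc(3) by (simp_all add: \<alpha>_def)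
  have ao: "\<alpha> x y = 0" if "\<not> (x = b \<or> x = c) \<or> \<not> (y = b \<or> y = c)" for x y using that by (auto simp: \<alpha>_def)
  have "(\<Sum>x<n. \<Sum>y<n. \<alpha> x y * (\<integral>U. F x y U \<partial>P)) = 0"
  proof (rule haar_integral_flow_deriv[OF P f])
    show "\<alpha> x y = - cnj (\<alpha> y x)" for x y using bc by (auto simp: \<alpha>_def)
    show "V t \<in> unitary_group n" for t
    proof -
      have "(\<Sum>l<n. V t i l * cnj (V t j l)) = (if i = j then 1 else 0)" if ij: "i < n" "j < n" for i j
      proof (cases "i = b \<or> i = c")
        case True
        then have "(\<Sum>l<n. V t i l * cnj (V t j l)) = V t i b * cnj (V t j b) + V t i c * cnj (V t j c)"
          by (intro two) (auto simp: Vo)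
        also have "\<dots> = (if i = j then 1 else 0)"
        proof (cases "j = b \<or> j = c")
          case False
          then show ?thesis using True Vo[OF False, of t] by auto
        next
          case j: True
          show ?thesis using True j bc(3) sc[of t] by (elim disjE) (simp_all add: Vv e1 add.commute)
        qed
        finally show ?thesis .
      next
        case False
        then have "(\<Sum>l<n. V t i l * cnj (V t j l)) = (\<Sum>l<n. if l = i then (if i = j then 1 else 0) else 0)"
        proof (intro sum.cong refl)
          fix l assume "l \<in> {..<n}"
          show "V t i l * cnj (V t j l) = (if l = i then (if i = j then 1 else 0) else 0)"
            using False ij Vo(1,2)[OF False] Vo(3,4)[OF False, of t] by (cases "j = b \<or> j = c") (auto simp: Vd)
        qed
        then show ?thesis using ij by simp
      qed
      moreover have "V t i j = 0" if "n \<le> i \<or> n \<le> j" for i j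
        using that by (elim disjE) (simp_all only: V_def not_less[symmetric] simp_thms if_False)
      ultimately show ?thesis by (simp add: unitary_group_def)
    qed
    show "V 0 x y = (if x = y then 1 else 0)" if "x < n" "y < n" for x y
      using that bc by (cases "x = b \<or> x = c"; cases "y = b \<or> y = c") (auto simp: Vv Vo Vd)
    show "((\<lambda>t. V t x y) has_vector_derivative (\<Sum>l<n. \<alpha> x l * V t l y)) (at t)" if xy: "x < n" "y < n" for x y t
    proof -
      have e: "(\<Sum>l<n. \<alpha> x l * V t l y) = \<alpha> x b * V t b y + \<alpha> x c * V t c y"
        by (rule two) (simp add: ao)
      have s: "((\<lambda>t. complex_of_real (sin t)) has_vector_derivative complex_of_real (cos t)) (at t)"
        and c: "((\<lambda>t. complex_of_real (cos t)) has_vector_derivative - complex_of_real (sin t)) (at t)"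
        unfolding has_vector_derivative_complex_iff by (auto intro!: derivative_eq_intros)
      have ws: "w * (cnj w * x) = x" "cnj w * (w * x) = x" for x
        using w w' by (simp_all add: mult.assoc[symmetric])
      have mw: "((\<lambda>t. w * complex_of_real (sin t)) has_vector_derivative w * complex_of_real (cos t)) (at t)"
        "((\<lambda>t. - cnj w * complex_of_real (sin t)) has_vector_derivative - cnj w * complex_of_real (cos t)) (at t)"
        by (rule has_vector_derivative_mult_right[OF s])+
      consider "x = b" "y = b" | "x = b" "y = c" | "x = c" "y = b" | "x = c" "y = c"
        | "x = b \<or> x = c" "\<not> (y = b \<or> y = c)" | "\<not> (x = b \<or> x = c)" by blast
      then show ?thesis
      proof cases
        case 1
        show ?thesis unfolding e unfolding 1 Vv av using c by (simp add: ws)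
      next
        case 2
        show ?thesis unfolding e unfolding 2 Vv av using mw(1) by simp
      next
        case 3
        show ?thesis unfolding e unfolding 3 Vv av using mw(2) by simp
      next
        case 4
        show ?thesis unfolding e unfolding 4 Vv av using c by (simp add: ws)
      next
        case 5
        then show ?thesis unfolding e by (auto simp: Vo)
      next
        case 6
        then show ?thesis unfolding e by (simp add: Vd ao)
      qed
    qed
  qed
  moreover have "(\<Sum>x<n. \<Sum>y<n. \<alpha> x y * (\<integral>U. F x y U \<partial>P)) = w * (\<integral>U. F b c U \<partial>P) - cnj w * (\<integral>U. F c b U \<partial>P)"
  proof -
    have "(\<Sum>x<n. \<Sum>y<n. \<alpha> x y * (\<integral>U. F x y U \<partial>P)) = (\<Sum>y<n. \<alpha> b y * (\<integral>U. F b y U \<partial>P)) + (\<Sum>y<n. \<alpha> c y * (\<integral>U. F c y U \<partial>P))"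
      by (rule two) (simp add: ao)
    also have "(\<Sum>y<n. \<alpha> b y * (\<integral>U. F b y U \<partial>P)) = \<alpha> b b * (\<integral>U. F b b U \<partial>P) + \<alpha> b c * (\<integral>U. F b c U \<partial>P)"
      by (rule two) (simp add: ao)
    also have "(\<Sum>y<n. \<alpha> c y * (\<integral>U. F c y U \<partial>P)) = \<alpha> c b * (\<integral>U. F c b U \<partial>P) + \<alpha> c c * (\<integral>U. F c c U \<partial>P)"
      by (rule two) (simp add: ao)
    finally show ?thesis unfolding av by simp
  qed
  ultimately show ?thesis by simp
qed

text \<open>For b different from c, w = 1 makes the two integrals equal and w = \<i> makes them
  opposite, so both vanish.\<close>

theorem haar_integral_deriv_eq_0:
  assumes P: "haar_unitary n P" and f: "polyd n f F" and bc: "b < n" "c < n"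
  shows "(\<integral>U. F b c U \<partial>P) = 0"
proof (cases "b = c")
  case True
  then show ?thesis using haar_integral_deriv_diag[OF P f] bc by simp
next
  case False
  have "(\<integral>U. F b c U \<partial>P) = (\<integral>U. F c b U \<partial>P)"
    using haar_integral_deriv_rotation[OF P f bc False, of 1] by simp
  moreover have "\<i> * (\<integral>U. F b c U \<partial>P) = - \<i> * (\<integral>U. F c b U \<partial>P)"
    using haar_integral_deriv_rotation[OF P f bc False, of \<i>] by simp
  ultimately show ?thesis by simp
qed

section \<open>Moment recursion\<close>

text \<open>Integration by parts: integrate the derivative along (b, c) of
  \<open>F i c b * cnj (f i) * \<Phi> ^ p\<close> and sum over i, b, c. Differentiating the first
  factor gives the Laplacian term \<kappa> \<Phi>^(p+1), the second gives - a \<Phi>^p, the third p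
  \<Phi>^(p-1) times a sum with real part at least - 2 \<tau>. At p = 0 the truncated exponent
  \<open>p - 1\<close> is harmless since its coefficient is 0.\<close>

lemma moment_recursion:
  fixes f :: "'i \<Rightarrow> cmatf \<Rightarrow> complex" and \<kappa> :: real
  assumes P: "haar_unitary n P" and I: "finite I"
    and F: "\<And>i. i \<in> I \<Longrightarrow> polyd n (f i) (F i)"
    and FF: "\<And>i b c. i \<in> I \<Longrightarrow> b < n \<Longrightarrow> c < n \<Longrightarrow> polyd n (F i b c) (FF i b c)"
    and lap: "\<And>i U. i \<in> I \<Longrightarrow> U \<in> unitary_group n \<Longrightarrow>
        (\<Sum>b<n. \<Sum>c<n. FF i c b b c U) = complex_of_real \<kappa> * f i U"
  defines "\<Phi> \<equiv> \<lambda>U. \<Sum>i\<in>I. (cmod (f i U))\<^sup>2"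
    and "a \<equiv> \<lambda>U. \<Sum>i\<in>I. \<Sum>b<n. \<Sum>c<n. (cmod (F i b c U))\<^sup>2"
    and "\<tau> \<equiv> \<lambda>U. \<Sum>b<n. \<Sum>c<n. (cmod (\<Sum>i\<in>I. cnj (f i U) * F i b c U))\<^sup>2"
  shows "integrable P (\<lambda>U. \<Phi> U ^ p)" "integrable P (\<lambda>U. a U * \<Phi> U ^ p)" "integrable P (\<lambda>U. \<tau> U * \<Phi> U ^ p)"
    "\<kappa> * (\<integral>U. \<Phi> U ^ Suc p \<partial>P) \<le> (\<integral>U. a U * \<Phi> U ^ p \<partial>P) + 2 * real p * (\<integral>U. \<tau> U * \<Phi> U ^ (p - 1) \<partial>P)"
proof -
  define Fc where "Fc U = (\<Sum>i\<in>I. cnj (f i U) * f i U)" for U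
  define T where "T b c U = (\<Sum>i\<in>I. cnj (f i U) * F i b c U)" for b c U
  define ac where "ac U = (\<Sum>i\<in>I. \<Sum>b<n. \<Sum>c<n. cnj (F i b c U) * F i b c U)" for U
  define tc where "tc U = (\<Sum>b<n. \<Sum>c<n. cnj (T b c U) * T b c U)" for U
  have sq: "cnj x * x = complex_of_real ((cmod x)\<^sup>2)" for x
    by (metis complex_norm_square mult.commute)
  have Fc: "Fc U = complex_of_real (\<Phi> U)" for U
    unfolding Fc_def \<Phi>_def by (simp add: sq del: of_real_power)
  have ac: "ac U = complex_of_real (a U)" for U
    unfolding ac_def a_def by (simp add: sq del: of_real_power)
  have tc: "tc U = complex_of_real (\<tau> U)" for U
    unfolding tc_def \<tau>_def T_def[symmetric] by (simp add: sq del: of_real_power)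
  define DF where "DF b c U = (\<Sum>i\<in>I. - cnj (F i c b U) * f i U + cnj (f i U) * F i b c U)" for b c U
  have pF: "polyd n Fc DF"
    unfolding Fc_def[abs_def] DF_def[abs_def] by (intro polyd_sum polyd.mult polyd_cnj F)
  have DF: "DF b c U = T b c U - cnj (T c b U)" for b c U
    unfolding DF_def T_def by (simp add: sum.distrib sum_subtractf sum_negf mult.commute)
  have pcnj: "\<exists>G. polyd n (\<lambda>U. cnj (g U)) G" if "\<exists>G. polyd n g G" for g using that polyd_cnj by blast
  have pm: "\<exists>H. polyd n (\<lambda>U. g U * h U) H" if "\<exists>G. polyd n g G" "\<exists>G. polyd n h G" for g h
    using that polyd.mult by blast
  have ps: "\<exists>H. polyd n (\<lambda>U. \<Sum>j\<in>J. g j U) H" if "\<And>j. j \<in> J \<Longrightarrow> \<exists>G. polyd n (g j) G" for J :: "'j set" and g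
  proof -
    have "\<forall>j\<in>J. \<exists>G. polyd n (g j) G" using that by simp
    then obtain G where "\<forall>j\<in>J. polyd n (g j) (G j)" by (rule bchoice[THEN exE])
    then have "polyd n (\<lambda>U. \<Sum>j\<in>J. g j U) (\<lambda>b c U. \<Sum>j\<in>J. G j b c U)" by (intro polyd_sum) auto
    then show ?thesis by (rule exI[where P="polyd n (\<lambda>U. \<Sum>j\<in>J. g j U)"])
  qed
  have pT: "\<exists>G. polyd n (T b c) G" if "b < n" "c < n" for b c
    unfolding T_def[abs_def] by (intro ps pm pcnj) (use F FF that in blast)+
  have pa: "\<exists>G. polyd n ac G" unfolding ac_def[abs_def] 
    by (intro ps pm pcnj) (use F FF in \<open>force intro: exI\<close>)+
  have pt: "\<exists>G. polyd n tc G" unfolding tc_def[abs_def]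
    by (intro ps pm pcnj) (use pT in auto)
  have pP: "\<exists>G. polyd n (\<lambda>U. Fc U ^ p) G" for p using polyd_power[OF pF] by blast
  have intRe: "integrable P g" if h: "\<exists>G. polyd n h G" "\<And>U. h U = complex_of_real (g U)" for g h
  proof -
    obtain G where "polyd n h G" using h(1) by blast
    then have "integrable P h" using polyd_integrable[OF P] by blast
    then have "integrable P (\<lambda>U. Re (h U))" by (rule integrable_Re)
    then show ?thesis using h(2) by simp
  qed
  show i1: "integrable P (\<lambda>U. \<Phi> U ^ p)" for p
    by (rule intRe[OF pP[of p]]) (simp add: Fc)
  show i2: "integrable P (\<lambda>U. a U * \<Phi> U ^ p)" for p
    by (rule intRe[OF pm[OF pa pP[of p]]]) (simp add: Fc ac)
  show i3: "integrable P (\<lambda>U. \<tau> U * \<Phi> U ^ p)" for p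
    by (rule intRe[OF pm[OF pt pP[of p]]]) (simp add: Fc tc)
  define g where "g i b c U = FF i c b b c U * (cnj (f i U) * Fc U ^ p)
     + F i c b U * (- cnj (F i c b U) * Fc U ^ p + cnj (f i U) * (of_nat p * Fc U ^ (p - 1) * DF b c U))" for i b c U
  have g: "integrable P (g i b c) \<and> (\<integral>U. g i b c U \<partial>P) = 0" if "i \<in> I" "b < n" "c < n" for i b c
  proof -
    have "polyd n (\<lambda>U. F i c b U * (cnj (f i U) * Fc U ^ p)) (\<lambda>b' c' U. FF i c b b' c' U * (cnj (f i U) * Fc U ^ p)
     + F i c b U * (- cnj (F i c' b' U) * Fc U ^ p + cnj (f i U) * (of_nat p * Fc U ^ (p - 1) * DF b' c' U)))"
      using that by (intro polyd.mult polyd_cnj F FF polyd_power pF)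
    from polyd_integrable(2)[OF P this, of b c] haar_integral_deriv_eq_0[OF P this that(2,3)]
    show ?thesis unfolding g_def[abs_def] by simp
  qed
  define R where "R U = \<kappa> * \<Phi> U ^ Suc p - a U * \<Phi> U ^ p - 2 * real p * (\<tau> U * \<Phi> U ^ (p - 1))" for U
  have "(\<integral>U. (\<Sum>i\<in>I. \<Sum>b<n. \<Sum>c<n. g i b c U) \<partial>P) = (\<Sum>i\<in>I. \<integral>U. (\<Sum>b<n. \<Sum>c<n. g i b c U) \<partial>P)"
    using g by (intro Bochner_Integration.integral_sum Bochner_Integration.integrable_sum) auto
  also have "\<dots> = (\<Sum>i\<in>I. \<Sum>b<n. \<integral>U. (\<Sum>c<n. g i b c U) \<partial>P)"
    using g by (intro sum.cong refl Bochner_Integration.integral_sum Bochner_Integration.integrable_sum) auto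
  also have "\<dots> = (\<Sum>i\<in>I. \<Sum>b<n. \<Sum>c<n. \<integral>U. g i b c U \<partial>P)"
    using g by (intro sum.cong refl Bochner_Integration.integral_sum) auto
  also have "\<dots> = 0" using g by (intro sum.neutral ballI) auto
  finally have "0 = Re (\<integral>U. (\<Sum>i\<in>I. \<Sum>b<n. \<Sum>c<n. g i b c U) \<partial>P)" by simp
  also have "\<dots> = (\<integral>U. Re (\<Sum>i\<in>I. \<Sum>b<n. \<Sum>c<n. g i b c U) \<partial>P)"
    using g by (intro integral_Re[symmetric] Bochner_Integration.integrable_sum) auto
  also have "\<dots> \<ge> (\<integral>U. R U \<partial>P)"
  proof (rule integral_mono_AE)
    show "integrable P R" unfolding R_def[abs_def] by (intro Bochner_Integration.integrable_diff integrable_mult_right i1 i2 i3)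
    show "integrable P (\<lambda>U. Re (\<Sum>i\<in>I. \<Sum>b<n. \<Sum>c<n. g i b c U))"
      using g by (intro integrable_Re Bochner_Integration.integrable_sum) auto
    show "AE U in P. R U \<le> Re (\<Sum>i\<in>I. \<Sum>b<n. \<Sum>c<n. g i b c U)"
      using haar_AE_unitary(1)[OF P]
    proof eventually_elim
      case (elim U)
      have "(\<Sum>i\<in>I. \<Sum>b<n. \<Sum>c<n. g i b c U) = 
         (\<Sum>i\<in>I. (\<Sum>b<n. \<Sum>c<n. FF i c b b c U) * (cnj (f i U) * Fc U ^ p))
         - (\<Sum>i\<in>I. \<Sum>b<n. \<Sum>c<n. cnj (F i c b U) * F i c b U) * Fc U ^ p
         + of_nat p * Fc U ^ (p - 1) * (\<Sum>i\<in>I. \<Sum>b<n. \<Sum>c<n. cnj (f i U) * F i c b U * DF b c U)"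
        unfolding g_def by (simp add: sum.distrib sum_subtractf sum_negf sum_distrib_left sum_distrib_right algebra_simps)
      also have "(\<Sum>i\<in>I. (\<Sum>b<n. \<Sum>c<n. FF i c b b c U) * (cnj (f i U) * Fc U ^ p)) = of_real \<kappa> * Fc U ^ Suc p"
      proof -
        have "(\<Sum>i\<in>I. (\<Sum>b<n. \<Sum>c<n. FF i c b b c U) * (cnj (f i U) * Fc U ^ p))
            = (\<Sum>i\<in>I. of_real \<kappa> * (cnj (f i U) * f i U) * Fc U ^ p)"
          using lap[OF _ elim] by (intro sum.cong) (auto simp: algebra_simps)
        also have "\<dots> = of_real \<kappa> * (\<Sum>i\<in>I. cnj (f i U) * f i U) * Fc U ^ p"
          by (simp only: sum_distrib_left sum_distrib_right)
        finally show ?thesis unfolding Fc_def[symmetric] by simp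
      qed
      also have "(\<Sum>i\<in>I. \<Sum>b<n. \<Sum>c<n. cnj (F i c b U) * F i c b U) = ac U"
        unfolding ac_def by (rule sum.cong[OF refl], rule sum.swap)
      also have "(\<Sum>i\<in>I. \<Sum>b<n. \<Sum>c<n. cnj (f i U) * F i c b U * DF b c U) = (\<Sum>b<n. \<Sum>c<n. T c b U * DF b c U)"
        unfolding T_def sum_distrib_right by (subst sum.swap, rule sum.cong[OF refl], rule sum.swap)
      also have "\<dots> = (\<Sum>b<n. \<Sum>c<n. T c b U * T b c U) - tc U"
      proof -
        have "tc U = (\<Sum>b<n. \<Sum>c<n. cnj (T c b U) * T c b U)" unfolding tc_def by (rule sum.swap)
        then show ?thesis by (simp only: DF right_diff_distrib sum_subtractf mult.commute)
      qed
      finally have e: "(\<Sum>i\<in>I. \<Sum>b<n. \<Sum>c<n. g i b c U) = complex_of_real (\<kappa> * \<Phi> U ^ Suc p - a U * \<Phi> U ^ p)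
          + complex_of_real (real p * \<Phi> U ^ (p - 1)) * ((\<Sum>b<n. \<Sum>c<n. T c b U * T b c U) - complex_of_real (\<tau> U))"
        unfolding Fc ac tc of_real_diff of_real_mult of_real_power of_real_of_nat_eq .
      \<comment> \<open>The mixed products T c b * T b c cost at most another \<tau>, because \<tau>
        sums |T b c|^2 over all b and c. This is the factor 2 in the recursion.\<close>
      have "cmod (\<Sum>b<n. \<Sum>c<n. T c b U * T b c U) \<le> (\<Sum>b<n. \<Sum>c<n. ((cmod (T c b U))\<^sup>2 + (cmod (T b c U))\<^sup>2) / 2)"
      proof (intro sum_norm_le)
        fix b c
        show "cmod (T c b U * T b c U) \<le> ((cmod (T c b U))\<^sup>2 + (cmod (T b c U))\<^sup>2) / 2"
          using sum_squares_bound[of "cmod (T c b U)" "cmod (T b c U)"] by (simp add: norm_mult)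
      qed
      also have "\<dots> = \<tau> U"
      proof -
        have "(\<Sum>b<n. \<Sum>c<n. (cmod (T c b U))\<^sup>2) = \<tau> U" unfolding \<tau>_def T_def by (rule sum.swap)
        moreover have "(\<Sum>b<n. \<Sum>c<n. (cmod (T b c U))\<^sup>2) = \<tau> U" unfolding \<tau>_def T_def ..
        ultimately show ?thesis by (simp add: add_divide_distrib sum.distrib sum_divide_distrib[symmetric])
      qed
      finally have "Re (\<Sum>b<n. \<Sum>c<n. T c b U * T b c U) \<ge> - \<tau> U"
        using abs_Re_le_cmod[of "\<Sum>b<n. \<Sum>c<n. T c b U * T b c U"] by linarith
      moreover have "\<Phi> U \<ge> 0" unfolding \<Phi>_def by (intro sum_nonneg) auto
      ultimately have "real p * \<Phi> U ^ (p - 1) * (Re (\<Sum>b<n. \<Sum>c<n. T c b U * T b c U) - \<tau> U)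
          \<ge> real p * \<Phi> U ^ (p - 1) * (- 2 * \<tau> U)" by (intro mult_left_mono) auto
      then show ?case unfolding e R_def by (simp add: algebra_simps)
    qed
  qed
  finally have "0 \<ge> (\<integral>U. R U \<partial>P)" .
  also have "(\<integral>U. R U \<partial>P) = \<kappa> * (\<integral>U. \<Phi> U ^ Suc p \<partial>P) - (\<integral>U. a U * \<Phi> U ^ p \<partial>P) - 2 * real p * (\<integral>U. \<tau> U * \<Phi> U ^ (p - 1) \<partial>P)"
  proof -
    have A: "integrable P (\<lambda>U. \<kappa> * \<Phi> U ^ Suc p)" "integrable P (\<lambda>U. 2 * real p * (\<tau> U * \<Phi> U ^ (p - 1)))"
      by (intro integrable_mult_right i1 i3)+
    show ?thesis unfolding R_def Bochner_Integration.integral_diff[OF Bochner_Integration.integrable_diff[OF A(1) i2] A(2)]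
      Bochner_Integration.integral_diff[OF A(1) i2] integral_mult_right_zero ..
  qed
  finally show "\<kappa> * (\<integral>U. \<Phi> U ^ Suc p \<partial>P) \<le> (\<integral>U. a U * \<Phi> U ^ p \<partial>P) + 2 * real p * (\<integral>U. \<tau> U * \<Phi> U ^ (p - 1) \<partial>P)"
    by simp
qed

text \<open>The p-th moment is at most (\<rho> (K + p))^p. Markov's inequality for the p-th power,
  with p proportional to T, turns this into an exponential tail.\<close>

lemma (in prob_space) moment_recursion_tail:
  fixes X :: "'a \<Rightarrow> real"
  assumes X: "\<And>p. integrable M (\<lambda>x. X x ^ p)" and nn: "\<And>x. X x \<ge> 0"
    and rec: "\<And>p. (\<integral>x. X x ^ Suc p \<partial>M) \<le> \<rho> * (real K + real p) * (\<integral>x. X x ^ p \<partial>M)"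
    and \<rho>: "\<rho> > 0" and K: "K \<ge> 1" and T: "T \<ge> 12 * \<rho> * real K"
  shows "prob {x \<in> space M. X x \<ge> T} \<le> exp (- T / (12 * \<rho>))"
proof -
  \<comment> \<open>The base contains q instead of p, so that it stays fixed during the
    induction.\<close>
  have mom: "p \<le> q \<Longrightarrow> (\<integral>x. X x ^ p \<partial>M) \<le> (\<rho> * (real K + real q)) ^ p" for p q
  proof (induction p)
    case 0
    then show ?case by (simp add: prob_space)
  next
    case (Suc p)
    have "(\<integral>x. X x ^ Suc p \<partial>M) \<le> \<rho> * (real K + real p) * (\<integral>x. X x ^ p \<partial>M)" by (rule rec)
    also have "\<dots> \<le> \<rho> * (real K + real q) * (\<rho> * (real K + real q)) ^ p"
      using Suc \<rho> nn by (intro mult_mono) auto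
    finally show ?case by simp
  qed
  have T0: "T > 0" using T \<rho> K by (intro less_le_trans[OF _ T]) auto
  \<comment> \<open>With this p, T \<ge> 12 \<rho> K gives K \<le> p, so \<rho> (K + p) \<le> 2
    \<rho> p \<le> T / 3, and 1/3 is below exp (-1). Rounding down loses at most half of T / (6
    \<rho>), which is at least 2; hence the 12 in the rate.\<close>
  define p where "p = nat \<lfloor>T / (6 * \<rho>)\<rfloor>"
  have t: "T / (6 * \<rho>) \<ge> 2 * real K" using T \<rho> by (simp add: field_simps)
  have p1: "real p \<le> T / (6 * \<rho>)" "real p > T / (6 * \<rho>) - 1"
    using T0 \<rho> unfolding p_def by (simp_all add: of_nat_nat)
  have pK: "p \<ge> K" 
  proof -
    have "real K < real p + 1" using p1(2) t K by linarith
    then show ?thesis by linarith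
  qed
  have pT: "real p \<ge> T / (12 * \<rho>)"
  proof -
    have "T / (12 * \<rho>) = T / (6 * \<rho>) / 2" by simp
    moreover have "T / (6 * \<rho>) \<ge> 2" using t K by linarith
    ultimately show ?thesis using p1 by linarith
  qed
  have "{x \<in> space M. X x \<ge> T} = {x \<in> space M. X x ^ p \<ge> T ^ p}"
    using nn T0 pK K by (auto intro: power_mono simp: power_mono_iff)
  then have "prob {x \<in> space M. X x \<ge> T} \<le> (\<integral>x. X x ^ p \<partial>M) / T ^ p"
    using integral_Markov_inequality_measure[OF X[of p], of "{}" "T ^ p"] nn T0 by (simp add: )
  also have "\<dots> \<le> (\<rho> * (real K + real p)) ^ p / T ^ p" using mom[of p p] T0 by (intro divide_right_mono) auto
  also have "\<dots> = (\<rho> * (real K + real p) / T) ^ p" by (simp add: power_divide)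
  also have "\<dots> \<le> exp (-1) ^ p"
  proof (rule power_mono)
    have "\<rho> * (real K + real p) \<le> \<rho> * (2 * (T / (6 * \<rho>)))"
      using pK p1 \<rho> by (intro mult_left_mono) auto
    also have "\<dots> = T / 3" using \<rho> by simp
    finally have "\<rho> * (real K + real p) / T \<le> 1 / 3" using T0 by (simp add: field_simps)
    also have "1 / 3 \<le> exp (-1::real)" using exp_le by (simp add: exp_minus field_simps)
    finally show "\<rho> * (real K + real p) / T \<le> exp (-1)" .
  qed (use \<rho> T0 in auto)
  also have "\<dots> = exp (- real p)" by (simp add: exp_of_nat_mult[symmetric])
  also have "\<dots> \<le> exp (- T / (12 * \<rho>))" using pT by simp
  finally show ?thesis .
qed

section \<open>Concentration of quadratic corner matrices\<close>

text \<open>\<open>unitary_group\<close> records only orthonormal rows. Columns follow because a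
  right inverse of a square matrix is also a left inverse.\<close>

lemma unitary_group_columns:
  assumes U: "U \<in> unitary_group n" and ij: "i < n" "j < n"
  shows "(\<Sum>l<n. cnj (U l i) * U l j) = (if i = j then 1 else 0)"
proof -
  define A where "A = mat n n (\<lambda>(i, j). U i j)"
  define B where "B = mat n n (\<lambda>(i, j). cnj (U j i))"
  have A: "A \<in> carrier_mat n n" and B: "B \<in> carrier_mat n n" by (auto simp: A_def B_def)
  have "A * B = 1\<^sub>m n"
  proof (rule eq_matI)
    fix i j assume "i < dim_row (1\<^sub>m n :: complex mat)" "j < dim_col (1\<^sub>m n :: complex mat)"
    then show "(A * B) $$ (i, j) = 1\<^sub>m n $$ (i, j)"
      using unitary_group_rows[OF U, of i j] by (simp add: A_def B_def scalar_prod_def atLeast0LessThan)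
  qed (auto simp: A_def B_def)
  then have "B * A = 1\<^sub>m n" by (rule mat_mult_left_right_inverse[OF A B])
  then have "(B * A) $$ (i, j) = 1\<^sub>m n $$ (i, j)" by (simp only:)
  moreover have "(B * A) $$ (i, j) = (\<Sum>l<n. cnj (U l i) * U l j)"
    using ij unfolding A_def B_def by (simp add: scalar_prod_def lessThan_atLeast0)
  moreover have "1\<^sub>m n $$ (i, j) = (if i = j then 1 else (0::complex))" using ij by simp
  ultimately show ?thesis by (simp only:)
qed

lemma unitary_group_cnj: "U \<in> unitary_group n \<Longrightarrow> (\<lambda>i j. cnj (U i j)) \<in> unitary_group n"
proof -
  assume U: "U \<in> unitary_group n"
  have "(\<Sum>l<n. cnj (U i l) * U j l) = (if i = j then 1 else 0)" if "i < n" "j < n" for i j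
  proof -
    have "(\<Sum>l<n. cnj (U i l) * U j l) = (\<Sum>l<n. U j l * cnj (U i l))" by (intro sum.cong refl mult.commute)
    also have "\<dots> = (if j = i then 1 else 0)" by (rule unitary_group_rows[OF U that(2,1)])
    finally show ?thesis by (simp only: eq_commute[of j i])
  qed
  then show ?thesis using U by (auto simp: unitary_group_def)
qed

lemma unitary_group_adjoint: "U \<in> unitary_group n \<Longrightarrow> (\<lambda>i j. cnj (U j i)) \<in> unitary_group n"
  using unitary_group_columns[of U n] by (auto simp: unitary_group_def)

lemma unitary_isometry:
  assumes U: "U \<in> unitary_group n"
  shows "(\<Sum>i<n. (cmod (\<Sum>l<n. U i l * x l))\<^sup>2) = (\<Sum>l<n. (cmod (x l))\<^sup>2)"
proof -
  have sq: "complex_of_real ((cmod z)\<^sup>2) = cnj z * z" for z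
    by (metis complex_norm_square mult.commute)
  have "complex_of_real (\<Sum>i<n. (cmod (\<Sum>l<n. U i l * x l))\<^sup>2)
     = (\<Sum>i<n. \<Sum>l<n. \<Sum>m<n. cnj (x l) * x m * (cnj (U i l) * U i m))"
    by (simp only: of_real_sum sq cnj_sum sum_product complex_cnj_mult) (simp add: ac_simps)
  also have "\<dots> = (\<Sum>l<n. \<Sum>m<n. \<Sum>i<n. cnj (x l) * x m * (cnj (U i l) * U i m))"
    by (subst sum.swap, rule sum.cong[OF refl], rule sum.swap)
  also have "\<dots> = (\<Sum>l<n. \<Sum>m<n. cnj (x l) * x m * (if l = m then 1 else 0))"
    using unitary_group_columns[OF U] by (intro sum.cong refl) (simp add: sum_distrib_left[symmetric])
  also have "\<dots> = (\<Sum>l<n. cnj (x l) * x l)"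
    by (intro sum.cong) (auto simp: if_distrib cong: if_cong)
  also have "\<dots> = complex_of_real (\<Sum>l<n. (cmod (x l))\<^sup>2)" by (simp add: sq del: of_real_power)
  finally show ?thesis by (simp only: of_real_eq_iff)
qed

text \<open>U diag(d) W^T is a product of two isometries and a diagonal matrix of norm at most
  \<Delta>. \<open>W = cnj U\<close> gives the Hermitian and \<open>W = U\<close> the symmetric
  quadratic matrix.\<close>

lemma unitary_conjugation_bound:
  assumes U: "U \<in> unitary_group n" and W: "W \<in> unitary_group n" and d: "\<And>j. j < n \<Longrightarrow> \<bar>d j\<bar> \<le> \<Delta>"
  shows "(\<Sum>i<n. (cmod (\<Sum>t<n. (\<Sum>j<n. U i j * complex_of_real (d j) * W t j) * y t))\<^sup>2) \<le> \<Delta>\<^sup>2 * (\<Sum>t<n. (cmod (y t))\<^sup>2)"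
proof -
  define w where "w j = (\<Sum>t<n. W t j * y t)" for j
  have "(\<Sum>t<n. (\<Sum>j<n. U i j * complex_of_real (d j) * W t j) * y t) = (\<Sum>j<n. U i j * (complex_of_real (d j) * w j))" for i
    unfolding w_def sum_distrib_left sum_distrib_right by (subst sum.swap) (simp add: mult.assoc)
  then have "(\<Sum>i<n. (cmod (\<Sum>t<n. (\<Sum>j<n. U i j * complex_of_real (d j) * W t j) * y t))\<^sup>2)
     = (\<Sum>j<n. (cmod (complex_of_real (d j) * w j))\<^sup>2)"
    using unitary_isometry[OF U] by simp
  also have "\<dots> \<le> (\<Sum>j<n. \<Delta>\<^sup>2 * (cmod (w j))\<^sup>2)"
    using d by (intro sum_mono) (auto simp: norm_mult power_mult_distrib intro!: mult_right_mono power2_le_iff_abs_le[THEN iffD2] dest: order.trans[OF abs_ge_zero])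
  also have "\<dots> = \<Delta>\<^sup>2 * (\<Sum>t<n. (cmod (y t))\<^sup>2)"
    using unitary_isometry[OF unitary_group_cnj[OF unitary_group_adjoint[OF W]], of y]
    by (simp add: w_def sum_distrib_left[symmetric])
  finally show ?thesis .
qed

section \<open>The Hermitian and the symmetric quadratic matrix\<close>

definition herm_quad :: "nat \<Rightarrow> (nat \<Rightarrow> real) \<Rightarrow> cmatf \<Rightarrow> nat \<Rightarrow> nat \<Rightarrow> complex" where
  "herm_quad n d U s t = (\<Sum>j<n. U s j * complex_of_real (d j) * cnj (U t j))"

definition sym_quad :: "nat \<Rightarrow> (nat \<Rightarrow> real) \<Rightarrow> cmatf \<Rightarrow> nat \<Rightarrow> nat \<Rightarrow> complex" where
  "sym_quad n d U s t = (\<Sum>j<n. U s j * complex_of_real (d j) * U t j)"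

lemma cnj_herm_quad: "cnj (herm_quad n d U s t) = herm_quad n d U t s"
  by (simp add: herm_quad_def ac_simps)

lemma sym_quad_commute: "sym_quad n d U s t = sym_quad n d U t s"
  by (simp add: sym_quad_def ac_simps)

lemma herm_quad_op:
  assumes "U \<in> unitary_group n" "\<And>j. j < n \<Longrightarrow> \<bar>d j\<bar> \<le> \<Delta>"
  shows "(\<Sum>i<n. (cmod (\<Sum>t<n. herm_quad n d U i t * y t))\<^sup>2) \<le> \<Delta>\<^sup>2 * (\<Sum>t<n. (cmod (y t))\<^sup>2)"
  unfolding herm_quad_def by (rule unitary_conjugation_bound[OF assms(1) unitary_group_cnj[OF assms(1)] assms(2)])

lemma sym_quad_op:
  assumes "U \<in> unitary_group n" "\<And>j. j < n \<Longrightarrow> \<bar>d j\<bar> \<le> \<Delta>"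
  shows "(\<Sum>i<n. (cmod (\<Sum>t<n. sym_quad n d U i t * y t))\<^sup>2) \<le> \<Delta>\<^sup>2 * (\<Sum>t<n. (cmod (y t))\<^sup>2)"
  unfolding sym_quad_def by (rule unitary_conjugation_bound[OF assms(1) assms(1) assms(2)])

text \<open>For e = d^2 this is the squared norm of row s of either quadratic matrix. Pointwise it
  is bounded by the maximum of e, but its Haar mean is the average of e; through the latter the
  energy enters.\<close>

definition row_weight :: "nat \<Rightarrow> (nat \<Rightarrow> real) \<Rightarrow> cmatf \<Rightarrow> nat \<Rightarrow> real" where
  "row_weight n e U s = (\<Sum>j<n. e j * (cmod (U s j))\<^sup>2)"

lemma row_weight_le:
  assumes U: "U \<in> unitary_group n" and s: "s < n" and d: "\<And>j. j < n \<Longrightarrow> e j \<le> D"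
  shows "row_weight n e U s \<le> D"
proof -
  have "(\<Sum>l<n. U s l * cnj (U s l)) = 1" using unitary_group_rows[OF U s s] by simp
  then have "complex_of_real (\<Sum>l<n. (cmod (U s l))\<^sup>2) = complex_of_real 1"
    by (simp add: complex_norm_square del: of_real_power)
  then have 1: "(\<Sum>l<n. (cmod (U s l))\<^sup>2) = 1" by (simp only: of_real_eq_iff)
  have "row_weight n e U s \<le> (\<Sum>l<n. D * (cmod (U s l))\<^sup>2)"
    unfolding row_weight_def using d by (intro sum_mono mult_right_mono) auto
  then show ?thesis using 1 by (simp add: sum_distrib_left[symmetric])
qed

lemma herm_quad_row:
  assumes "U \<in> unitary_group n" "s < n"
  shows "(\<Sum>c<n. (cmod (herm_quad n d U s c))\<^sup>2) = row_weight n (\<lambda>j. (d j)\<^sup>2) U s"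
proof -
  have "herm_quad n d U s c = (\<Sum>j<n. cnj (U c j) * (complex_of_real (d j) * U s j))" for c
    by (simp add: herm_quad_def ac_simps)
  then show ?thesis
    using unitary_isometry[OF unitary_group_cnj[OF assms(1)], of "\<lambda>j. complex_of_real (d j) * U s j"]
    by (simp add: row_weight_def norm_mult power_mult_distrib)
qed

lemma sym_quad_row:
  assumes "U \<in> unitary_group n" "s < n"
  shows "(\<Sum>c<n. (cmod (sym_quad n d U s c))\<^sup>2) = row_weight n (\<lambda>j. (d j)\<^sup>2) U s"
proof -
  have "sym_quad n d U s c = (\<Sum>j<n. U c j * (complex_of_real (d j) * U s j))" for c
    by (simp add: sym_quad_def ac_simps)
  then show ?thesis
    using unitary_isometry[OF assms(1), of "\<lambda>j. complex_of_real (d j) * U s j"]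
    by (simp add: row_weight_def norm_mult power_mult_distrib)
qed

lemma herm_quad_trace:
  assumes U: "U \<in> unitary_group n"
  shows "(\<Sum>b<n. herm_quad n d U b b) = complex_of_real (\<Sum>j<n. d j)"
proof -
  have "(\<Sum>b<n. herm_quad n d U b b) = (\<Sum>j<n. \<Sum>b<n. complex_of_real (d j) * (cnj (U b j) * U b j))"
    unfolding herm_quad_def by (subst sum.swap) (simp add: ac_simps)
  also have "\<dots> = (\<Sum>j<n. complex_of_real (d j))"
    using unitary_group_columns[OF U] by (simp add: sum_distrib_left[symmetric])
  finally show ?thesis by simp
qed

section \<open>Action of the derivations on the quadratic matrices\<close>

definition herm_quad_D where
  "herm_quad_D n d s t b c U = (if s = b then herm_quad n d U c t else 0) - (if t = c then herm_quad n d U s b else 0)"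

definition sym_quad_D where
  "sym_quad_D n d s t b c U = (if s = b then sym_quad n d U c t else 0) + (if t = b then sym_quad n d U s c else 0)"

text \<open>Left multiplication of U acts on A = U d U^* by conjugation, so the derivative is the
  commutator of E_bc with A. For A = U d U^T it is E_bc A + A (E_bc)^T, which is
  \<open>sym_quad_D\<close>.\<close>

lemma polyd_herm_quad:
  assumes "s < n" "t < n"
  shows "polyd n (\<lambda>U. herm_quad n d U s t) (herm_quad_D n d s t)"
proof -
  have "polyd n (\<lambda>U. herm_quad n d U s t) (\<lambda>b c U. \<Sum>j<n. ((if s = b then U c j else 0) * complex_of_real (d j) + U s j * 0) * cnj (U t j)
      + U s j * complex_of_real (d j) * (if t = c then - cnj (U b j) else 0))"
    unfolding herm_quad_def using assms by (intro polyd_sum polyd.mult polyd.entry polyd.cnj_entry polyd.const) auto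
  then show ?thesis
    by (rule polyd_cong) (auto simp: herm_quad_D_def herm_quad_def sum.distrib sum_negf)
qed

lemma polyd_sym_quad:
  assumes "s < n" "t < n"
  shows "polyd n (\<lambda>U. sym_quad n d U s t) (sym_quad_D n d s t)"
proof -
  have "polyd n (\<lambda>U. sym_quad n d U s t) (\<lambda>b c U. \<Sum>j<n. ((if s = b then U c j else 0) * complex_of_real (d j) + U s j * 0) * U t j
      + U s j * complex_of_real (d j) * (if t = b then U c j else 0))"
    unfolding sym_quad_def using assms by (intro polyd_sum polyd.mult polyd.entry polyd.const) auto
  then show ?thesis
    by (rule polyd_cong) (auto simp: sym_quad_D_def sym_quad_def sum.distrib)
qed

definition herm_quad_DD where
  "herm_quad_DD n d s t b c b' c' U =
     (if s = b then herm_quad_D n d c t b' c' U else 0) - (if t = c then herm_quad_D n d s b b' c' U else 0)"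

definition sym_quad_DD where
  "sym_quad_DD n d s t b c b' c' U =
     (if s = b then sym_quad_D n d c t b' c' U else 0) + (if t = b then sym_quad_D n d s c b' c' U else 0)"

lemma polyd_if:
  assumes "p \<Longrightarrow> polyd n f F"
  shows "polyd n (\<lambda>U. if p then f U else 0) (\<lambda>b c U. if p then F b c U else 0)"
  using assms polyd.const[of n 0] by (cases p) (simp_all only: if_True if_False)

lemma polyd_herm_quad_D:
  assumes "s < n" "t < n" "b < n" "c < n"
  shows "polyd n (herm_quad_D n d s t b c) (herm_quad_DD n d s t b c)"
proof -
  have "herm_quad_D n d s t b c = (\<lambda>U. (if s = b then herm_quad n d U c t else 0) - (if t = c then herm_quad n d U s b else 0))"
    by (rule ext) (simp add: herm_quad_D_def)
  then show ?thesis
    unfolding herm_quad_DD_def[abs_def] using assms by (simp only:) (intro polyd_diff polyd_if polyd_herm_quad)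
qed

lemma polyd_sym_quad_D:
  assumes "s < n" "t < n" "b < n" "c < n"
  shows "polyd n (sym_quad_D n d s t b c) (sym_quad_DD n d s t b c)"
proof -
  have "sym_quad_D n d s t b c = (\<lambda>U. (if s = b then sym_quad n d U c t else 0) + (if t = b then sym_quad n d U s c else 0))"
    by (rule ext) (simp add: sym_quad_D_def)
  then show ?thesis
    unfolding sym_quad_DD_def[abs_def] using assms by (simp only:) (intro polyd.add polyd_if polyd_sym_quad)
qed

text \<open>The double commutator of A with E_bc and E_cb, summed over b and c, is 2 n A - 2 tr(A)
  1. The diagonal entries become eigenfunctions because the trace vanishes; this is why the mean
  energy is subtracted from the diagonal.\<close>

lemma herm_quad_laplacian:
  assumes U: "U \<in> unitary_group n" and "s < n" "t < n" and d: "(\<Sum>j<n. d j) = 0"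
  shows "(\<Sum>b<n. \<Sum>c<n. herm_quad_DD n d s t c b b c U) = complex_of_real (2 * real n) * herm_quad n d U s t"
proof -
  let ?A = "herm_quad n d U"
  have "(\<Sum>b<n. \<Sum>c<n. herm_quad_DD n d s t c b b c U) =
    (\<Sum>b<n. \<Sum>c<n. (if c = s then ?A s t - (if s = t then ?A b b else 0) else 0)
       - (if b = t then (if s = t then ?A c c else 0) - ?A s t else 0))"
    by (intro sum.cong refl) (auto simp: herm_quad_DD_def herm_quad_D_def)
  also have "\<dots> = (\<Sum>b<n. ?A s t - (if s = t then ?A b b else 0)) - (\<Sum>c<n. (if s = t then ?A c c else 0) - ?A s t)"
  proof -
    have "(\<Sum>b<n. \<Sum>c<n. (if b = t then (if s = t then ?A c c else 0) - ?A s t else 0)) =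
      (\<Sum>c<n. \<Sum>b<n. (if b = t then (if s = t then ?A c c else 0) - ?A s t else 0))" by (rule sum.swap)
    then show ?thesis using assms by (simp add: sum_subtractf)
  qed
  also have "\<dots> = 2 * of_nat n * ?A s t"
    using herm_quad_trace[OF U, of d] d by (cases "s = t") (simp_all add: sum_subtractf)
  finally show ?thesis by simp
qed

text \<open>Each of the two indices contributes n A, and the mixed terms exchange the indices;
  symmetry of A turns these into another 2 A. No trace has to be removed here.\<close>

lemma sym_quad_laplacian:
  assumes "s < n" "t < n"
  shows "(\<Sum>b<n. \<Sum>c<n. sym_quad_DD n d s t c b b c U) = complex_of_real (2 * real n + 2) * sym_quad n d U s t"
proof -
  let ?A = "sym_quad n d U"
  have "(\<Sum>b<n. \<Sum>c<n. sym_quad_DD n d s t c b b c U) =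
    (\<Sum>b<n. \<Sum>c<n. (if c = s then ?A s t + (if b = t then ?A t s else 0) else 0)
       + (if c = t then (if b = s then ?A t s else 0) + ?A s t else 0))"
    by (intro sum.cong refl) (auto simp: sym_quad_DD_def sym_quad_D_def)
  also have "\<dots> = (\<Sum>b<n. ?A s t + (if b = t then ?A t s else 0)) + (\<Sum>b<n. (if b = s then ?A t s else 0) + ?A s t)"
    using assms by (simp add: sum.distrib)
  also have "\<dots> = (2 * of_nat n + 2) * ?A s t"
    using assms sym_quad_commute[of n d U t s] by (simp add: sum.distrib algebra_simps)
  finally show ?thesis by simp
qed


text \<open>The derivative of the entry (s, b) along (s, b) is the difference of the diagonal
  entries b and s, so all diagonal entries have the same mean; their sum is the constant
  trace.\<close>

lemma haar_row_weight:
  assumes P: "haar_unitary n P" and s: "s < n"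
  shows "integrable P (\<lambda>U. row_weight n e U s)" "(\<integral>U. row_weight n e U s \<partial>P) = (\<Sum>j<n. e j) / real n"
proof -
  interpret prob_space P using haar_AE_unitary[OF P] by simp
  have Re: "row_weight n e U s = Re (herm_quad n e U s s)" for U s
    unfolding row_weight_def herm_quad_def Re_sum
    by (intro sum.cong refl) (simp add: cmod_power2, simp add: power2_eq_square algebra_simps)
  have int: "integrable P (\<lambda>U. herm_quad n e U s s)" if "s < n" for s
    by (rule polyd_integrable(1)[OF P polyd_herm_quad[OF that that]])
  show i: "integrable P (\<lambda>U. row_weight n e U s)" unfolding Re using int[OF s] by simp
  have eq: "(\<integral>U. herm_quad n e U b b \<partial>P) = (\<integral>U. herm_quad n e U s s \<partial>P)" if b: "b < n" for b
  proof (cases "b = s")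
    case False
    have "(\<integral>U. herm_quad_D n e s b s b U \<partial>P) = 0"
      by (rule haar_integral_deriv_eq_0[OF P polyd_herm_quad[OF s b] s b])
    then show ?thesis using False int[OF s] int[OF b] by (simp add: herm_quad_D_def)
  qed simp
  have "(\<Sum>b<n. \<integral>U. herm_quad n e U b b \<partial>P) = (\<integral>U. (\<Sum>b<n. herm_quad n e U b b) \<partial>P)"
    using int by (intro Bochner_Integration.integral_sum[symmetric]) auto
  also have "\<dots> = (\<integral>U. complex_of_real (\<Sum>j<n. e j) \<partial>P)"
  proof (rule integral_cong_AE)
    show "(\<lambda>U. \<Sum>b<n. herm_quad n e U b b) \<in> borel_measurable P"
      using int by (intro borel_measurable_integrable Bochner_Integration.integrable_sum) auto
    show "AE U in P. (\<Sum>b<n. herm_quad n e U b b) = complex_of_real (\<Sum>j<n. e j)"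
      using haar_AE_unitary(1)[OF P] herm_quad_trace by auto
  qed simp
  also have "\<dots> = complex_of_real (\<Sum>j<n. e j)" using prob_space by simp
  finally have "of_nat n * (\<integral>U. herm_quad n e U s s \<partial>P) = complex_of_real (\<Sum>j<n. e j)" using eq by simp
  then have "Re (of_nat n * (\<integral>U. herm_quad n e U s s \<partial>P)) = (\<Sum>j<n. e j)" by (simp only: Re_complex_of_real)
  then have "real n * Re (\<integral>U. herm_quad n e U s s \<partial>P) = (\<Sum>j<n. e j)" by simp
  moreover have "(\<integral>U. row_weight n e U s \<partial>P) = Re (\<integral>U. herm_quad n e U s s \<partial>P)"
    unfolding Re by (rule integral_Re[OF int[OF s]])
  ultimately show "(\<integral>U. row_weight n e U s \<partial>P) = (\<Sum>j<n. e j) / real n" using s by (simp add: field_simps)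
qed

text \<open>The analysis common to both quadratic matrices. The gradient bound is used twice: with
  row weights at most \<Delta>^2 for all moments, and with averaged row weights at p = 0, where the
  mean comes out proportional to the sum of d^2 instead of n \<Delta>^2. The eigenvalue is only
  bounded below, since it is 2 n in one case and 2 n + 2 in the other.\<close>

lemma quadratic_moments:
  fixes f :: "'i \<Rightarrow> cmatf \<Rightarrow> complex" and \<kappa> :: real
  assumes P: "haar_unitary n P" and I: "finite I"
    and F: "\<And>i. i \<in> I \<Longrightarrow> polyd n (f i) (F i)"
    and FF: "\<And>i b c. i \<in> I \<Longrightarrow> b < n \<Longrightarrow> c < n \<Longrightarrow> polyd n (F i b c) (FF i b c)"
    and lap: "\<And>i U. i \<in> I \<Longrightarrow> U \<in> unitary_group n \<Longrightarrow>
        (\<Sum>b<n. \<Sum>c<n. FF i c b b c U) = complex_of_real \<kappa> * f i U"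
    and \<kappa>: "\<kappa> \<ge> 2 * real n" and k: "1 \<le> k" "k \<le> n"
    and d: "\<And>j. j < n \<Longrightarrow> \<bar>d j\<bar> \<le> \<Delta>" and \<Delta>: "\<Delta> > 0"
    and a_le: "\<And>U. U \<in> unitary_group n \<Longrightarrow> (\<Sum>i\<in>I. \<Sum>b<n. \<Sum>c<n. (cmod (F i b c U))\<^sup>2)
        \<le> 4 * real k * (\<Sum>s<k. row_weight n (\<lambda>j. (d j)\<^sup>2) U s)"
    and \<tau>_le: "\<And>U. U \<in> unitary_group n \<Longrightarrow> (\<Sum>b<n. \<Sum>c<n. (cmod (\<Sum>i\<in>I. cnj (f i U) * F i b c U))\<^sup>2)
        \<le> 4 * \<Delta>\<^sup>2 * (\<Sum>i\<in>I. (cmod (f i U))\<^sup>2)"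
  shows "integrable P (\<lambda>U. \<Sum>i\<in>I. (cmod (f i U))\<^sup>2)"
    "(\<integral>U. (\<Sum>i\<in>I. (cmod (f i U))\<^sup>2) \<partial>P) \<le> 2 * (real k)\<^sup>2 / (real n)\<^sup>2 * (\<Sum>j<n. (d j)\<^sup>2)"
    "T \<ge> 48 * \<Delta>\<^sup>2 * (real k)\<^sup>2 / real n \<Longrightarrow>
      measure P {U. (\<Sum>i\<in>I. (cmod (f i U))\<^sup>2) \<ge> T} \<le> exp (- T * real n / (48 * \<Delta>\<^sup>2))"
proof -
  interpret prob_space P using haar_AE_unitary[OF P] by simp
  have s: "sets P = sets borel" using haar_AE_unitary[OF P] by simp
  have sp: "space P = UNIV" using sets_eq_imp_space_eq[OF s] by simp
  define \<Phi> where "\<Phi> U = (\<Sum>i\<in>I. (cmod (f i U))\<^sup>2)" for U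
  define a where "a U = (\<Sum>i\<in>I. \<Sum>b<n. \<Sum>c<n. (cmod (F i b c U))\<^sup>2)" for U
  define \<tau> where "\<tau> U = (\<Sum>b<n. \<Sum>c<n. (cmod (\<Sum>i\<in>I. cnj (f i U) * F i b c U))\<^sup>2)" for U
  note mr = moment_recursion[where n=n and P=P and I=I and f=f and F=F and FF=FF and \<kappa>=\<kappa>, OF P I F FF lap, folded \<Phi>_def a_def \<tau>_def]
  have i1: "integrable P (\<lambda>U. \<Phi> U ^ p)" for p using mr(1) by simp
  have i2: "integrable P (\<lambda>U. a U * \<Phi> U ^ p)" for p using mr(2) by simp
  have i3: "integrable P (\<lambda>U. \<tau> U * \<Phi> U ^ p)" for p using mr(3) by simp
  have rec: "\<kappa> * (\<integral>U. \<Phi> U ^ Suc p \<partial>P) \<le> (\<integral>U. a U * \<Phi> U ^ p \<partial>P) + 2 * real p * (\<integral>U. \<tau> U * \<Phi> U ^ (p - 1) \<partial>P)" for p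
    using mr(4) by simp
  have nn: "\<Phi> U \<ge> 0" for U unfolding \<Phi>_def by (intro sum_nonneg) auto
  have n: "real n > 0" using k by simp
  have low: "2 * real n * (\<integral>U. \<Phi> U ^ Suc p \<partial>P) \<le> \<kappa> * (\<integral>U. \<Phi> U ^ Suc p \<partial>P)" for p
    using \<kappa> nn by (intro mult_right_mono integral_nonneg_AE) auto
  \<comment> \<open>The gradient and contraction terms add up to 4 k^2 \<Delta>^2 + 8 p \<Delta>^2.
    Enlarging 4 k^2 to 8 k^2 and dividing by 2 n gives the form k^2 + p.\<close>
  have rec': "(\<integral>U. \<Phi> U ^ Suc p \<partial>P) \<le> (4 * \<Delta>\<^sup>2 / real n) * (real (k\<^sup>2) + real p) * (\<integral>U. \<Phi> U ^ p \<partial>P)" for p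
  proof -
    have "(\<integral>U. a U * \<Phi> U ^ p \<partial>P) \<le> (\<integral>U. 4 * (real k)\<^sup>2 * \<Delta>\<^sup>2 * \<Phi> U ^ p \<partial>P)"
    proof (rule integral_mono_AE[OF i2])
      show "integrable P (\<lambda>U. 4 * (real k)\<^sup>2 * \<Delta>\<^sup>2 * \<Phi> U ^ p)" using i1 by simp
      show "AE U in P. a U * \<Phi> U ^ p \<le> 4 * (real k)\<^sup>2 * \<Delta>\<^sup>2 * \<Phi> U ^ p"
        using haar_AE_unitary(1)[OF P]
      proof eventually_elim
        case (elim U)
        have "(d j)\<^sup>2 \<le> \<Delta>\<^sup>2" if "j < n" for j using d[OF that] \<Delta> by (simp add: abs_le_square_iff[symmetric])
        then have "row_weight n (\<lambda>j. (d j)\<^sup>2) U s \<le> \<Delta>\<^sup>2" if "s < k" for s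
          using that k by (intro row_weight_le[OF elim]) auto
        then have "(\<Sum>s<k. row_weight n (\<lambda>j. (d j)\<^sup>2) U s) \<le> (\<Sum>s<k. \<Delta>\<^sup>2)" by (intro sum_mono) auto
        then have "4 * real k * (\<Sum>s<k. row_weight n (\<lambda>j. (d j)\<^sup>2) U s) \<le> 4 * real k * (real k * \<Delta>\<^sup>2)"
          by (intro mult_left_mono) auto
        then have "a U \<le> 4 * (real k)\<^sup>2 * \<Delta>\<^sup>2" using a_le[OF elim] unfolding a_def by (simp add: power2_eq_square)
        then show ?case using nn[of U] by (intro mult_right_mono) auto
      qed
    qed
    also have "\<dots> = 4 * (real k)\<^sup>2 * \<Delta>\<^sup>2 * (\<integral>U. \<Phi> U ^ p \<partial>P)" by simp
    finally have A: "(\<integral>U. a U * \<Phi> U ^ p \<partial>P) \<le> 4 * (real k)\<^sup>2 * \<Delta>\<^sup>2 * (\<integral>U. \<Phi> U ^ p \<partial>P)" .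
    have B: "2 * real p * (\<integral>U. \<tau> U * \<Phi> U ^ (p - 1) \<partial>P) \<le> 2 * real p * (4 * \<Delta>\<^sup>2 * (\<integral>U. \<Phi> U ^ p \<partial>P))"
    proof (cases "p = 0")
      case False
      have "(\<integral>U. \<tau> U * \<Phi> U ^ (p - 1) \<partial>P) \<le> (\<integral>U. 4 * \<Delta>\<^sup>2 * \<Phi> U ^ p \<partial>P)"
      proof (rule integral_mono_AE[OF i3])
        show "integrable P (\<lambda>U. 4 * \<Delta>\<^sup>2 * \<Phi> U ^ p)" using i1 by simp
        show "AE U in P. \<tau> U * \<Phi> U ^ (p - 1) \<le> 4 * \<Delta>\<^sup>2 * \<Phi> U ^ p"
          using haar_AE_unitary(1)[OF P]
        proof eventually_elim
          case (elim U)
          have "\<tau> U * \<Phi> U ^ (p - 1) \<le> (4 * \<Delta>\<^sup>2 * \<Phi> U) * \<Phi> U ^ (p - 1)"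
            using \<tau>_le[OF elim] nn[of U] unfolding \<tau>_def \<Phi>_def by (intro mult_right_mono) auto
          also have "\<dots> = 4 * \<Delta>\<^sup>2 * \<Phi> U ^ p" using False by (simp add: power_eq_if)
          finally show ?case .
        qed
      qed
      also have "\<dots> = 4 * \<Delta>\<^sup>2 * (\<integral>U. \<Phi> U ^ p \<partial>P)" by simp
      finally show ?thesis by (intro mult_left_mono) auto
    qed simp
    have I: "(\<integral>U. \<Phi> U ^ p \<partial>P) \<ge> 0" using nn by (intro integral_nonneg_AE) auto
    have "2 * real n * (\<integral>U. \<Phi> U ^ Suc p \<partial>P) \<le> (4 * (real k)\<^sup>2 * \<Delta>\<^sup>2 + 8 * real p * \<Delta>\<^sup>2) * (\<integral>U. \<Phi> U ^ p \<partial>P)"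
      using low[of p] rec[of p] A B by (simp add: algebra_simps)
    also have "\<dots> \<le> (8 * (real k)\<^sup>2 * \<Delta>\<^sup>2 + 8 * real p * \<Delta>\<^sup>2) * (\<integral>U. \<Phi> U ^ p \<partial>P)"
      using I by (intro mult_right_mono) auto
    finally show ?thesis using n by (simp add: field_simps)
  qed
  show "integrable P (\<lambda>U. \<Sum>i\<in>I. (cmod (f i U))\<^sup>2)" using i1[of 1] by (simp add: \<Phi>_def)
  show "(\<integral>U. (\<Sum>i\<in>I. (cmod (f i U))\<^sup>2) \<partial>P) \<le> 2 * (real k)\<^sup>2 / (real n)\<^sup>2 * (\<Sum>j<n. (d j)\<^sup>2)"
  proof -
    have rw: "integrable P (\<lambda>U. row_weight n (\<lambda>j. (d j)\<^sup>2) U s)" if "s < k" for s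
      using haar_row_weight(1)[OF P, of s] that k by auto
    have "2 * real n * (\<integral>U. \<Phi> U \<partial>P) \<le> (\<integral>U. a U \<partial>P)" using low[of 0] rec[of 0] by simp
    also have "\<dots> \<le> (\<integral>U. 4 * real k * (\<Sum>s<k. row_weight n (\<lambda>j. (d j)\<^sup>2) U s) \<partial>P)"
    proof (rule integral_mono_AE)
      show "integrable P a" using i2[of 0] by simp
      show "integrable P (\<lambda>U. 4 * real k * (\<Sum>s<k. row_weight n (\<lambda>j. (d j)\<^sup>2) U s))"
        using rw by (intro integrable_mult_right Bochner_Integration.integrable_sum) auto
      show "AE U in P. a U \<le> 4 * real k * (\<Sum>s<k. row_weight n (\<lambda>j. (d j)\<^sup>2) U s)"
        using haar_AE_unitary(1)[OF P] by eventually_elim (use a_le in \<open>auto simp: a_def\<close>)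
    qed
    also have "\<dots> = 4 * real k * (\<Sum>s<k. \<integral>U. row_weight n (\<lambda>j. (d j)\<^sup>2) U s \<partial>P)"
      using rw by (subst Bochner_Integration.integral_sum[symmetric]) auto
    also have "(\<Sum>s<k. \<integral>U. row_weight n (\<lambda>j. (d j)\<^sup>2) U s \<partial>P) = (\<Sum>s<k. (\<Sum>j<n. (d j)\<^sup>2) / real n)"
      using haar_row_weight(2)[OF P] k by (intro sum.cong) auto
    finally show ?thesis using n unfolding \<Phi>_def by (simp add: field_simps power2_eq_square)
  qed
  assume T: "T \<ge> 48 * \<Delta>\<^sup>2 * (real k)\<^sup>2 / real n"
  \<comment> \<open>Here \<rho> = 4 \<Delta>^2 / n and K = k^2, so 12 \<rho> is the 48 \<Delta>^2 /
    n of the claim.\<close>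
  have "prob {x \<in> space P. \<Phi> x \<ge> T} \<le> exp (- T / (12 * (4 * \<Delta>\<^sup>2 / real n)))"
  proof (rule moment_recursion_tail[OF i1 nn rec'])
    show "4 * \<Delta>\<^sup>2 / real n > 0" using \<Delta> n by simp
    show "1 \<le> k\<^sup>2" using k by simp
    show "12 * (4 * \<Delta>\<^sup>2 / real n) * real (k\<^sup>2) \<le> T" using T by simp
  qed
  then show "measure P {U. (\<Sum>i\<in>I. (cmod (f i U))\<^sup>2) \<ge> T} \<le> exp (- T * real n / (48 * \<Delta>\<^sup>2))"
    using n by (simp add: sp \<Phi>_def)
qed


section \<open>Gradient and contraction bounds on the corner\<close>

lemma sum_square_index: "(\<Sum>i\<in>{..<k} \<times> {..<k}. g (fst i) (snd i)) = (\<Sum>s<k. \<Sum>t<k. g s t)"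
  by (simp add: sum.cartesian_product split_def)

lemma sum_block_extend:
  assumes "k \<le> (n::nat)"
  shows "(\<Sum>t<n. if t < k then g t else 0) = (\<Sum>t<k. g t)"
proof -
  have "(\<Sum>t<k. g t) = (\<Sum>t<k. if t < k then g t else 0)" by (intro sum.cong) auto
  also have "\<dots> = (\<Sum>t<n. if t < k then g t else 0)" using assms by (intro sum.mono_neutral_left) auto
  finally show ?thesis ..
qed

lemma cmod_add_sq_le: "(cmod (x + y))\<^sup>2 \<le> 2 * (cmod x)\<^sup>2 + 2 * (cmod y)\<^sup>2"
proof -
  have "(cmod (x + y))\<^sup>2 \<le> (cmod x + cmod y)\<^sup>2" by (intro power_mono norm_triangle_ineq) auto
  also have "\<dots> \<le> 2 * (cmod x)\<^sup>2 + 2 * (cmod y)\<^sup>2" using sum_squares_bound[of "cmod x" "cmod y"] by (simp add: power2_sum)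
  finally show ?thesis .
qed

text \<open>The derivatives of the entry (s, t) involve only rows s and t of the full matrix.
  Summing 2 w t + 2 w s over the k^2 pairs counts each row weight 4 k times.\<close>

lemma block_gradient_bound:
  fixes X :: "nat \<Rightarrow> nat \<Rightarrow> complex" and D :: "nat \<Rightarrow> nat \<Rightarrow> nat \<Rightarrow> nat \<Rightarrow> complex"
  assumes k: "k \<le> n" and row: "\<And>s. s < n \<Longrightarrow> (\<Sum>c<n. (cmod (X s c))\<^sup>2) = w s"
    and D: "\<And>s t. s < k \<Longrightarrow> t < k \<Longrightarrow> (\<Sum>b<n. \<Sum>c<n. (cmod (D s t b c))\<^sup>2)
       \<le> 2 * (\<Sum>c<n. (cmod (X t c))\<^sup>2) + 2 * (\<Sum>c<n. (cmod (X s c))\<^sup>2)"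
  shows "(\<Sum>i\<in>{..<k} \<times> {..<k}. \<Sum>b<n. \<Sum>c<n. (cmod (D (fst i) (snd i) b c))\<^sup>2) \<le> 4 * real k * (\<Sum>s<k. w s)"
proof -
  have "(\<Sum>i\<in>{..<k} \<times> {..<k}. \<Sum>b<n. \<Sum>c<n. (cmod (D (fst i) (snd i) b c))\<^sup>2)
     = (\<Sum>s<k. \<Sum>t<k. \<Sum>b<n. \<Sum>c<n. (cmod (D s t b c))\<^sup>2)"
    by (rule sum_square_index[of "\<lambda>s t. \<Sum>b<n. \<Sum>c<n. (cmod (D s t b c))\<^sup>2"])
  also have "\<dots> \<le> (\<Sum>s<k. \<Sum>t<k. 2 * w t + 2 * w s)"
    using D row k by (intro sum_mono) force
  also have "\<dots> = 4 * real k * (\<Sum>s<k. w s)"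
    by (simp add: sum.distrib sum_distrib_left[symmetric])
  finally show ?thesis .
qed

text \<open>The decisive saving. Cauchy-Schwarz alone would bound \<tau> by \<Phi> times the
  gradient, which is of order k^2 \<Delta>^2 \<Phi>. Here each row of the corner, padded by zeros to
  length n, is mapped by the full matrix, whose operator norm is at most \<Delta>. No factor k^2
  arises, and the tail rate stays n / \<Delta>^2.\<close>

lemma block_contraction_bound:
  fixes X :: "nat \<Rightarrow> nat \<Rightarrow> complex"
  assumes k: "k \<le> n" and op: "\<And>y. (\<Sum>i<n. (cmod (\<Sum>t<n. X i t * y t))\<^sup>2) \<le> \<Delta>\<^sup>2 * (\<Sum>t<n. (cmod (y t))\<^sup>2)"
  shows "(\<Sum>b<k. \<Sum>c<n. (cmod (\<Sum>t<k. cnj (X b t) * X c t))\<^sup>2) \<le> \<Delta>\<^sup>2 * (\<Sum>s<k. \<Sum>t<k. (cmod (X s t))\<^sup>2)"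
proof -
  have "(\<Sum>c<n. (cmod (\<Sum>t<k. cnj (X b t) * X c t))\<^sup>2) \<le> \<Delta>\<^sup>2 * (\<Sum>t<k. (cmod (X b t))\<^sup>2)" for b
  proof -
    define y where "y t = (if t < k then cnj (X b t) else 0)" for t
    have "(\<Sum>t<n. X c t * y t) = (\<Sum>t<n. if t < k then cnj (X b t) * X c t else 0)" for c
      by (intro sum.cong) (auto simp: y_def)
    then have 1: "(\<Sum>t<n. X c t * y t) = (\<Sum>t<k. cnj (X b t) * X c t)" for c
      using sum_block_extend[OF k] by metis
    have "(\<Sum>t<n. (cmod (y t))\<^sup>2) = (\<Sum>t<n. if t < k then (cmod (X b t))\<^sup>2 else 0)"
      by (intro sum.cong) (auto simp: y_def)
    then have 2: "(\<Sum>t<n. (cmod (y t))\<^sup>2) = (\<Sum>t<k. (cmod (X b t))\<^sup>2)"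
      using sum_block_extend[OF k] by metis
    show ?thesis using op[of y] unfolding 1 2 .
  qed
  then show ?thesis unfolding sum_distrib_left[of _ "\<lambda>s. \<Sum>t<k. (cmod (X s t))\<^sup>2"] by (intro sum_mono)
qed

lemma herm_quad_gradient:
  assumes U: "U \<in> unitary_group n" and k: "k \<le> n"
  shows "(\<Sum>i\<in>{..<k} \<times> {..<k}. \<Sum>b<n. \<Sum>c<n. (cmod (herm_quad_D n d (fst i) (snd i) b c U))\<^sup>2)
     \<le> 4 * real k * (\<Sum>s<k. row_weight n (\<lambda>j. (d j)\<^sup>2) U s)"
proof (rule block_gradient_bound[OF k herm_quad_row[OF U]])
  fix s t assume st: "s < k" "t < k"
  let ?A = "herm_quad n d U"
  have sw: "cmod (?A c t) = cmod (?A t c)" for c t by (metis cnj_herm_quad complex_mod_cnj)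
  have "(\<Sum>b<n. \<Sum>c<n. (cmod (herm_quad_D n d s t b c U))\<^sup>2)
    \<le> (\<Sum>b<n. \<Sum>c<n. (if b = s then 2 * (cmod (?A t c))\<^sup>2 else 0) + (if c = t then 2 * (cmod (?A s b))\<^sup>2 else 0))"
  proof (intro sum_mono)
    fix b c
    show "(cmod (herm_quad_D n d s t b c U))\<^sup>2 \<le> (if b = s then 2 * (cmod (?A t c))\<^sup>2 else 0) + (if c = t then 2 * (cmod (?A s b))\<^sup>2 else 0)"
      using cmod_add_sq_le[of "if s = b then ?A c t else 0" "- (if t = c then ?A s b else 0)"] sw[of c t]
      by (auto simp: herm_quad_D_def)
  qed
  also have "\<dots> = (\<Sum>c<n. \<Sum>b<n. if b = s then 2 * (cmod (?A t c))\<^sup>2 else 0) + (\<Sum>b<n. \<Sum>c<n. if c = t then 2 * (cmod (?A s b))\<^sup>2 else 0)"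
    unfolding sum.distrib by (rule arg_cong2[where f="(+)"], rule sum.swap, rule refl)
  also have "\<dots> = 2 * (\<Sum>c<n. (cmod (?A t c))\<^sup>2) + 2 * (\<Sum>c<n. (cmod (?A s c))\<^sup>2)"
    using st k by (simp add: sum_distrib_left)
  finally show "(\<Sum>b<n. \<Sum>c<n. (cmod (herm_quad_D n d s t b c U))\<^sup>2)
    \<le> 2 * (\<Sum>c<n. (cmod (?A t c))\<^sup>2) + 2 * (\<Sum>c<n. (cmod (?A s c))\<^sup>2)" .
qed

lemma sym_quad_gradient:
  assumes U: "U \<in> unitary_group n" and k: "k \<le> n"
  shows "(\<Sum>i\<in>{..<k} \<times> {..<k}. \<Sum>b<n. \<Sum>c<n. (cmod (sym_quad_D n d (fst i) (snd i) b c U))\<^sup>2)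
     \<le> 4 * real k * (\<Sum>s<k. row_weight n (\<lambda>j. (d j)\<^sup>2) U s)"
proof (rule block_gradient_bound[OF k sym_quad_row[OF U]])
  fix s t assume st: "s < k" "t < k"
  let ?A = "sym_quad n d U"
  have sw: "cmod (?A c t) = cmod (?A t c)" for c t by (metis sym_quad_commute)
  have "(\<Sum>b<n. \<Sum>c<n. (cmod (sym_quad_D n d s t b c U))\<^sup>2)
    \<le> (\<Sum>b<n. \<Sum>c<n. (if b = s then 2 * (cmod (?A t c))\<^sup>2 else 0) + (if b = t then 2 * (cmod (?A s c))\<^sup>2 else 0))"
  proof (intro sum_mono)
    fix b c
    show "(cmod (sym_quad_D n d s t b c U))\<^sup>2 \<le> (if b = s then 2 * (cmod (?A t c))\<^sup>2 else 0) + (if b = t then 2 * (cmod (?A s c))\<^sup>2 else 0)"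
      using cmod_add_sq_le[of "if s = b then ?A c t else 0" "if t = b then ?A s c else 0"] sw[of c t]
      by (auto simp: sym_quad_D_def)
  qed
  also have "\<dots> = (\<Sum>c<n. \<Sum>b<n. if b = s then 2 * (cmod (?A t c))\<^sup>2 else 0) + (\<Sum>c<n. \<Sum>b<n. if b = t then 2 * (cmod (?A s c))\<^sup>2 else 0)"
    unfolding sum.distrib by (rule arg_cong2[where f="(+)"]; rule sum.swap)
  also have "\<dots> = 2 * (\<Sum>c<n. (cmod (?A t c))\<^sup>2) + 2 * (\<Sum>c<n. (cmod (?A s c))\<^sup>2)"
    using st k by (simp add: sum_distrib_left)
  finally show "(\<Sum>b<n. \<Sum>c<n. (cmod (sym_quad_D n d s t b c U))\<^sup>2)
    \<le> 2 * (\<Sum>c<n. (cmod (?A t c))\<^sup>2) + 2 * (\<Sum>c<n. (cmod (?A s c))\<^sup>2)" .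
qed

text \<open>Contracting the derivative with the corner gives r b c, with coefficient 1 for b < k and
  -1 for c < k. Since r is Hermitian, both parts reduce to the same sum over rows of the
  corner.\<close>

lemma herm_quad_contraction:
  assumes U: "U \<in> unitary_group n" and k: "k \<le> n" and d: "\<And>j. j < n \<Longrightarrow> \<bar>d j\<bar> \<le> \<Delta>"
  shows "(\<Sum>b<n. \<Sum>c<n. (cmod (\<Sum>i\<in>{..<k} \<times> {..<k}. cnj (herm_quad n d U (fst i) (snd i)) * herm_quad_D n d (fst i) (snd i) b c U))\<^sup>2)
     \<le> 4 * \<Delta>\<^sup>2 * (\<Sum>i\<in>{..<k} \<times> {..<k}. (cmod (herm_quad n d U (fst i) (snd i)))\<^sup>2)"
proof -
  let ?A = "herm_quad n d U"
  define r where "r b c = (\<Sum>t<k. cnj (?A b t) * ?A c t)" for b c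
  have rsw: "cmod (r b c) = cmod (r c b)" for b c
  proof -
    have "r b c = cnj (r c b)" by (simp add: r_def mult.commute)
    then show ?thesis by simp
  qed
  have T: "(\<Sum>i\<in>{..<k} \<times> {..<k}. cnj (?A (fst i) (snd i)) * herm_quad_D n d (fst i) (snd i) b c U)
    = (if b < k then r b c else 0) - (if c < k then r b c else 0)" for b c
  proof -
    have "(\<Sum>i\<in>{..<k} \<times> {..<k}. cnj (?A (fst i) (snd i)) * herm_quad_D n d (fst i) (snd i) b c U)
      = (\<Sum>s<k. \<Sum>t<k. cnj (?A s t) * herm_quad_D n d s t b c U)"
      by (rule sum_square_index[of "\<lambda>s t. cnj (?A s t) * herm_quad_D n d s t b c U"])
    also have "\<dots> = (\<Sum>s<k. \<Sum>t<k. (if s = b then cnj (?A b t) * ?A c t else 0) - (if t = c then ?A c s * cnj (?A b s) else 0))"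
      by (intro sum.cong refl) (auto simp: herm_quad_D_def right_diff_distrib cnj_herm_quad)
    also have "\<dots> = (\<Sum>t<k. \<Sum>s<k. (if s = b then cnj (?A b t) * ?A c t else 0)) - (\<Sum>s<k. \<Sum>t<k. (if t = c then ?A c s * cnj (?A b s) else 0))"
      unfolding sum_subtractf by (rule arg_cong2[where f="(-)"], rule sum.swap, rule refl)
    also have "\<dots> = (if b < k then r b c else 0) - (if c < k then r b c else 0)"
      by (simp add: r_def mult.commute)
    finally show ?thesis .
  qed
  have "(\<Sum>b<n. \<Sum>c<n. (cmod (\<Sum>i\<in>{..<k} \<times> {..<k}. cnj (?A (fst i) (snd i)) * herm_quad_D n d (fst i) (snd i) b c U))\<^sup>2)
     \<le> (\<Sum>b<n. \<Sum>c<n. (if b < k then 2 * (cmod (r b c))\<^sup>2 else 0) + (if c < k then 2 * (cmod (r c b))\<^sup>2 else 0))"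
    unfolding T
  proof (intro sum_mono)
    fix b c
    show "(cmod ((if b < k then r b c else 0) - (if c < k then r b c else 0)))\<^sup>2
      \<le> (if b < k then 2 * (cmod (r b c))\<^sup>2 else 0) + (if c < k then 2 * (cmod (r c b))\<^sup>2 else 0)"
      using rsw[of b c] by auto
  qed
  also have "\<dots> = (\<Sum>c<n. \<Sum>b<n. if b < k then 2 * (cmod (r b c))\<^sup>2 else 0) + (\<Sum>b<n. \<Sum>c<n. if c < k then 2 * (cmod (r c b))\<^sup>2 else 0)"
    unfolding sum.distrib by (rule arg_cong2[where f="(+)"], rule sum.swap, rule refl)
  also have "\<dots> = (\<Sum>c<n. \<Sum>b<k. 4 * (cmod (r b c))\<^sup>2)"
    unfolding sum_block_extend[OF k] by (simp add: sum.distrib[symmetric])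
  also have "\<dots> = 4 * (\<Sum>b<k. \<Sum>c<n. (cmod (r b c))\<^sup>2)"
    unfolding sum_distrib_left by (rule sum.swap)
  also have "\<dots> \<le> 4 * (\<Delta>\<^sup>2 * (\<Sum>s<k. \<Sum>t<k. (cmod (?A s t))\<^sup>2))"
    unfolding r_def using block_contraction_bound[OF k herm_quad_op[OF U d]] by simp
  also have "\<dots> = 4 * \<Delta>\<^sup>2 * (\<Sum>i\<in>{..<k} \<times> {..<k}. (cmod (?A (fst i) (snd i)))\<^sup>2)"
    using sum_square_index[of "\<lambda>s t. (cmod (?A s t))\<^sup>2" k] by simp
  finally show ?thesis .
qed

text \<open>By symmetry of A the two halves of the derivative contribute equally, which gives 2 r b
  c for b < k; squaring yields the factor 4.\<close>

lemma sym_quad_contraction: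
  assumes U: "U \<in> unitary_group n" and k: "k \<le> n" and d: "\<And>j. j < n \<Longrightarrow> \<bar>d j\<bar> \<le> \<Delta>"
  shows "(\<Sum>b<n. \<Sum>c<n. (cmod (\<Sum>i\<in>{..<k} \<times> {..<k}. cnj (sym_quad n d U (fst i) (snd i)) * sym_quad_D n d (fst i) (snd i) b c U))\<^sup>2)
     \<le> 4 * \<Delta>\<^sup>2 * (\<Sum>i\<in>{..<k} \<times> {..<k}. (cmod (sym_quad n d U (fst i) (snd i)))\<^sup>2)"
proof -
  let ?A = "sym_quad n d U"
  define r where "r b c = (\<Sum>t<k. cnj (?A b t) * ?A c t)" for b c
  have T: "(\<Sum>i\<in>{..<k} \<times> {..<k}. cnj (?A (fst i) (snd i)) * sym_quad_D n d (fst i) (snd i) b c U)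
    = (if b < k then 2 * r b c else 0)" for b c
  proof -
    have "(\<Sum>i\<in>{..<k} \<times> {..<k}. cnj (?A (fst i) (snd i)) * sym_quad_D n d (fst i) (snd i) b c U)
      = (\<Sum>s<k. \<Sum>t<k. cnj (?A s t) * sym_quad_D n d s t b c U)"
      by (rule sum_square_index[of "\<lambda>s t. cnj (?A s t) * sym_quad_D n d s t b c U"])
    also have "\<dots> = (\<Sum>s<k. \<Sum>t<k. (if s = b then cnj (?A b t) * ?A c t else 0) + (if t = b then cnj (?A b s) * ?A c s else 0))"
    proof (intro sum.cong refl)
      fix s t
      have "cnj (?A s b) * ?A s c = cnj (?A b s) * ?A c s" by (metis sym_quad_commute)
      then show "cnj (?A s t) * sym_quad_D n d s t b c U
          = (if s = b then cnj (?A b t) * ?A c t else 0) + (if t = b then cnj (?A b s) * ?A c s else 0)"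
        unfolding sym_quad_D_def by (cases "s = b"; cases "t = b") (simp_all add: distrib_left)
    qed
    also have "\<dots> = (\<Sum>t<k. \<Sum>s<k. (if s = b then cnj (?A b t) * ?A c t else 0)) + (\<Sum>s<k. \<Sum>t<k. (if t = b then cnj (?A b s) * ?A c s else 0))"
      unfolding sum.distrib by (rule arg_cong2[where f="(+)"], rule sum.swap, rule refl)
    also have "\<dots> = (if b < k then 2 * r b c else 0)"
      by (simp add: r_def)
    finally show ?thesis .
  qed
  have "(\<Sum>b<n. \<Sum>c<n. (cmod (\<Sum>i\<in>{..<k} \<times> {..<k}. cnj (?A (fst i) (snd i)) * sym_quad_D n d (fst i) (snd i) b c U))\<^sup>2)
     = (\<Sum>b<n. if b < k then 4 * (\<Sum>c<n. (cmod (r b c))\<^sup>2) else 0)"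
    unfolding T by (intro sum.cong refl) (simp add: norm_mult power_mult_distrib sum_distrib_left)
  also have "\<dots> = 4 * (\<Sum>b<k. \<Sum>c<n. (cmod (r b c))\<^sup>2)"
    unfolding sum_block_extend[OF k] sum_distrib_left ..
  also have "\<dots> \<le> 4 * (\<Delta>\<^sup>2 * (\<Sum>s<k. \<Sum>t<k. (cmod (?A s t))\<^sup>2))"
    unfolding r_def using block_contraction_bound[OF k sym_quad_op[OF U d]] by simp
  also have "\<dots> = 4 * \<Delta>\<^sup>2 * (\<Sum>i\<in>{..<k} \<times> {..<k}. (cmod (?A (fst i) (snd i)))\<^sup>2)"
    using sum_square_index[of "\<lambda>s t. (cmod (?A s t))\<^sup>2" k] by simp
  finally show ?thesis .
qed

lemma herm_quad_concentration:
  assumes P: "haar_unitary n P" and k: "1 \<le> k" "k \<le> n"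
    and d: "\<And>j. j < n \<Longrightarrow> \<bar>d j\<bar> \<le> \<Delta>" and \<Delta>: "\<Delta> > 0" and tr: "(\<Sum>j<n. d j) = 0"
  shows "integrable P (\<lambda>U. \<Sum>s<k. \<Sum>t<k. (cmod (herm_quad n d U s t))\<^sup>2)"
    "(\<integral>U. (\<Sum>s<k. \<Sum>t<k. (cmod (herm_quad n d U s t))\<^sup>2) \<partial>P) \<le> 2 * (real k)\<^sup>2 / (real n)\<^sup>2 * (\<Sum>j<n. (d j)\<^sup>2)"
    "T \<ge> 48 * \<Delta>\<^sup>2 * (real k)\<^sup>2 / real n \<Longrightarrow>
      measure P {U. (\<Sum>s<k. \<Sum>t<k. (cmod (herm_quad n d U s t))\<^sup>2) \<ge> T} \<le> exp (- T * real n / (48 * \<Delta>\<^sup>2))"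
proof -
  let ?I = "{..<k} \<times> {..<k}"
  have e: "(\<Sum>i\<in>?I. (cmod (herm_quad n d U (fst i) (snd i)))\<^sup>2) = (\<Sum>s<k. \<Sum>t<k. (cmod (herm_quad n d U s t))\<^sup>2)" for U
    by (rule sum_square_index[of "\<lambda>s t. (cmod (herm_quad n d U s t))\<^sup>2"])
  have *: "finite ?I"
    "\<And>i. i \<in> ?I \<Longrightarrow> polyd n (\<lambda>U. herm_quad n d U (fst i) (snd i)) (herm_quad_D n d (fst i) (snd i))"
    "\<And>i b c. i \<in> ?I \<Longrightarrow> b < n \<Longrightarrow> c < n \<Longrightarrow> polyd n (herm_quad_D n d (fst i) (snd i) b c) (herm_quad_DD n d (fst i) (snd i) b c)"
    "\<And>i U. i \<in> ?I \<Longrightarrow> U \<in> unitary_group n \<Longrightarrow> (\<Sum>b<n. \<Sum>c<n. herm_quad_DD n d (fst i) (snd i) c b b c U)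
       = complex_of_real (2 * real n) * herm_quad n d U (fst i) (snd i)"
    "2 * real n \<le> 2 * real n"
  proof -
    fix i b c assume i: "i \<in> ?I"
    then have i': "fst i < n" "snd i < n" using k by auto
    show "polyd n (\<lambda>U. herm_quad n d U (fst i) (snd i)) (herm_quad_D n d (fst i) (snd i))"
      by (rule polyd_herm_quad[OF i'])
    show "polyd n (herm_quad_D n d (fst i) (snd i) b c) (herm_quad_DD n d (fst i) (snd i) b c)" if "b < n" "c < n"
      by (rule polyd_herm_quad_D[OF i' that])
    show "(\<Sum>b<n. \<Sum>c<n. herm_quad_DD n d (fst i) (snd i) c b b c U)
       = complex_of_real (2 * real n) * herm_quad n d U (fst i) (snd i)" if "U \<in> unitary_group n" for U
      by (rule herm_quad_laplacian[OF that i' tr])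
  qed auto
  note q = quadratic_moments[where f="\<lambda>i U. herm_quad n d U (fst i) (snd i)" and F="\<lambda>i. herm_quad_D n d (fst i) (snd i)"
      and FF="\<lambda>i. herm_quad_DD n d (fst i) (snd i)" and I="?I", OF P * k d \<Delta> herm_quad_gradient[OF _ k(2)] herm_quad_contraction[OF _ k(2) d]]
  show "integrable P (\<lambda>U. \<Sum>s<k. \<Sum>t<k. (cmod (herm_quad n d U s t))\<^sup>2)" using q(1) unfolding e .
  show "(\<integral>U. (\<Sum>s<k. \<Sum>t<k. (cmod (herm_quad n d U s t))\<^sup>2) \<partial>P) \<le> 2 * (real k)\<^sup>2 / (real n)\<^sup>2 * (\<Sum>j<n. (d j)\<^sup>2)"
    using q(2) unfolding e .
  show "T \<ge> 48 * \<Delta>\<^sup>2 * (real k)\<^sup>2 / real n \<Longrightarrow>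
      measure P {U. (\<Sum>s<k. \<Sum>t<k. (cmod (herm_quad n d U s t))\<^sup>2) \<ge> T} \<le> exp (- T * real n / (48 * \<Delta>\<^sup>2))"
    using q(3) unfolding e .
qed

lemma sym_quad_concentration:
  assumes P: "haar_unitary n P" and k: "1 \<le> k" "k \<le> n"
    and d: "\<And>j. j < n \<Longrightarrow> \<bar>d j\<bar> \<le> \<Delta>" and \<Delta>: "\<Delta> > 0"
  shows "integrable P (\<lambda>U. \<Sum>s<k. \<Sum>t<k. (cmod (sym_quad n d U s t))\<^sup>2)"
    "(\<integral>U. (\<Sum>s<k. \<Sum>t<k. (cmod (sym_quad n d U s t))\<^sup>2) \<partial>P) \<le> 2 * (real k)\<^sup>2 / (real n)\<^sup>2 * (\<Sum>j<n. (d j)\<^sup>2)"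
    "T \<ge> 48 * \<Delta>\<^sup>2 * (real k)\<^sup>2 / real n \<Longrightarrow>
      measure P {U. (\<Sum>s<k. \<Sum>t<k. (cmod (sym_quad n d U s t))\<^sup>2) \<ge> T} \<le> exp (- T * real n / (48 * \<Delta>\<^sup>2))"
proof -
  let ?I = "{..<k} \<times> {..<k}"
  have e: "(\<Sum>i\<in>?I. (cmod (sym_quad n d U (fst i) (snd i)))\<^sup>2) = (\<Sum>s<k. \<Sum>t<k. (cmod (sym_quad n d U s t))\<^sup>2)" for U
    by (rule sum_square_index[of "\<lambda>s t. (cmod (sym_quad n d U s t))\<^sup>2"])
  have *: "finite ?I"
    "\<And>i. i \<in> ?I \<Longrightarrow> polyd n (\<lambda>U. sym_quad n d U (fst i) (snd i)) (sym_quad_D n d (fst i) (snd i))"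
    "\<And>i b c. i \<in> ?I \<Longrightarrow> b < n \<Longrightarrow> c < n \<Longrightarrow> polyd n (sym_quad_D n d (fst i) (snd i) b c) (sym_quad_DD n d (fst i) (snd i) b c)"
    "\<And>i U. i \<in> ?I \<Longrightarrow> U \<in> unitary_group n \<Longrightarrow> (\<Sum>b<n. \<Sum>c<n. sym_quad_DD n d (fst i) (snd i) c b b c U)
       = complex_of_real (2 * real n + 2) * sym_quad n d U (fst i) (snd i)"
    "2 * real n \<le> 2 * real n + 2"
  proof -
    fix i b c assume i: "i \<in> ?I"
    then have i': "fst i < n" "snd i < n" using k by auto
    show "polyd n (\<lambda>U. sym_quad n d U (fst i) (snd i)) (sym_quad_D n d (fst i) (snd i))"
      by (rule polyd_sym_quad[OF i'])
    show "polyd n (sym_quad_D n d (fst i) (snd i) b c) (sym_quad_DD n d (fst i) (snd i) b c)" if "b < n" "c < n"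
      by (rule polyd_sym_quad_D[OF i' that])
    show "(\<Sum>b<n. \<Sum>c<n. sym_quad_DD n d (fst i) (snd i) c b b c U)
       = complex_of_real (2 * real n + 2) * sym_quad n d U (fst i) (snd i)" for U
      by (rule sym_quad_laplacian[OF i'])
  qed auto
  note q = quadratic_moments[where f="\<lambda>i U. sym_quad n d U (fst i) (snd i)" and F="\<lambda>i. sym_quad_D n d (fst i) (snd i)"
      and FF="\<lambda>i. sym_quad_DD n d (fst i) (snd i)" and I="?I", OF P * k d \<Delta> sym_quad_gradient[OF _ k(2)] sym_quad_contraction[OF _ k(2) d]]
  show "integrable P (\<lambda>U. \<Sum>s<k. \<Sum>t<k. (cmod (sym_quad n d U s t))\<^sup>2)" using q(1) unfolding e .
  show "(\<integral>U. (\<Sum>s<k. \<Sum>t<k. (cmod (sym_quad n d U s t))\<^sup>2) \<partial>P) \<le> 2 * (real k)\<^sup>2 / (real n)\<^sup>2 * (\<Sum>j<n. (d j)\<^sup>2)"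
    using q(2) unfolding e .
  show "T \<ge> 48 * \<Delta>\<^sup>2 * (real k)\<^sup>2 / real n \<Longrightarrow>
      measure P {U. (\<Sum>s<k. \<Sum>t<k. (cmod (sym_quad n d U s t))\<^sup>2) \<ge> T} \<le> exp (- T * real n / (48 * \<Delta>\<^sup>2))"
    using q(3) unfolding e .
qed

section \<open>Traces, characteristic polynomials and symplectic eigenvalues\<close>

definition mtrace :: "'a::comm_ring_1 mat \<Rightarrow> 'a" where
  "mtrace A = (\<Sum>i<dim_row A. A $$ (i, i))"

lemma mtrace_mult:
  assumes "A \<in> carrier_mat n n" "B \<in> carrier_mat n n"
  shows "mtrace (A * B) = (\<Sum>i<n. \<Sum>j<n. A $$ (i, j) * B $$ (j, i))"
  using assms by (simp add: mtrace_def scalar_prod_def atLeast0LessThan)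

lemma mtrace_commute:
  assumes "A \<in> carrier_mat n n" "B \<in> carrier_mat n n"
  shows "mtrace (A * B) = mtrace (B * A)"
  unfolding mtrace_mult[OF assms] mtrace_mult[OF assms(2,1)] by (subst sum.swap) (simp add: mult.commute)

lemma upper_triangular_pow:
  fixes B :: "'a::comm_ring_1 mat"
  assumes B: "B \<in> carrier_mat n n" and ut: "upper_triangular B"
  shows "(\<forall>i<n. \<forall>j<i. (B ^\<^sub>m m) $$ (i, j) = 0) \<and> (\<forall>i<n. (B ^\<^sub>m m) $$ (i, i) = (B $$ (i, i)) ^ m)"
proof (induction m)
  case 0
  then show ?case using B by auto
next
  case (Suc m)
  have c: "B ^\<^sub>m m \<in> carrier_mat n n" using B by simp
  have e: "(B ^\<^sub>m Suc m) $$ (i, j) = (\<Sum>l<n. (B ^\<^sub>m m) $$ (i, l) * B $$ (l, j))" if "i < n" "j < n" for i j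
    using that B c by (simp add: scalar_prod_def atLeast0LessThan)
  have z: "(B ^\<^sub>m m) $$ (i, l) * B $$ (l, j) = 0" if "i < n" "j < n" "l < n" "l < i \<or> j < l" for i j l
    using that Suc B ut by (auto simp: upper_triangular_def)
  show ?case
  proof (intro conjI allI impI)
    fix i j assume ij: "i < n" "j < i"
    then have "(\<Sum>l<n. (B ^\<^sub>m m) $$ (i, l) * B $$ (l, j)) = 0"
      by (intro sum.neutral ballI z) auto
    then show "(B ^\<^sub>m Suc m) $$ (i, j) = 0" using e[of i j] ij by simp
  next
    fix i assume i: "i < n"
    have "(\<Sum>l<n. (B ^\<^sub>m m) $$ (i, l) * B $$ (l, i)) = (\<Sum>l\<in>{i}. (B ^\<^sub>m m) $$ (i, l) * B $$ (l, i))"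
      using i by (intro sum.mono_neutral_right) (auto intro!: z)
    then show "(B ^\<^sub>m Suc m) $$ (i, i) = (B $$ (i, i)) ^ Suc m" using e[of i i] i Suc by (simp add: mult.commute)
  qed
qed

text \<open>In Schur form the powers are triangular with the powers of the eigenvalues on the
  diagonal. Roots are counted with multiplicity, and A may fail to be diagonalizable.\<close>

lemma mtrace_pow_eq_sum_roots:
  fixes A :: "complex mat"
  assumes A: "A \<in> carrier_mat n n" and c: "char_poly A = (\<Prod>e\<leftarrow>es. [:- e, 1:])"
  shows "mtrace (A ^\<^sub>m m) = (\<Sum>e\<leftarrow>es. e ^ m)"
proof -
  obtain B P Q where s: "schur_decomposition A es = (B, P, Q)" by (metis prod_cases3)
  from schur_decomposition[OF A c s]
  have w: "similar_mat_wit A B P Q" and ut: "upper_triangular B" and dg: "diag_mat B = es" by auto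
  have B: "B \<in> carrier_mat n n" and P: "P \<in> carrier_mat n n" and Q: "Q \<in> carrier_mat n n" and QP: "Q * P = 1\<^sub>m n"
    using similar_mat_witD2[OF A w] by auto
  have Bm: "B ^\<^sub>m m \<in> carrier_mat n n" using B by simp
  have "mtrace (A ^\<^sub>m m) = mtrace (P * B ^\<^sub>m m * Q)" using similar_mat_wit_pow_id[OF w] by simp
  also have "\<dots> = mtrace (Q * (P * B ^\<^sub>m m))" by (rule mtrace_commute) (use P Q Bm in auto)
  also have "Q * (P * B ^\<^sub>m m) = Q * P * B ^\<^sub>m m" by (rule assoc_mult_mat[OF Q P Bm, symmetric])
  also have "\<dots> = B ^\<^sub>m m" unfolding QP by (rule left_mult_one_mat[OF Bm])
  also have "mtrace (B ^\<^sub>m m) = (\<Sum>i<n. (B $$ (i, i)) ^ m)"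
    unfolding mtrace_def using upper_triangular_pow[OF B ut, of m] B by simp
  also have "\<dots> = (\<Sum>e\<leftarrow>diag_mat B. e ^ m)"
    using B by (simp add: diag_mat_def o_def sum_list_sum_nth atLeast0LessThan)
  finally show ?thesis using dg by simp
qed

text \<open>The eigenvalues of C are \<i> l and - \<i> l, so C^2 + c has each c - l^2 twice.
  Expanding the square of C^2 + c reduces the trace to the power sums of order 2 and 4.\<close>

lemma symplectic_trace_identity:
  fixes c :: real
  assumes C: "C \<in> carrier_mat (2*k) (2*k)" and len: "length lams = k"
    and ch: "char_poly C = (\<Prod>l\<leftarrow>lams. [:complex_of_real (l^2), 0, 1:])"
    and N: "\<And>i j. i < 2*k \<Longrightarrow> j < 2*k \<Longrightarrow> N i j = (\<Sum>l<2*k. C $$ (i, l) * C $$ (l, j)) + (if i = j then complex_of_real c else 0)"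
  shows "(\<Sum>i<2*k. \<Sum>j<2*k. N i j * N j i) = complex_of_real (2 * (\<Sum>l\<leftarrow>lams. (l\<^sup>2 - c)\<^sup>2))"
proof -
  define es where "es = concat (map (\<lambda>l. [\<i> * complex_of_real l, - \<i> * complex_of_real l]) lams)"
  have "char_poly C = (\<Prod>e\<leftarrow>es. [:- e, 1:])"
  proof -
    have q: "[:- (\<i> * complex_of_real l), 1:] * ([:\<i> * complex_of_real l, 1:] * X) = [:complex_of_real (l\<^sup>2), 0, 1:] * X" for l X
    proof -
      have "[:- (\<i> * complex_of_real l), 1:] * [:\<i> * complex_of_real l, 1:] = [:complex_of_real (l\<^sup>2), 0, 1:]"
        by (simp add: power2_eq_square, simp add: complex_eq_iff)
      then show ?thesis by (simp only: mult.assoc[symmetric])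
    qed
    then show ?thesis unfolding ch es_def
      by (induction lams) (simp_all only: list.map concat.simps map_append prod_list.append prod_list.Cons
          prod_list.Nil append_Cons append_Nil minus_minus mult_minus_left q)
  qed
  note tr = mtrace_pow_eq_sum_roots[OF C this]
  have e2: "(\<Sum>e\<leftarrow>es. e ^ 2) = - 2 * (\<Sum>l\<leftarrow>lams. complex_of_real l ^ 2)"
    unfolding es_def by (induction lams) (auto simp: power_mult_distrib)
  have i4: "\<i> ^ 4 = 1" by (simp add: power4_eq_xxxx)
  have e4: "(\<Sum>e\<leftarrow>es. e ^ 4) = 2 * (\<Sum>l\<leftarrow>lams. complex_of_real l ^ 4)"
    unfolding es_def by (induction lams) (auto simp: power_mult_distrib i4)
  define D where "D = C * C"
  have D: "D \<in> carrier_mat (2*k) (2*k)" using C by (simp add: D_def)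
  have D_ij: "D $$ (i, j) = (\<Sum>l<2*k. C $$ (i, l) * C $$ (l, j))" if "i < 2*k" "j < 2*k" for i j
    using that C by (simp add: D_def scalar_prod_def atLeast0LessThan)
  have C2: "C ^\<^sub>m 2 = D" using C by (simp add: numeral_2_eq_2 D_def)
  have C4: "C ^\<^sub>m 4 = D * D"
  proof -
    have "C ^\<^sub>m 4 = C ^\<^sub>m 2 * C * C" 
    proof -
      have "(4::nat) = Suc (Suc 2)" by simp
      then show ?thesis by (simp only: pow_mat.simps)
    qed
    also have "\<dots> = D * (C * C)" unfolding C2 by (rule assoc_mult_mat[OF D C C])
    finally show ?thesis by (simp only: D_def)
  qed
  have t2: "(\<Sum>i<2*k. D $$ (i, i)) = (\<Sum>e\<leftarrow>es. e ^ 2)"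
    using tr[of 2] D unfolding C2 mtrace_def by simp
  have t4: "(\<Sum>i<2*k. \<Sum>j<2*k. D $$ (i, j) * D $$ (j, i)) = (\<Sum>e\<leftarrow>es. e ^ 4)"
    using tr[of 4] unfolding C4 mtrace_mult[OF D D] .
  have N': "N i j = D $$ (i, j) + (if i = j then complex_of_real c else 0)" if "i < 2*k" "j < 2*k" for i j
    using N[OF that] D_ij[OF that] by simp
  have "(\<Sum>i<2*k. \<Sum>j<2*k. N i j * N j i) = (\<Sum>i<2*k. \<Sum>j<2*k. D $$ (i, j) * D $$ (j, i)
     + (if j = i then 2 * complex_of_real c * D $$ (i, i) + complex_of_real c ^ 2 else 0))"
    by (intro sum.cong refl) (auto simp: N' algebra_simps power2_eq_square)
  also have "\<dots> = (\<Sum>e\<leftarrow>es. e ^ 4) + 2 * complex_of_real c * (\<Sum>e\<leftarrow>es. e ^ 2) + of_nat (2*k) * complex_of_real c ^ 2"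
    unfolding sum.distrib t4 t2[symmetric] by (simp add: sum.distrib sum_distrib_left)
  also have "\<dots> = complex_of_real (2 * (\<Sum>l\<leftarrow>lams. (l\<^sup>2 - c)\<^sup>2))"
    unfolding e2 e4 len[symmetric]
    by (induction lams) (auto simp: algebra_simps power2_eq_square power4_eq_xxxx)
  finally show ?thesis .
qed

section \<open>Existence and uniqueness of the factorization into x^2 + l^2\<close>

lemma map_poly_of_real_add: "map_poly complex_of_real (p + q) = map_poly complex_of_real p + map_poly complex_of_real q"
  and map_poly_of_real_mult: "map_poly complex_of_real (p * q) = map_poly complex_of_real p * map_poly complex_of_real q"
proof -
  interpret mp: map_poly_comm_ring_hom complex_of_real ..
  show "map_poly complex_of_real (p + q) = map_poly complex_of_real p + map_poly complex_of_real q" by (rule mp.hom_add)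
  show "map_poly complex_of_real (p * q) = map_poly complex_of_real p * map_poly complex_of_real q" by (rule mp.hom_mult)
qed

text \<open>A root with real part 0 and |Im z| = t makes x^2 + t^2 divide p: the remainder is real,
  of degree at most 1, and vanishes at a nonzero imaginary point, so it is zero. The quotient
  inherits the hypotheses.\<close>

lemma real_poly_imaginary_roots:
  fixes p :: "real poly"
  assumes "degree p = 2 * k" "lead_coeff p = 1"
    and "\<And>z. poly (map_poly complex_of_real p) z = 0 \<Longrightarrow> Re z = 0 \<and> 1 \<le> \<bar>Im z\<bar>"
  shows "\<exists>lams. length lams = k \<and> (\<forall>l\<in>set lams. 1 \<le> l) \<and> p = (\<Prod>l\<leftarrow>lams. [:l\<^sup>2, 0, 1:])"
  using assms
proof (induction k arbitrary: p)
  case 0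
  then have "p = 1" by (metis degree_eq_zeroE lead_coeff_pCons(2) mult_0_right one_pCons)
  then show ?case by simp
next
  case (Suc k)
  have deg: "degree (map_poly complex_of_real p) = degree p" by (simp add: degree_map_poly)
  have "\<not> constant (poly (map_poly complex_of_real p))"
    using Suc.prems(1) deg by (simp add: constant_degree)
  then obtain z where z: "poly (map_poly complex_of_real p) z = 0" using fundamental_theorem_of_algebra by blast
  define t where "t = \<bar>Im z\<bar>"
  have t: "t \<ge> 1" and z0: "Re z = 0" using Suc.prems(3)[OF z] by (auto simp: t_def)
  define d where "d = [:t\<^sup>2, 0, 1:]"
  have dd: "degree d = 2" "d \<noteq> 0" "lead_coeff d = 1" by (auto simp: d_def)
  have zz: "z ^ 2 = - complex_of_real (t\<^sup>2)" using z0 by (auto simp: t_def complex_eq_iff power2_eq_square)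
  have dz: "poly (map_poly complex_of_real d) z = 0"
    using zz by (simp add: d_def power2_eq_square)
  define q r where "q = p div d" and "r = p mod d"
  have p: "p = q * d + r" by (simp add: q_def r_def)
  have "degree r < 2" using degree_mod_less_degree[OF dd(2), of p] dd(1)
    by (cases "r = 0") (auto simp: r_def dvd_eq_mod_eq_0)
  then obtain a b where r: "r = [:a, b:]"
  proof -
    assume a: "\<And>a b. r = [:a, b:] \<Longrightarrow> thesis" and deg: "degree r < 2"
    have "coeff r (Suc (Suc i)) = 0" for i using deg by (intro coeff_eq_0) simp
    then have "r = [:coeff r 0, coeff r 1:]" by (intro poly_eqI) (auto simp: coeff_pCons split: nat.split)
    then show thesis by (rule a)
  qed
  have "map_poly complex_of_real p = map_poly complex_of_real q * map_poly complex_of_real d + map_poly complex_of_real r"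
    unfolding p by (simp add: map_poly_of_real_add map_poly_of_real_mult)
  then have "poly (map_poly complex_of_real r) z = 0" using z dz by simp
  then have "complex_of_real a + z * complex_of_real b = 0" by (simp add: r of_real_hom.map_poly_pCons_hom)
  moreover have "Im z \<noteq> 0" using t by (auto simp: t_def)
  ultimately have "a = 0" "b = 0" using z0 by (auto simp: complex_eq_iff)
  then have pq: "p = q * d" using p r by simp
  have "q \<noteq> 0" using pq Suc.prems(1) by auto
  then have "degree q = 2 * k" using Suc.prems(1) dd by (simp add: pq degree_mult_eq)
  moreover have "lead_coeff q = 1" using Suc.prems(2) dd by (simp add: pq lead_coeff_mult)
  moreover have "Re w = 0 \<and> 1 \<le> \<bar>Im w\<bar>" if "poly (map_poly complex_of_real q) w = 0" for w
    using that by (intro Suc.prems(3)) (simp add: pq map_poly_of_real_mult)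
  ultimately obtain lams where "length lams = k" "\<forall>l\<in>set lams. 1 \<le> l" "q = (\<Prod>l\<leftarrow>lams. [:l\<^sup>2, 0, 1:])"
    using Suc.IH by blast
  then show ?case using t by (intro exI[of _ "t # lams"]) (auto simp: pq d_def mult.commute)
qed

text \<open>The root \<i> l of a factor on the left is a root of some factor on the right, and l, m
  \<ge> 1 excludes m = - l; cancel and induct. This gives the definite description in
  \<open>gauss_entropy\<close> a well-defined value.\<close>

lemma quadratic_factors_unique:
  assumes "(\<Prod>l\<leftarrow>ls. [:complex_of_real (l^2), 0, 1:]) = (\<Prod>l\<leftarrow>ms. [:complex_of_real (l^2), 0, 1:])"
    and "\<forall>l\<in>set ls. 1 \<le> l" "\<forall>l\<in>set ms. 1 \<le> l"
  shows "mset ls = mset ms"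
proof -
  have r0: "poly [:complex_of_real (l^2), 0, 1:] (\<i> * complex_of_real l) = 0" for l
    by (auto simp: complex_eq_iff power2_eq_square)
  show ?thesis using assms
  proof (induction ls arbitrary: ms)
    case Nil
    show ?case
    proof (cases ms)
      case (Cons m ms')
      have "poly (\<Prod>l\<leftarrow>ms. [:complex_of_real (l^2), 0, 1:]) (\<i> * complex_of_real m) = 0"
        unfolding Cons by (simp only: list.map prod_list.Cons poly_mult r0 mult_zero_left)
      then have "poly (1 :: complex poly) (\<i> * complex_of_real m) = 0"
        using Nil(1)[symmetric] by (simp only: list.map prod_list.Nil)
      then show ?thesis by simp
    qed simp
  next
    case (Cons l ls)
    have "poly (\<Prod>l\<leftarrow>l # ls. [:complex_of_real (l^2), 0, 1:]) (\<i> * complex_of_real l) = 0"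
      by (simp only: list.map prod_list.Cons poly_mult r0 mult_zero_left)
    then have "poly (\<Prod>l\<leftarrow>ms. [:complex_of_real (l^2), 0, 1:]) (\<i> * complex_of_real l) = 0"
      unfolding Cons.prems(1) .
    then obtain m where m: "m \<in> set ms" "poly [:complex_of_real (m^2), 0, 1:] (\<i> * complex_of_real l) = 0"
      by (auto simp: poly_prod_list prod_list_zero_iff)
    then have "complex_of_real (m\<^sup>2) = complex_of_real (l\<^sup>2)" by (simp add: power2_eq_square algebra_simps)
    then have "m\<^sup>2 = l\<^sup>2" by (simp only: of_real_eq_iff)
    then have ml: "m = l" using m(1) Cons.prems by (simp add: power2_eq_iff) force
    define ms' where "ms' = remove1 l ms"
    have ms: "mset ms = add_mset l (mset ms')" using m ml by (simp add: ms'_def)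
    let ?f = "\<lambda>l. [:complex_of_real (l^2), 0, 1:]"
    have pm: "prod_list (map ?f xs) = prod_mset (image_mset ?f (mset xs))" for xs
      unfolding mset_map[symmetric] prod_mset_prod_list ..
    have "prod_list (map ?f ms) = ?f l * prod_list (map ?f ms')"
      unfolding pm ms image_mset_add_mset prod_mset.add_mset ..
    then have "[:complex_of_real (l^2), 0, 1:] * (\<Prod>l\<leftarrow>ls. [:complex_of_real (l^2), 0, 1:]) = [:complex_of_real (l^2), 0, 1:] * (\<Prod>l\<leftarrow>ms'. [:complex_of_real (l^2), 0, 1:])"
      using Cons.prems(1) by (simp only: list.map prod_list.Cons)
    then have "(\<Prod>l\<leftarrow>ls. [:complex_of_real (l^2), 0, 1:]) = (\<Prod>l\<leftarrow>ms'. [:complex_of_real (l^2), 0, 1:])"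
      by (rule mult_left_cancel[THEN iffD1, rotated]) simp
    moreover have "\<forall>l\<in>set ms'. 1 \<le> l" using Cons.prems(3) by (metis ms'_def notin_set_remove1)
    ultimately show ?case using Cons.IH Cons.prems(2) ms by simp
  qed
qed

lemma gauss_entropy_eq:
  assumes "symplectic_eigenvalues k M lams"
  shows "gauss_entropy k M = (\<Sum>l\<leftarrow>lams. Gfun l)"
  unfolding gauss_entropy_def
proof (rule the_equality)
  show "\<exists>ls. symplectic_eigenvalues k M ls \<and> (\<Sum>l\<leftarrow>lams. Gfun l) = (\<Sum>l\<leftarrow>ls. Gfun l)" using assms by blast
  fix s assume "\<exists>ls. symplectic_eigenvalues k M ls \<and> s = (\<Sum>l\<leftarrow>ls. Gfun l)"
  then obtain ls where ls: "symplectic_eigenvalues k M ls" "s = (\<Sum>l\<leftarrow>ls. Gfun l)" by blast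
  have "mset ls = mset lams"
    using ls(1) assms by (intro quadratic_factors_unique) (auto simp: symplectic_eigenvalues_def)
  then have "mset (map Gfun ls) = mset (map Gfun lams)" by simp
  then show "s = (\<Sum>l\<leftarrow>lams. Gfun l)" unfolding ls(2) by (metis sum_mset_sum_list)
qed

section \<open>Existence of symplectic eigenvalues of reduced covariance matrices\<close>

lemma sum_double_lessThan: "(\<Sum>i<2*k. g i) = (\<Sum>a<k. g a) + (\<Sum>a<k. g (k + a))" for g :: "nat \<Rightarrow> 'a::comm_monoid_add"
proof -
  have "(\<Sum>i<2*k. g i) = (\<Sum>i<k. g i) + (\<Sum>i=k..<2*k. g i)"
  proof -
    have "{..<2*k} = {..<k} \<union> {k..<2*k}" by auto
    moreover have "sum g ({..<k} \<union> {k..<2*k}) = (\<Sum>i<k. g i) + (\<Sum>i=k..<2*k. g i)"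
      by (rule sum.union_disjoint) auto
    ultimately show ?thesis by simp
  qed
  also have "(\<Sum>i=k..<2*k. g i) = (\<Sum>a<k. g (k + a))"
    by (rule sum.reindex_bij_witness[of _ "\<lambda>a. k + a" "\<lambda>i. i - k"]) auto
  finally show ?thesis .
qed

section \<open>The covariance matrix as a diagonal form pulled back along \<open>eta\<close>\<close>

definition msub :: "(nat \<Rightarrow> nat \<Rightarrow> real) \<Rightarrow> nat \<Rightarrow> nat \<Rightarrow> cmatf \<Rightarrow> nat \<Rightarrow> nat \<Rightarrow> real" where
  "msub z n k U i j = Mcov z n U (sub_idx n k i) (sub_idx n k j)"

text \<open>The transpose of the selected rows of \<open>eta n U\<close>, applied to w. It carries a
  vector on the k modes to the 2 n coordinates in which the covariance matrix is the diagonal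
  \<open>zdiag\<close>.\<close>

definition pull :: "nat \<Rightarrow> nat \<Rightarrow> cmatf \<Rightarrow> (nat \<Rightarrow> complex) \<Rightarrow> nat \<Rightarrow> complex" where
  "pull n k U w c = (\<Sum>i<2*k. complex_of_real (eta n U (sub_idx n k i) c) * w i)"

lemma pull_lower:
  assumes "k \<le> n" "j < n"
  shows "pull n k U w j = (\<Sum>a<k. complex_of_real (Re (U a j)) * w a - complex_of_real (Im (U a j)) * w (k + a))"
  using assms unfolding pull_def sum_double_lessThan
  by (simp add: eta_def sub_idx_def sum_subtractf sum_negf)

lemma pull_upper:
  assumes "k \<le> n" "j < n"
  shows "pull n k U w (n + j) = (\<Sum>a<k. complex_of_real (Im (U a j)) * w a + complex_of_real (Re (U a j)) * w (k + a))"
  using assms unfolding pull_def sum_double_lessThan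
  by (simp add: eta_def sub_idx_def sum.distrib)

text \<open>In the coordinates w a + \<i> w (k + a) the real representation \<open>eta\<close> turns
  back into U, and in w a - \<i> w (k + a) into \<open>cnj U\<close>.\<close>

lemma pull_plus:
  assumes "k \<le> n" "j < n"
  shows "pull n k U w j + \<i> * pull n k U w (n + j) = (\<Sum>a<k. U a j * (w a + \<i> * w (k + a)))"
  unfolding pull_lower[OF assms] pull_upper[OF assms] sum_distrib_left sum.distrib[symmetric]
  by (intro sum.cong refl) (simp add: complex_eq_iff algebra_simps)

lemma pull_minus:
  assumes "k \<le> n" "j < n"
  shows "pull n k U w j - \<i> * pull n k U w (n + j) = (\<Sum>a<k. cnj (U a j) * (w a - \<i> * w (k + a)))"
  unfolding pull_lower[OF assms] pull_upper[OF assms] sum_distrib_left sum_subtractf[symmetric]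
  by (intro sum.cong refl) (simp add: complex_eq_iff algebra_simps)

lemma unitary_rows_isometry:
  assumes U: "U \<in> unitary_group n" and k: "k \<le> n"
  shows "(\<Sum>j<n. (cmod (\<Sum>a<k. U a j * x a))\<^sup>2) = (\<Sum>a<k. (cmod (x a))\<^sup>2)"
proof -
  define y where "y a = (if a < k then x a else 0)" for a
  have "(\<Sum>a<n. U a j * y a) = (\<Sum>a<n. if a < k then U a j * x a else 0)" for j
    by (intro sum.cong) (auto simp: y_def)
  then have 1: "(\<Sum>a<n. U a j * y a) = (\<Sum>a<k. U a j * x a)" for j
    using sum_block_extend[OF k] by metis
  have "(\<Sum>a<n. (cmod (y a))\<^sup>2) = (\<Sum>a<n. if a < k then (cmod (x a))\<^sup>2 else 0)"
    by (intro sum.cong) (auto simp: y_def)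
  then have 2: "(\<Sum>a<n. (cmod (y a))\<^sup>2) = (\<Sum>a<k. (cmod (x a))\<^sup>2)"
    using sum_block_extend[OF k] by metis
  show ?thesis
    using unitary_isometry[OF unitary_group_cnj[OF unitary_group_adjoint[OF U]], of y] unfolding 1[symmetric] 2[symmetric] by simp
qed

lemma cmod_rotated_sum: "(cmod (x + \<i> * y))\<^sup>2 + (cmod (x - \<i> * y))\<^sup>2 = 2 * ((cmod x)\<^sup>2 + (cmod y)\<^sup>2)"
  unfolding cmod_power2 by (simp add: power2_eq_square algebra_simps)

lemma cmod_rotated_diff: "(cmod (x - \<i> * y))\<^sup>2 - (cmod (x + \<i> * y))\<^sup>2 = 4 * Im (cnj x * y)"
  unfolding cmod_power2 by (simp add: power2_eq_square algebra_simps)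

text \<open>Both rotated coordinates are transformed isometrically. The sum of the two norm
  identities is preservation of the norm, their difference preservation of the symplectic form:
  \<open>eta\<close> is orthogonal and symplectic.\<close>

lemma
  assumes U: "U \<in> unitary_group n" and k: "k \<le> n"
  shows pull_norm: "(\<Sum>c<2*n. (cmod (pull n k U w c))\<^sup>2) = (\<Sum>i<2*k. (cmod (w i))\<^sup>2)"
    and pull_symplectic: "(\<Sum>j<n. Im (cnj (pull n k U w j) * pull n k U w (n + j))) = (\<Sum>a<k. Im (cnj (w a) * w (k + a)))"
proof -
  let ?v = "pull n k U w"
  have p: "(\<Sum>j<n. (cmod (?v j + \<i> * ?v (n + j)))\<^sup>2) = (\<Sum>a<k. (cmod (w a + \<i> * w (k + a)))\<^sup>2)"
    using unitary_rows_isometry[OF U k] pull_plus[OF k] by simp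
  have m: "(\<Sum>j<n. (cmod (?v j - \<i> * ?v (n + j)))\<^sup>2) = (\<Sum>a<k. (cmod (w a - \<i> * w (k + a)))\<^sup>2)"
    using unitary_rows_isometry[OF unitary_group_cnj[OF U] k] pull_minus[OF k] by simp
  have "2 * (\<Sum>c<2*n. (cmod (?v c))\<^sup>2) = (\<Sum>j<n. 2 * ((cmod (?v j))\<^sup>2 + (cmod (?v (n + j)))\<^sup>2))"
    unfolding sum_double_lessThan by (simp add: sum.distrib sum_distrib_left)
  also have "\<dots> = (\<Sum>a<k. (cmod (w a + \<i> * w (k + a)))\<^sup>2) + (\<Sum>a<k. (cmod (w a - \<i> * w (k + a)))\<^sup>2)"
    unfolding cmod_rotated_sum[symmetric] sum.distrib p m ..
  also have "\<dots> = (\<Sum>a<k. 2 * ((cmod (w a))\<^sup>2 + (cmod (w (k + a)))\<^sup>2))"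
    unfolding cmod_rotated_sum[symmetric] sum.distrib ..
  also have "\<dots> = 2 * (\<Sum>i<2*k. (cmod (w i))\<^sup>2)"
    unfolding sum_double_lessThan by (simp add: sum.distrib sum_distrib_left)
  finally show "(\<Sum>c<2*n. (cmod (?v c))\<^sup>2) = (\<Sum>i<2*k. (cmod (w i))\<^sup>2)" by simp
  have "4 * (\<Sum>j<n. Im (cnj (?v j) * ?v (n + j))) = (\<Sum>a<k. (cmod (w a - \<i> * w (k + a)))\<^sup>2) - (\<Sum>a<k. (cmod (w a + \<i> * w (k + a)))\<^sup>2)"
    unfolding sum_distrib_left cmod_rotated_diff[symmetric] sum_subtractf p m ..
  also have "\<dots> = 4 * (\<Sum>a<k. Im (cnj (w a) * w (k + a)))"
    unfolding sum_distrib_left cmod_rotated_diff[symmetric] sum_subtractf ..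
  finally show "(\<Sum>j<n. Im (cnj (?v j) * ?v (n + j))) = (\<Sum>a<k. Im (cnj (w a) * w (k + a)))" by simp
qed

lemma msub_form:
  "(\<Sum>i<2*k. cnj (x i) * (\<Sum>j<2*k. complex_of_real (msub z n k U i j) * y j))
    = (\<Sum>c<2*n. complex_of_real (zdiag z n c) * (cnj (pull n k U x c) * pull n k U y c))"
proof -
  let ?e = "\<lambda>i c. complex_of_real (eta n U (sub_idx n k i) c)"
  have "(\<Sum>i<2*k. cnj (x i) * (\<Sum>j<2*k. complex_of_real (msub z n k U i j) * y j))
    = (\<Sum>i<2*k. \<Sum>j<2*k. \<Sum>c<2*n. complex_of_real (zdiag z n c) * (?e i c * cnj (x i) * (?e j c * y j)))"
    by (simp add: msub_def Mcov_def sum_distrib_left sum_distrib_right ac_simps)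
  also have "\<dots> = (\<Sum>i<2*k. \<Sum>c<2*n. \<Sum>j<2*k. complex_of_real (zdiag z n c) * (?e i c * cnj (x i) * (?e j c * y j)))"
    by (rule sum.cong[OF refl], rule sum.swap)
  also have "\<dots> = (\<Sum>c<2*n. \<Sum>i<2*k. \<Sum>j<2*k. complex_of_real (zdiag z n c) * (?e i c * cnj (x i) * (?e j c * y j)))"
    by (rule sum.swap)
  also have "\<dots> = (\<Sum>c<2*n. complex_of_real (zdiag z n c) * (cnj (pull n k U x c) * pull n k U y c))"
  proof (rule sum.cong[OF refl])
    fix c
    have "cnj (pull n k U x c) * pull n k U y c = (\<Sum>i<2*k. \<Sum>j<2*k. ?e i c * cnj (x i) * (?e j c * y j))"
      by (simp only: pull_def cnj_sum complex_cnj_mult complex_cnj_complex_of_real sum_product)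
    then show "(\<Sum>i<2*k. \<Sum>j<2*k. complex_of_real (zdiag z n c) * (?e i c * cnj (x i) * (?e j c * y j)))
        = complex_of_real (zdiag z n c) * (cnj (pull n k U x c) * pull n k U y c)"
      by (simp only: sum_distrib_left)
  qed
  finally show ?thesis .
qed

text \<open>With x = M y, the squared norm of x is the bilinear form of M at x and y. Its diagonal
  weights are positive and at most \<Delta>, so Cauchy-Schwarz bounds it by \<Delta> |x|
  |y|.\<close>

lemma msub_op:
  assumes U: "U \<in> unitary_group n" and k: "k \<le> n" and z: "\<And>j. j < n \<Longrightarrow> 1 \<le> z n j \<and> z n j \<le> \<Delta>"
  shows "(\<Sum>i<2*k. (\<Sum>j<2*k. msub z n k U i j * y j)\<^sup>2) \<le> \<Delta>\<^sup>2 * (\<Sum>j<2*k. (y j)\<^sup>2)"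
proof -
  define x where "x i = (\<Sum>j<2*k. msub z n k U i j * y j)" for i
  let ?px = "\<lambda>c. pull n k U (\<lambda>i. complex_of_real (x i)) c" and ?py = "\<lambda>c. pull n k U (\<lambda>i. complex_of_real (y i)) c"
  have D: "\<bar>zdiag z n c\<bar> \<le> \<Delta>" if "c < 2*n" for c
  proof (cases "c < n")
    case False
    have "1 \<le> z n (c - n)" "z n (c - n) \<le> \<Delta>" using z[of "c - n"] that False by auto
    then have "1 / z n (c - n) \<le> \<Delta>" by (smt (verit) divide_le_eq_1)
    then show ?thesis using False \<open>1 \<le> z n (c - n)\<close> by (simp add: zdiag_def)
  qed (use z[of c] in \<open>auto simp: zdiag_def\<close>)
  have "complex_of_real (\<Sum>i<2*k. (x i)\<^sup>2) = (\<Sum>i<2*k. cnj (complex_of_real (x i)) * (\<Sum>j<2*k. complex_of_real (msub z n k U i j) * complex_of_real (y j)))"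
    by (simp add: x_def power2_eq_square)
  also have "\<dots> = (\<Sum>c<2*n. complex_of_real (zdiag z n c) * (cnj (?px c) * ?py c))" by (rule msub_form)
  finally have "cmod (complex_of_real (\<Sum>i<2*k. (x i)\<^sup>2)) = cmod (\<Sum>c<2*n. complex_of_real (zdiag z n c) * (cnj (?px c) * ?py c))" by simp
  also have "\<dots> \<le> (\<Sum>c<2*n. \<Delta> * (cmod (?px c) * cmod (?py c)))"
    by (intro sum_norm_le) (auto simp: norm_mult intro!: mult_right_mono D)
  finally have le: "(\<Sum>i<2*k. (x i)\<^sup>2) \<le> \<Delta> * (\<Sum>c<2*n. cmod (?px c) * cmod (?py c))"
    by (simp add: sum_distrib_left del: of_real_sum)
  have X0: "(\<Sum>i<2*k. (x i)\<^sup>2) \<ge> 0" by (intro sum_nonneg) auto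
  have "(\<Sum>i<2*k. (x i)\<^sup>2)\<^sup>2 \<le> (\<Delta> * (\<Sum>c<2*n. cmod (?px c) * cmod (?py c)))\<^sup>2"
    using le X0 by (intro power_mono) auto
  also have "\<dots> = \<Delta>\<^sup>2 * (\<Sum>c<2*n. cmod (?px c) * cmod (?py c))\<^sup>2" by (simp add: power_mult_distrib)
  also have "\<dots> \<le> \<Delta>\<^sup>2 * ((\<Sum>c<2*n. (cmod (?px c))\<^sup>2) * (\<Sum>c<2*n. (cmod (?py c))\<^sup>2))"
    by (intro mult_left_mono Cauchy_Schwarz_ineq_sum) auto
  also have "\<dots> = (\<Sum>i<2*k. (x i)\<^sup>2) * (\<Delta>\<^sup>2 * (\<Sum>i<2*k. (y i)\<^sup>2))"
    unfolding pull_norm[OF U k] by simp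
  finally have "(\<Sum>i<2*k. (x i)\<^sup>2) * (\<Sum>i<2*k. (x i)\<^sup>2) \<le> (\<Sum>i<2*k. (x i)\<^sup>2) * (\<Delta>\<^sup>2 * (\<Sum>i<2*k. (y i)\<^sup>2))"
    by (simp only: power2_eq_square)
  moreover have "\<Delta>\<^sup>2 * (\<Sum>i<2*k. (y i)\<^sup>2) \<ge> 0" by (intro mult_nonneg_nonneg sum_nonneg) auto
  ultimately have "(\<Sum>i<2*k. (x i)\<^sup>2) \<le> \<Delta>\<^sup>2 * (\<Sum>i<2*k. (y i)\<^sup>2)"
    using X0 by (cases "(\<Sum>i<2*k. (x i)\<^sup>2) = 0") (auto simp: mult_le_cancel_left)
  then show ?thesis unfolding x_def .
qed

section \<open>The symplectic matrix J and the spectrum of J M\<close>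

definition jsgn :: "nat \<Rightarrow> nat \<Rightarrow> real" where "jsgn k i = (if i < k then -1 else 1)"
definition jidx :: "nat \<Rightarrow> nat \<Rightarrow> nat" where "jidx k i = (if i < k then i + k else i - k)"

lemma jidx_lt: "i < 2*k \<Longrightarrow> jidx k i < 2*k" and jidx_jidx: "i < 2*k \<Longrightarrow> jidx k (jidx k i) = i"
  and jsgn_jidx: "i < 2*k \<Longrightarrow> jsgn k (jidx k i) = - jsgn k i" and jsgn_sq: "jsgn k i * jsgn k i = 1"
  by (auto simp: jidx_def jsgn_def)

lemma sum_jidx: "(\<Sum>i<2*k. g (jidx k i)) = (\<Sum>i<2*k. g i)" for g :: "nat \<Rightarrow> 'a::comm_monoid_add"
  by (rule sum.reindex_bij_witness[of _ "jidx k" "jidx k"]) (auto simp: jidx_lt jidx_jidx)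

text \<open>J is a signed permutation with signs \<open>jsgn\<close> and index map
  \<open>jidx\<close>. Written this way J M is visibly real, so its characteristic polynomial has
  real coefficients.\<close>

lemma Jmat_mult_real: "Jmat k * map_mat complex_of_real (Mcov_sub z n k U)
   = map_mat complex_of_real (mat (2*k) (2*k) (\<lambda>(i, j). jsgn k i * msub z n k U (jidx k i) j))"
proof (rule eq_matI)
  fix i j assume "i < dim_row (map_mat complex_of_real (mat (2*k) (2*k) (\<lambda>(i, j). jsgn k i * msub z n k U (jidx k i) j)))"
    "j < dim_col (map_mat complex_of_real (mat (2*k) (2*k) (\<lambda>(i, j). jsgn k i * msub z n k U (jidx k i) j)))"
  then have ij: "i < 2*k" "j < 2*k" by auto
  have "(Jmat k * map_mat complex_of_real (Mcov_sub z n k U)) $$ (i, j)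
     = (\<Sum>l<2*k. Jmat k $$ (i, l) * complex_of_real (msub z n k U l j))"
    using ij by (simp add: Jmat_def Mcov_sub_def scalar_prod_def atLeast0LessThan msub_def)
  also have "\<dots> = (\<Sum>l<2*k. if l = jidx k i then complex_of_real (jsgn k i * msub z n k U l j) else 0)"
    using ij by (intro sum.cong refl) (auto simp: Jmat_def jidx_def jsgn_def)
  finally show "(Jmat k * map_mat complex_of_real (Mcov_sub z n k U)) $$ (i, j)
     = map_mat complex_of_real (mat (2*k) (2*k) (\<lambda>(i, j). jsgn k i * msub z n k U (jidx k i) j)) $$ (i, j)"
    using ij jidx_lt[OF ij(1)] by simp
qed (auto simp: Jmat_def Mcov_sub_def)

text \<open>For an eigenvector w, pairing M w = - \<alpha> J w with w gives h = 2 \<i> s \<alpha>,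
  with h the positive form of M and s the symplectic form. Hence \<alpha> is imaginary and |Im
  \<alpha>| = h / (2 |s|), which is at least 1 by the uncertainty relation 2 |s| \<le> h.\<close>

lemma symplectic_spectrum_imaginary:
  assumes U: "U \<in> unitary_group n" and k: "k \<le> n" and z: "\<And>j. j < n \<Longrightarrow> 1 \<le> z n j"
    and ev: "eigenvalue (Jmat k * map_mat complex_of_real (Mcov_sub z n k U)) \<alpha>"
  shows "Re \<alpha> = 0 \<and> 1 \<le> \<bar>Im \<alpha>\<bar>"
proof -
  define C where "C = Jmat k * map_mat complex_of_real (Mcov_sub z n k U)"
  have C: "C \<in> carrier_mat (2*k) (2*k)" by (auto simp: C_def Jmat_def Mcov_sub_def)
  obtain u where u: "u \<in> carrier_vec (2*k)" "u \<noteq> 0\<^sub>v (2*k)" "C *\<^sub>v u = \<alpha> \<cdot>\<^sub>v u"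
    using ev C unfolding eigenvalue_def eigenvector_def C_def[symmetric] by auto
  define w where "w i = u $ i" for i
  have eq: "complex_of_real (jsgn k i) * (\<Sum>j<2*k. complex_of_real (msub z n k U (jidx k i) j) * w j) = \<alpha> * w i" if "i < 2*k" for i
  proof -
    have "(C *\<^sub>v u) $ i = (\<alpha> \<cdot>\<^sub>v u) $ i" using u by simp
    moreover have "(C *\<^sub>v u) $ i = (\<Sum>j<2*k. C $$ (i, j) * w j)"
      using that C u(1) by (simp add: scalar_prod_def atLeast0LessThan w_def)
    moreover have "C $$ (i, j) = complex_of_real (jsgn k i) * complex_of_real (msub z n k U (jidx k i) j)" if "j < 2*k" for j
      unfolding C_def Jmat_mult_real using that \<open>i < 2*k\<close> by simp
    ultimately show ?thesis using that u by (simp add: w_def sum_distrib_left mult.assoc)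
  qed
  have eq': "(\<Sum>j<2*k. complex_of_real (msub z n k U i j) * w j) = complex_of_real (- jsgn k i) * (\<alpha> * w (jidx k i))" if "i < 2*k" for i
  proof -
    have "complex_of_real (jsgn k (jidx k i)) * (\<Sum>j<2*k. complex_of_real (msub z n k U i j) * w j) = \<alpha> * w (jidx k i)"
      using eq[OF jidx_lt[OF that]] by (simp add: jidx_jidx[OF that])
    then show ?thesis unfolding jsgn_jidx[OF that] by (cases "i < k") (auto simp: jsgn_def minus_equation_iff)
  qed
  let ?v = "pull n k U w"
  define h where "h = (\<Sum>c<2*n. zdiag z n c * (cmod (?v c))\<^sup>2)"
  define s where "s = (\<Sum>a<k. Im (cnj (w a) * w (k + a)))"
  have Dpos: "zdiag z n c > 0" if "c < 2*n" for c
  proof (cases "c < n")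
    case False
    then have "c - n < n" using that by linarith
    then show ?thesis using False z[of "c - n"] by (simp add: zdiag_def)
  qed (use z[of c] in \<open>auto simp: zdiag_def\<close>)
  have sq: "cnj x * x = complex_of_real ((cmod x)\<^sup>2)" for x by (metis complex_norm_square mult.commute)
  have "complex_of_real h = (\<Sum>i<2*k. cnj (w i) * (\<Sum>j<2*k. complex_of_real (msub z n k U i j) * w j))"
    unfolding msub_form h_def by (simp add: sq del: of_real_power)
  also have "\<dots> = (\<Sum>i<2*k. cnj (w i) * (complex_of_real (- jsgn k i) * (\<alpha> * w (jidx k i))))"
    using eq' by (intro sum.cong) auto
  also have "\<dots> = (\<Sum>a<k. cnj (w a) * (\<alpha> * w (k + a))) + (\<Sum>a<k. - (cnj (w (k + a)) * (\<alpha> * w a)))"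
    unfolding sum_double_lessThan by (intro arg_cong2[where f="(+)"] sum.cong) (auto simp: jsgn_def jidx_def add.commute)
  also have "\<dots> = \<alpha> * (\<Sum>a<k. cnj (w a) * w (k + a) - cnj (cnj (w a) * w (k + a)))"
    by (simp add: sum_distrib_left sum_subtractf sum_negf algebra_simps)
  also have "(\<Sum>a<k. cnj (w a) * w (k + a) - cnj (cnj (w a) * w (k + a))) = \<i> * complex_of_real (2 * s)"
    unfolding s_def sum_distrib_left of_real_sum by (intro sum.cong refl) (simp add: complex_eq_iff)
  finally have hs: "complex_of_real h = \<alpha> * (\<i> * complex_of_real (2 * s))" .
  \<comment> \<open>The two coordinates of mode j carry the weights z and 1/z. As their product is
    1, the arithmetic-geometric mean inequality loses no constant.\<close>
  have hge: "2 * \<bar>s\<bar> \<le> h"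
  proof -
    have "\<bar>s\<bar> \<le> (\<Sum>j<n. cmod (?v j) * cmod (?v (n + j)))"
      unfolding s_def pull_symplectic[OF U k, symmetric]
      by (intro order.trans[OF sum_abs] sum_mono) (metis abs_Im_le_cmod complex_mod_cnj norm_mult)
    then have "2 * \<bar>s\<bar> \<le> (\<Sum>j<n. 2 * (cmod (?v j) * cmod (?v (n + j))))" by (simp add: sum_distrib_left[symmetric])
    also have "\<dots> \<le> (\<Sum>j<n. zdiag z n j * (cmod (?v j))\<^sup>2 + zdiag z n (n + j) * (cmod (?v (n + j)))\<^sup>2)"
    proof (intro sum_mono)
      fix j assume "j \<in> {..<n}"
      then have zj: "z n j \<ge> 1" using z by auto
      then have r: "sqrt (z n j) > 0" by simp
      have "2 * (sqrt (z n j) * cmod (?v j)) * (cmod (?v (n + j)) / sqrt (z n j))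
        \<le> (sqrt (z n j) * cmod (?v j))\<^sup>2 + (cmod (?v (n + j)) / sqrt (z n j))\<^sup>2"
        by (rule sum_squares_bound)
      then show "2 * (cmod (?v j) * cmod (?v (n + j))) \<le> zdiag z n j * (cmod (?v j))\<^sup>2 + zdiag z n (n + j) * (cmod (?v (n + j)))\<^sup>2"
        using zj r \<open>j \<in> {..<n}\<close> by (simp add: zdiag_def power_mult_distrib power_divide)
    qed
    also have "\<dots> = h" unfolding h_def sum_double_lessThan by (simp add: sum.distrib)
    finally show ?thesis .
  qed
  have "h \<noteq> 0"
  proof
    assume "h = 0"
    then have "\<forall>c\<in>{..<2*n}. zdiag z n c * (cmod (?v c))\<^sup>2 = 0"
      unfolding h_def using sum_nonneg_eq_0_iff[of "{..<2*n}" "\<lambda>c. zdiag z n c * (cmod (?v c))\<^sup>2"] Dpos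
      by (simp add: less_imp_le)
    then have "(\<Sum>c<2*n. (cmod (?v c))\<^sup>2) = 0" using Dpos by (intro sum.neutral) force
    then have "(\<Sum>i<2*k. (cmod (w i))\<^sup>2) = 0" using pull_norm[OF U k] by simp
    then have "\<forall>i<2*k. w i = 0" by (simp add: sum_nonneg_eq_0_iff)
    then have "u = 0\<^sub>v (2*k)" using u(1) by (intro eq_vecI) (auto simp: w_def)
    then show False using u by simp
  qed
  have "h = - 2 * s * Im \<alpha>" "0 = 2 * s * Re \<alpha>" using hs by (auto simp: complex_eq_iff)
  with \<open>h \<noteq> 0\<close> have s0: "s \<noteq> 0" and re: "Re \<alpha> = 0" by auto
  have "2 * \<bar>s\<bar> * 1 \<le> 2 * \<bar>s\<bar> * \<bar>Im \<alpha>\<bar>"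
    using hge \<open>h = - 2 * s * Im \<alpha>\<close> by (metis abs_ge_self abs_minus_cancel abs_mult abs_numeral mult.right_neutral mult_minus_left order.trans)
  then have "1 \<le> \<bar>Im \<alpha>\<bar>" using s0 by simp
  then show ?thesis using re by simp
qed

text \<open>J M is a real matrix with imaginary spectrum of modulus at least 1, so its
  characteristic polynomial splits into the required real quadratics.\<close>

lemma symplectic_eigenvalues_exist:
  assumes U: "U \<in> unitary_group n" and k: "k \<le> n" and z: "\<And>j. j < n \<Longrightarrow> 1 \<le> z n j"
  shows "\<exists>lams. symplectic_eigenvalues k (Mcov_sub z n k U) lams"
proof -
  define R where "R = mat (2*k) (2*k) (\<lambda>(i, j). jsgn k i * msub z n k U (jidx k i) j)"
  have R: "R \<in> carrier_mat (2*k) (2*k)" by (simp add: R_def)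
  have C: "Jmat k * map_mat complex_of_real (Mcov_sub z n k U) = map_mat complex_of_real R"
    unfolding Jmat_mult_real R_def ..
  have C': "map_mat complex_of_real R \<in> carrier_mat (2*k) (2*k)" using R by simp
  have ch: "char_poly (map_mat complex_of_real R) = map_poly complex_of_real (char_poly R)"
    by (rule of_real_hom.char_poly_hom[OF R])
  obtain lams where l: "length lams = k" "\<forall>l\<in>set lams. 1 \<le> l" "char_poly R = (\<Prod>l\<leftarrow>lams. [:l\<^sup>2, 0, 1:])"
  proof -
    have "\<exists>lams. length lams = k \<and> (\<forall>l\<in>set lams. 1 \<le> l) \<and> char_poly R = (\<Prod>l\<leftarrow>lams. [:l\<^sup>2, 0, 1:])"
    proof (rule real_poly_imaginary_roots)
      show "degree (char_poly R) = 2 * k" "lead_coeff (char_poly R) = 1" using degree_monic_char_poly[OF R] by auto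
      fix w assume "poly (map_poly complex_of_real (char_poly R)) w = 0"
      then have "eigenvalue (map_mat complex_of_real R) w" using eigenvalue_root_char_poly[OF C'] ch by simp
      then show "Re w = 0 \<and> 1 \<le> \<bar>Im w\<bar>" using symplectic_spectrum_imaginary[where z=z and n=n, OF U k z] unfolding C by simp
    qed
    then show ?thesis using that by blast
  qed
  have "map_poly complex_of_real (\<Prod>l\<leftarrow>ls. [:l\<^sup>2, 0, 1:]) = (\<Prod>l\<leftarrow>ls. [:complex_of_real (l\<^sup>2), 0, 1:])" for ls
  proof (induction ls)
    case (Cons l ls)
    have "map_poly complex_of_real [:l\<^sup>2, 0, 1:] = [:complex_of_real (l\<^sup>2), 0, 1:]" by (simp del: of_real_power)
    then show ?case using Cons by (simp only: list.map prod_list.Cons map_poly_of_real_mult)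
  qed simp
  then have "char_poly (Jmat k * map_mat complex_of_real (Mcov_sub z n k U)) = (\<Prod>l\<leftarrow>lams. [:complex_of_real (l\<^sup>2), 0, 1:])"
    unfolding C ch l(3) .
  then show ?thesis using l unfolding symplectic_eigenvalues_def by blast
qed

section \<open>Entropy deviation\<close>

definition sq_defect :: "(nat \<Rightarrow> nat \<Rightarrow> real) \<Rightarrow> nat \<Rightarrow> nat \<Rightarrow> real \<Rightarrow> cmatf \<Rightarrow> real" where
  "sq_defect z n k la U = (\<Sum>i<2*k. \<Sum>j<2*k. (msub z n k U i j - (if i = j then la else 0))\<^sup>2)"

text \<open>With p and q the half sum and half difference of z and 1/z, the covariance matrix splits
  into a complex-linear part U p U^* and an antilinear part U q U^T. They are orthogonal in the
  Frobenius inner product, so the cross terms cancel. The shift by la moves into p because the rows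
  of U are orthonormal.\<close>

lemma sq_defect_eq:
  assumes U: "U \<in> unitary_group n" and k: "k \<le> n"
  shows "sq_defect z n k la U = 2 * ((\<Sum>s<k. \<Sum>t<k. (cmod (herm_quad n (\<lambda>j. (z n j + 1 / z n j) / 2 - la) U s t))\<^sup>2)
     + (\<Sum>s<k. \<Sum>t<k. (cmod (sym_quad n (\<lambda>j. (z n j - 1 / z n j) / 2) U s t))\<^sup>2))"
proof -
  define p where "p j = (z n j + 1 / z n j) / 2" for j
  define q where "q j = (z n j - 1 / z n j) / 2" for j
  have zd: "zdiag z n j = p j + q j" "zdiag z n (n + j) = p j - q j" if "j < n" for j
    using that by (simp_all add: zdiag_def p_def q_def field_simps)
  let ?P = "herm_quad n (\<lambda>j. p j - la) U" and ?Q = "sym_quad n q U"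
  let ?d = "\<lambda>i j. if i = (j::nat) then la else 0"
  have row: "(\<Sum>j<n. Re (U a j) * Re (U b j) + Im (U a j) * Im (U b j)) = (if a = b then 1 else 0)"
    "(\<Sum>j<n. Im (U a j) * Re (U b j) - Re (U a j) * Im (U b j)) = 0" if "a < k" "b < k" for a b
  proof -
    have e: "(\<Sum>j<n. U a j * cnj (U b j)) = (if a = b then 1 else 0)"
      using unitary_group_rows[OF U, of a b] that k by auto
    have "Re (\<Sum>j<n. U a j * cnj (U b j)) = (if a = b then 1 else 0)" "Im (\<Sum>j<n. U a j * cnj (U b j)) = 0"
      unfolding e by auto
    then show "(\<Sum>j<n. Re (U a j) * Re (U b j) + Im (U a j) * Im (U b j)) = (if a = b then 1 else 0)"
      "(\<Sum>j<n. Im (U a j) * Re (U b j) - Re (U a j) * Im (U b j)) = 0" by simp_all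
  qed
  have lin: "(\<Sum>j<n. f j - la * g j) = (\<Sum>j<n. f j) - la * (\<Sum>j<n. g j)" for f g :: "nat \<Rightarrow> real"
    by (simp add: sum_subtractf sum_distrib_left)
  have RP: "Re (?P a b) = (\<Sum>j<n. p j * (Re (U a j) * Re (U b j) + Im (U a j) * Im (U b j))) - ?d a b"
    if "a < k" "b < k" for a b
  proof -
    have "Re (?P a b) = (\<Sum>j<n. p j * (Re (U a j) * Re (U b j) + Im (U a j) * Im (U b j))
        - la * (Re (U a j) * Re (U b j) + Im (U a j) * Im (U b j)))"
      unfolding herm_quad_def Re_sum by (intro sum.cong refl) (simp add: algebra_simps)
    then show ?thesis unfolding lin row(1)[OF that] by simp
  qed
  have IP: "Im (?P a b) = (\<Sum>j<n. p j * (Im (U a j) * Re (U b j) - Re (U a j) * Im (U b j)))"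
    if "a < k" "b < k" for a b
  proof -
    have "Im (?P a b) = (\<Sum>j<n. p j * (Im (U a j) * Re (U b j) - Re (U a j) * Im (U b j))
        - la * (Im (U a j) * Re (U b j) - Re (U a j) * Im (U b j)))"
      unfolding herm_quad_def Im_sum by (intro sum.cong refl) (simp add: algebra_simps)
    then show ?thesis unfolding lin row(2)[OF that] by simp
  qed
  have RQ: "Re (?Q a b) = (\<Sum>j<n. q j * (Re (U a j) * Re (U b j) - Im (U a j) * Im (U b j)))" for a b
    unfolding sym_quad_def Re_sum by (intro sum.cong refl) (simp add: algebra_simps)
  have IQ: "Im (?Q a b) = (\<Sum>j<n. q j * (Re (U a j) * Im (U b j) + Im (U a j) * Re (U b j)))" for a b
    unfolding sym_quad_def Im_sum by (intro sum.cong refl) (simp add: algebra_simps)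
  have ms: "msub z n k U i i' = (\<Sum>j<n. eta n U (sub_idx n k i) j * (p j + q j) * eta n U (sub_idx n k i') j
      + eta n U (sub_idx n k i) (n + j) * (p j - q j) * eta n U (sub_idx n k i') (n + j))" for i i'
    unfolding msub_def Mcov_def sum_double_lessThan sum.distrib[symmetric]
    by (intro sum.cong refl) (simp add: zd)
  have m11: "msub z n k U a b - ?d a b = Re (?P a b) + Re (?Q a b)" if "a < k" "b < k" for a b
  proof -
    have "msub z n k U a b = (\<Sum>j<n. p j * (Re (U a j) * Re (U b j) + Im (U a j) * Im (U b j))
        + q j * (Re (U a j) * Re (U b j) - Im (U a j) * Im (U b j)))"
      unfolding ms using that k by (intro sum.cong refl) (simp add: eta_def sub_idx_def algebra_simps)
    then show ?thesis unfolding RP[OF that] RQ sum.distrib by simp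
  qed
  have m22: "msub z n k U (k + a) (k + b) - ?d a b = Re (?P a b) - Re (?Q a b)" if "a < k" "b < k" for a b
  proof -
    have "msub z n k U (k + a) (k + b) = (\<Sum>j<n. p j * (Re (U a j) * Re (U b j) + Im (U a j) * Im (U b j))
        - q j * (Re (U a j) * Re (U b j) - Im (U a j) * Im (U b j)))"
      unfolding ms using that k by (intro sum.cong refl) (simp add: eta_def sub_idx_def algebra_simps)
    then show ?thesis unfolding RP[OF that] RQ
      unfolding sum_subtractf[of "\<lambda>j. p j * (Re (U a j) * Re (U b j) + Im (U a j) * Im (U b j))"] by simp
  qed
  have m12: "msub z n k U a (k + b) = Im (?P a b) - Im (?Q a b)" if "a < k" "b < k" for a b
    unfolding IP[OF that] IQ ms sum_subtractf[symmetric]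
    using that k by (intro sum.cong refl) (simp add: eta_def sub_idx_def algebra_simps)
  have m21: "msub z n k U (k + a) b = - Im (?P a b) - Im (?Q a b)" if "a < k" "b < k" for a b
    unfolding IP[OF that] IQ ms sum_negf[symmetric] sum_subtractf[symmetric]
    using that k by (intro sum.cong refl) (simp add: eta_def sub_idx_def algebra_simps)
  have "sq_defect z n k la U = (\<Sum>a<k. \<Sum>b<k. (msub z n k U a b - ?d a b)\<^sup>2 + (msub z n k U a (k + b))\<^sup>2
      + (msub z n k U (k + a) b)\<^sup>2 + (msub z n k U (k + a) (k + b) - ?d a b)\<^sup>2)"
    unfolding sq_defect_def sum_double_lessThan sum.distrib[symmetric]
    by (intro sum.cong refl) auto
  also have "\<dots> = (\<Sum>a<k. \<Sum>b<k. 2 * (cmod (?P a b))\<^sup>2 + 2 * (cmod (?Q a b))\<^sup>2)"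
  proof (intro sum.cong refl)
    fix a b assume "a \<in> {..<k}" "b \<in> {..<k}"
    then have ab: "a < k" "b < k" by auto
    show "(msub z n k U a b - ?d a b)\<^sup>2 + (msub z n k U a (k + b))\<^sup>2
      + (msub z n k U (k + a) b)\<^sup>2 + (msub z n k U (k + a) (k + b) - ?d a b)\<^sup>2 = 2 * (cmod (?P a b))\<^sup>2 + 2 * (cmod (?Q a b))\<^sup>2"
      unfolding m11[OF ab] m12[OF ab] m21[OF ab] m22[OF ab] cmod_power2 by (simp add: power2_eq_square algebra_simps)
  qed
  finally show ?thesis unfolding p_def q_def by (simp add: sum.distrib sum_distrib_left distrib_left)
qed

section \<open>From the Frobenius defect to the symplectic eigenvalues\<close>

lemma sum_sq_le2: "((x::real) + y)\<^sup>2 \<le> 2 * x\<^sup>2 + 2 * y\<^sup>2"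
  using sum_squares_bound[of x y] by (simp add: power2_sum)

lemma sum_sq_le3: "((x::real) + y + w)\<^sup>2 \<le> 3 * (x\<^sup>2 + y\<^sup>2 + w\<^sup>2)"
  using sum_squares_bound[of x y] sum_squares_bound[of x w] sum_squares_bound[of y w]
  by (simp add: power2_sum algebra_simps)

text \<open>With \<open>X = J M\<close> and \<open>E = J (M - \<lambda>)\<close> one has \<open>X\<^sup>2 + \<lambda>\<^sup>2 = X E + \<lambda> E J = E\<^sup>2 + \<lambda> (J E + E J)\<close>;
  the two forms give the two bounds.\<close>

lemma symplectic_square_defect:
  fixes m :: "nat \<Rightarrow> nat \<Rightarrow> real" and la :: real
  assumes op: "\<And>y. (\<Sum>i<2*k. (\<Sum>j<2*k. m i j * y j)\<^sup>2) \<le> \<Delta>\<^sup>2 * (\<Sum>j<2*k. (y j)\<^sup>2)"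
  defines "N \<equiv> \<lambda>i j. (\<Sum>l<2*k. jsgn k i * m (jidx k i) l * (jsgn k l * m (jidx k l) j)) + (if i = j then la\<^sup>2 else 0)"
    and "Y \<equiv> (\<Sum>i<2*k. \<Sum>j<2*k. (m i j - (if i = j then la else 0))\<^sup>2)"
  shows "(\<Sum>i<2*k. \<Sum>j<2*k. (N i j)\<^sup>2) \<le> 2 * (\<Delta>\<^sup>2 + la\<^sup>2) * Y"
    "(\<Sum>i<2*k. \<Sum>j<2*k. (N i j)\<^sup>2) \<le> 3 * (Y\<^sup>2 + 2 * la\<^sup>2 * Y)"
proof -
  define X where "X i j = jsgn k i * m (jidx k i) j" for i j
  define E where "E i j = jsgn k i * (m (jidx k i) j - (if jidx k i = j then la else 0))" for i j
  have XE: "X i l = E i l + la * (jsgn k i * (if l = jidx k i then 1 else 0))" for i l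
    by (auto simp: X_def E_def algebra_simps)
  have s2: "(jsgn k i)\<^sup>2 = 1" for i by (simp add: jsgn_def)
  have EY: "(\<Sum>i<2*k. \<Sum>j<2*k. (E i j)\<^sup>2) = Y"
  proof -
    have "(\<Sum>i<2*k. \<Sum>j<2*k. (E i j)\<^sup>2) = (\<Sum>i<2*k. \<Sum>j<2*k. (m (jidx k i) j - (if jidx k i = j then la else 0))\<^sup>2)"
      by (simp add: E_def power_mult_distrib s2)
    also have "\<dots> = Y" unfolding Y_def by (rule sum_jidx[of "\<lambda>i. \<Sum>j<2*k. (m i j - (if i = j then la else 0))\<^sup>2"])
    finally show ?thesis .
  qed
  have EJ: "(\<Sum>i<2*k. \<Sum>j<2*k. (E i (jidx k j))\<^sup>2) = Y"
    using sum_jidx[of "\<lambda>j. (E i j)\<^sup>2" k for i] EY by simp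
  have JE: "(\<Sum>i<2*k. \<Sum>j<2*k. (E (jidx k i) j)\<^sup>2) = Y"
    using sum_jidx[of "\<lambda>i. \<Sum>j<2*k. (E i j)\<^sup>2" k] EY by simp
  \<comment> \<open>This is X E + \<lambda> E J: the \<lambda>^2 in N cancels against \<lambda>^2
    J^2.\<close>
  have N1: "N i j = (\<Sum>l<2*k. X i l * E l j) - la * jsgn k j * E i (jidx k j)" if "i < 2*k" "j < 2*k" for i j
  proof -
    have "(\<Sum>l<2*k. X i l * X l j) = (\<Sum>l<2*k. X i l * E l j + (if l = jidx k j then la * (X i l * jsgn k l) else 0))"
    proof (intro sum.cong refl)
      fix l assume "l \<in> {..<2*k}"
      then have "j = jidx k l \<longleftrightarrow> l = jidx k j" using jidx_jidx that by auto
      then show "X i l * X l j = X i l * E l j + (if l = jidx k j then la * (X i l * jsgn k l) else 0)"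
        unfolding XE[of l j] by (simp add: algebra_simps)
    qed
    also have "\<dots> = (\<Sum>l<2*k. X i l * E l j) + la * (X i (jidx k j) * jsgn k (jidx k j))"
      using jidx_lt[OF that(2)] by (simp add: sum.distrib)
    also have "la * (X i (jidx k j) * jsgn k (jidx k j)) = - la * jsgn k j * E i (jidx k j) - (if i = j then la\<^sup>2 else 0)"
    proof -
      have "jidx k j = jidx k i \<longleftrightarrow> i = j" using jidx_jidx that by metis
      then show ?thesis unfolding XE jsgn_jidx[OF that(2)] using jsgn_sq[of k i]
        by (auto simp: algebra_simps power2_eq_square)
    qed
    finally show ?thesis unfolding N_def X_def by simp
  qed
  have N2: "N i j = (\<Sum>l<2*k. E i l * E l j) + la * jsgn k i * E (jidx k i) j - la * jsgn k j * E i (jidx k j)" if "i < 2*k" "j < 2*k" for i j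
  proof -
    have "(\<Sum>l<2*k. X i l * E l j) = (\<Sum>l<2*k. E i l * E l j + (if l = jidx k i then la * jsgn k i * E l j else 0))"
      unfolding XE by (intro sum.cong) (auto simp: algebra_simps)
    also have "\<dots> = (\<Sum>l<2*k. E i l * E l j) + la * jsgn k i * E (jidx k i) j"
      using jidx_lt[OF that(1)] by (simp add: sum.distrib)
    finally show ?thesis using N1[OF that] by simp
  qed
  have XEle: "(\<Sum>i<2*k. \<Sum>j<2*k. (\<Sum>l<2*k. X i l * E l j)\<^sup>2) \<le> \<Delta>\<^sup>2 * Y"
  proof -
    have "(\<Sum>i<2*k. \<Sum>j<2*k. (\<Sum>l<2*k. X i l * E l j)\<^sup>2) = (\<Sum>j<2*k. \<Sum>i<2*k. (\<Sum>l<2*k. X i l * E l j)\<^sup>2)" by (rule sum.swap)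
    also have "\<dots> = (\<Sum>j<2*k. \<Sum>i<2*k. (\<Sum>l<2*k. m (jidx k i) l * E l j)\<^sup>2)"
      by (simp add: X_def mult.assoc sum_distrib_left[symmetric] power_mult_distrib s2)
    also have "\<dots> = (\<Sum>j<2*k. \<Sum>i<2*k. (\<Sum>l<2*k. m i l * E l j)\<^sup>2)"
      by (intro sum.cong refl sum_jidx[of "\<lambda>i. (\<Sum>l<2*k. m i l * E l _)\<^sup>2"])
    also have "\<dots> \<le> (\<Sum>j<2*k. \<Delta>\<^sup>2 * (\<Sum>l<2*k. (E l j)\<^sup>2))" by (intro sum_mono op)
    also have "\<dots> = \<Delta>\<^sup>2 * (\<Sum>l<2*k. \<Sum>j<2*k. (E l j)\<^sup>2)" unfolding sum_distrib_left[symmetric] by (subst sum.swap) simp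
    finally show ?thesis unfolding EY .
  qed
  have EEle: "(\<Sum>i<2*k. \<Sum>j<2*k. (\<Sum>l<2*k. E i l * E l j)\<^sup>2) \<le> Y\<^sup>2"
  proof -
    have "(\<Sum>i<2*k. \<Sum>j<2*k. (\<Sum>l<2*k. E i l * E l j)\<^sup>2) \<le> (\<Sum>i<2*k. \<Sum>j<2*k. (\<Sum>l<2*k. (E i l)\<^sup>2) * (\<Sum>l<2*k. (E l j)\<^sup>2))"
      by (intro sum_mono Cauchy_Schwarz_ineq_sum)
    also have "\<dots> = (\<Sum>i<2*k. \<Sum>l<2*k. (E i l)\<^sup>2) * (\<Sum>j<2*k. \<Sum>l<2*k. (E l j)\<^sup>2)"
      by (simp add: sum_product)
    also have "(\<Sum>j<2*k. \<Sum>l<2*k. (E l j)\<^sup>2) = (\<Sum>l<2*k. \<Sum>j<2*k. (E l j)\<^sup>2)" by (rule sum.swap)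
    finally show ?thesis unfolding EY by (simp add: power2_eq_square)
  qed
  have "(\<Sum>i<2*k. \<Sum>j<2*k. (N i j)\<^sup>2) \<le> (\<Sum>i<2*k. \<Sum>j<2*k. 2 * (\<Sum>l<2*k. X i l * E l j)\<^sup>2 + 2 * la\<^sup>2 * (E i (jidx k j))\<^sup>2)"
  proof (intro sum_mono)
    fix i j assume "i \<in> {..<2*k}" "j \<in> {..<2*k}"
    then have "N i j = (\<Sum>l<2*k. X i l * E l j) + (- la * jsgn k j * E i (jidx k j))" using N1 by simp
    then show "(N i j)\<^sup>2 \<le> 2 * (\<Sum>l<2*k. X i l * E l j)\<^sup>2 + 2 * la\<^sup>2 * (E i (jidx k j))\<^sup>2"
      using sum_sq_le2[of "\<Sum>l<2*k. X i l * E l j" "- la * jsgn k j * E i (jidx k j)"] by (simp add: power_mult_distrib s2)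
  qed
  also have "\<dots> = 2 * (\<Sum>i<2*k. \<Sum>j<2*k. (\<Sum>l<2*k. X i l * E l j)\<^sup>2) + 2 * la\<^sup>2 * (\<Sum>i<2*k. \<Sum>j<2*k. (E i (jidx k j))\<^sup>2)"
    by (simp only: sum.distrib sum_distrib_left)
  also have "\<dots> \<le> 2 * (\<Delta>\<^sup>2 + la\<^sup>2) * Y" unfolding EJ using XEle by (simp add: algebra_simps)
  finally show "(\<Sum>i<2*k. \<Sum>j<2*k. (N i j)\<^sup>2) \<le> 2 * (\<Delta>\<^sup>2 + la\<^sup>2) * Y" .
  have "(\<Sum>i<2*k. \<Sum>j<2*k. (N i j)\<^sup>2) \<le> (\<Sum>i<2*k. \<Sum>j<2*k. 3 * (\<Sum>l<2*k. E i l * E l j)\<^sup>2 + 3 * la\<^sup>2 * (E (jidx k i) j)\<^sup>2 + 3 * la\<^sup>2 * (E i (jidx k j))\<^sup>2)"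
  proof (intro sum_mono)
    fix i j assume "i \<in> {..<2*k}" "j \<in> {..<2*k}"
    then have e: "N i j = (\<Sum>l<2*k. E i l * E l j) + la * jsgn k i * E (jidx k i) j + (- la * jsgn k j * E i (jidx k j))" using N2 by simp
    show "(N i j)\<^sup>2 \<le> 3 * (\<Sum>l<2*k. E i l * E l j)\<^sup>2 + 3 * la\<^sup>2 * (E (jidx k i) j)\<^sup>2 + 3 * la\<^sup>2 * (E i (jidx k j))\<^sup>2"
      unfolding e by (rule order.trans[OF sum_sq_le3]) (simp add: power_mult_distrib s2 distrib_left mult.assoc)
  qed
  also have "\<dots> = 3 * (\<Sum>i<2*k. \<Sum>j<2*k. (\<Sum>l<2*k. E i l * E l j)\<^sup>2) + 3 * la\<^sup>2 * (\<Sum>i<2*k. \<Sum>j<2*k. (E (jidx k i) j)\<^sup>2)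
      + 3 * la\<^sup>2 * (\<Sum>i<2*k. \<Sum>j<2*k. (E i (jidx k j))\<^sup>2)"
    by (simp only: sum.distrib sum_distrib_left)
  also have "\<dots> \<le> 3 * (Y\<^sup>2 + 2 * la\<^sup>2 * Y)" unfolding EJ JE using EEle by (simp add: algebra_simps)
  finally show "(\<Sum>i<2*k. \<Sum>j<2*k. (N i j)\<^sup>2) \<le> 3 * (Y\<^sup>2 + 2 * la\<^sup>2 * Y)" .
qed

text \<open>N = (J M)^2 + la^2 need not be symmetric, so the trace of N^2 is bounded by the squared
  Frobenius norm of N instead of being equal to it. Each eigenvalue occurs twice, which halves both
  bounds.\<close>

lemma symplectic_eigenvalue_defect:
  fixes la :: real
  assumes U: "U \<in> unitary_group n" and k: "k \<le> n" and z: "\<And>j. j < n \<Longrightarrow> 1 \<le> z n j \<and> z n j \<le> \<Delta>"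
    and l: "symplectic_eigenvalues k (Mcov_sub z n k U) lams"
  defines "Y \<equiv> sq_defect z n k la U"
  shows "(\<Sum>l\<leftarrow>lams. (l\<^sup>2 - la\<^sup>2)\<^sup>2) \<le> (\<Delta>\<^sup>2 + la\<^sup>2) * Y" "(\<Sum>l\<leftarrow>lams. (l\<^sup>2 - la\<^sup>2)\<^sup>2) \<le> 3 / 2 * (Y\<^sup>2 + 2 * la\<^sup>2 * Y)"
proof -
  define N where "N i j = (\<Sum>l<2*k. jsgn k i * msub z n k U (jidx k i) l * (jsgn k l * msub z n k U (jidx k l) j)) + (if i = j then la\<^sup>2 else 0)" for i j
  define C where "C = Jmat k * map_mat complex_of_real (Mcov_sub z n k U)"
  have C: "C \<in> carrier_mat (2*k) (2*k)" by (auto simp: C_def Jmat_def Mcov_sub_def)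
  have Cij: "C $$ (i, j) = complex_of_real (jsgn k i * msub z n k U (jidx k i) j)" if "i < 2*k" "j < 2*k" for i j
    unfolding C_def Jmat_mult_real using that by simp
  have "(\<Sum>i<2*k. \<Sum>j<2*k. complex_of_real (N i j) * complex_of_real (N j i)) = complex_of_real (2 * (\<Sum>l\<leftarrow>lams. (l\<^sup>2 - la\<^sup>2)\<^sup>2))"
  proof (rule symplectic_trace_identity[OF C])
    show "length lams = k" "char_poly C = (\<Prod>l\<leftarrow>lams. [:complex_of_real (l\<^sup>2), 0, 1:])"
      using l unfolding symplectic_eigenvalues_def C_def by auto
    show "complex_of_real (N i j) = (\<Sum>l<2*k. C $$ (i, l) * C $$ (l, j)) + (if i = j then complex_of_real (la\<^sup>2) else 0)"
      if "i < 2*k" "j < 2*k" for i j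
      using that by (simp add: N_def Cij)
  qed
  then have "complex_of_real (\<Sum>i<2*k. \<Sum>j<2*k. N i j * N j i) = complex_of_real (2 * (\<Sum>l\<leftarrow>lams. (l\<^sup>2 - la\<^sup>2)\<^sup>2))" by simp
  then have "2 * (\<Sum>l\<leftarrow>lams. (l\<^sup>2 - la\<^sup>2)\<^sup>2) = (\<Sum>i<2*k. \<Sum>j<2*k. N i j * N j i)" by (simp only: of_real_eq_iff)
  also have "\<dots> \<le> (\<Sum>i<2*k. \<Sum>j<2*k. ((N i j)\<^sup>2 + (N j i)\<^sup>2) / 2)"
  proof (intro sum_mono)
    fix i j show "N i j * N j i \<le> ((N i j)\<^sup>2 + (N j i)\<^sup>2) / 2" using sum_squares_bound[of "N i j" "N j i"] by simp
  qed
  also have "\<dots> = (\<Sum>i<2*k. \<Sum>j<2*k. (N i j)\<^sup>2)"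
  proof -
    have "(\<Sum>i<2*k. \<Sum>j<2*k. (N j i)\<^sup>2) = (\<Sum>i<2*k. \<Sum>j<2*k. (N i j)\<^sup>2)" by (rule sum.swap)
    then show ?thesis by (simp add: add_divide_distrib sum.distrib sum_divide_distrib[symmetric])
  qed
  finally have *: "2 * (\<Sum>l\<leftarrow>lams. (l\<^sup>2 - la\<^sup>2)\<^sup>2) \<le> (\<Sum>i<2*k. \<Sum>j<2*k. (N i j)\<^sup>2)" .
  have op: "(\<Sum>i<2*k. (\<Sum>j<2*k. msub z n k U i j * y j)\<^sup>2) \<le> \<Delta>\<^sup>2 * (\<Sum>j<2*k. (y j)\<^sup>2)" for y
    by (rule msub_op[where z=z, OF U k z])
  note sd = symplectic_square_defect[where m="msub z n k U" and k=k and \<Delta>=\<Delta> and la=la, OF op, folded N_def sq_defect_def, folded Y_def]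
  show "(\<Sum>l\<leftarrow>lams. (l\<^sup>2 - la\<^sup>2)\<^sup>2) \<le> (\<Delta>\<^sup>2 + la\<^sup>2) * Y" using order.trans[OF * sd(1)] unfolding mult.assoc by linarith
  show "(\<Sum>l\<leftarrow>lams. (l\<^sup>2 - la\<^sup>2)\<^sup>2) \<le> 3 / 2 * (Y\<^sup>2 + 2 * la\<^sup>2 * Y)" using order.trans[OF * sd(2)] by linarith
qed

lemma sum_list_abs_sq_le: "(\<Sum>x\<leftarrow>xs. \<bar>f x\<bar>)\<^sup>2 \<le> real (length xs) * (\<Sum>x\<leftarrow>xs. (f x)\<^sup>2)"
proof -
  have "(\<Sum>x\<leftarrow>xs. \<bar>f x\<bar>)\<^sup>2 = (\<Sum>i<length xs. 1 * \<bar>f (xs ! i)\<bar>)\<^sup>2" by (simp add: sum_list_sum_nth atLeast0LessThan)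
  also have "\<dots> \<le> (\<Sum>i<length xs. 1\<^sup>2) * (\<Sum>i<length xs. \<bar>f (xs ! i)\<bar>\<^sup>2)" by (rule Cauchy_Schwarz_ineq_sum)
  finally show ?thesis by (simp add: sum_list_sum_nth atLeast0LessThan)
qed

text \<open>Uses |l - la| \<le> |l^2 - la^2|, valid since l + la \<ge> 1, and Cauchy-Schwarz over
  the k eigenvalues, which costs the factor k. The first bound is linear in Y but loses \<Delta>^2;
  the second is free of \<Delta> and serves for Y \<le> 1.\<close>

lemma entropy_deviation:
  assumes U: "U \<in> unitary_group n" and k: "k \<le> n" and z: "\<And>j. j < n \<Longrightarrow> 1 \<le> z n j \<and> z n j \<le> \<Delta>"
    and la: "la \<ge> 1" and L: "\<And>l. l \<ge> 1 \<Longrightarrow> \<bar>Gfun l - Gfun la\<bar> \<le> L * \<bar>l - la\<bar>"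
  defines "Y \<equiv> sq_defect z n k la U" and "\<delta> \<equiv> real k * Gfun la - gauss_entropy k (Mcov_sub z n k U)"
  shows "\<delta>\<^sup>2 \<le> L\<^sup>2 * real k * (\<Delta>\<^sup>2 + la\<^sup>2) * Y" "\<delta>\<^sup>2 \<le> L\<^sup>2 * real k * (3 / 2 * (Y\<^sup>2 + 2 * la\<^sup>2 * Y))"
proof -
  obtain lams where l: "symplectic_eigenvalues k (Mcov_sub z n k U) lams"
    using symplectic_eigenvalues_exist[where z=z, OF U k] z by blast
  have len: "length lams = k" and ge: "\<And>l. l \<in> set lams \<Longrightarrow> l \<ge> 1" using l by (auto simp: symplectic_eigenvalues_def)
  have "\<bar>\<delta>\<bar> = \<bar>(\<Sum>l\<leftarrow>lams. Gfun la - Gfun l)\<bar>"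
    unfolding \<delta>_def gauss_entropy_eq[OF l] sum_list_subtractf by (simp add: len sum_list_triv)
  also have "\<dots> \<le> (\<Sum>l\<leftarrow>lams. \<bar>Gfun la - Gfun l\<bar>)" using sum_list_abs[of "map (\<lambda>l. Gfun la - Gfun l) lams"] by (simp add: o_def)
  also have "\<dots> \<le> (\<Sum>l\<leftarrow>lams. \<bar>L * (l\<^sup>2 - la\<^sup>2)\<bar>)"
  proof (rule sum_list_mono)
    fix l assume "l \<in> set lams"
    then have l1: "l \<ge> 1" using ge by simp
    have "\<bar>Gfun la - Gfun l\<bar> \<le> L * \<bar>l - la\<bar>" using L[OF l1] by (simp add: abs_minus_commute)
    also have "\<dots> \<le> \<bar>L\<bar> * (\<bar>l - la\<bar> * \<bar>l + la\<bar>)"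
    proof -
      have "\<bar>l - la\<bar> * 1 \<le> \<bar>l - la\<bar> * \<bar>l + la\<bar>" using l1 la by (intro mult_left_mono) auto
      then have "\<bar>L\<bar> * \<bar>l - la\<bar> \<le> \<bar>L\<bar> * (\<bar>l - la\<bar> * \<bar>l + la\<bar>)" by (intro mult_left_mono) auto
      moreover have "L * \<bar>l - la\<bar> \<le> \<bar>L\<bar> * \<bar>l - la\<bar>" by (intro mult_right_mono) auto
      ultimately show ?thesis by linarith
    qed
    also have "\<dots> = \<bar>L * (l\<^sup>2 - la\<^sup>2)\<bar>" by (simp add: abs_mult[symmetric] power2_eq_square algebra_simps)
    finally show "\<bar>Gfun la - Gfun l\<bar> \<le> \<bar>L * (l\<^sup>2 - la\<^sup>2)\<bar>" .
  qed
  finally have "\<bar>\<delta>\<bar>\<^sup>2 \<le> (\<Sum>l\<leftarrow>lams. \<bar>L * (l\<^sup>2 - la\<^sup>2)\<bar>)\<^sup>2" by (intro power_mono) auto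
  also have "\<dots> \<le> real (length lams) * (\<Sum>l\<leftarrow>lams. (L * (l\<^sup>2 - la\<^sup>2))\<^sup>2)" by (rule sum_list_abs_sq_le)
  also have "\<dots> = L\<^sup>2 * real k * (\<Sum>l\<leftarrow>lams. (l\<^sup>2 - la\<^sup>2)\<^sup>2)" by (simp add: len power_mult_distrib sum_list_const_mult)
  finally have *: "\<delta>\<^sup>2 \<le> L\<^sup>2 * real k * (\<Sum>l\<leftarrow>lams. (l\<^sup>2 - la\<^sup>2)\<^sup>2)" by simp
  have sd: "(\<Sum>l\<leftarrow>lams. (l\<^sup>2 - la\<^sup>2)\<^sup>2) \<le> (\<Delta>\<^sup>2 + la\<^sup>2) * Y" "(\<Sum>l\<leftarrow>lams. (l\<^sup>2 - la\<^sup>2)\<^sup>2) \<le> 3 / 2 * (Y\<^sup>2 + 2 * la\<^sup>2 * Y)"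
    unfolding Y_def using symplectic_eigenvalue_defect[where z=z, OF U k z l] by auto
  have "L\<^sup>2 * real k * (\<Sum>l\<leftarrow>lams. (l\<^sup>2 - la\<^sup>2)\<^sup>2) \<le> L\<^sup>2 * real k * ((\<Delta>\<^sup>2 + la\<^sup>2) * Y)"
    using sd(1) by (intro mult_left_mono) auto
  then show "\<delta>\<^sup>2 \<le> L\<^sup>2 * real k * (\<Delta>\<^sup>2 + la\<^sup>2) * Y" using * by (simp add: mult.assoc)
  have "L\<^sup>2 * real k * (\<Sum>l\<leftarrow>lams. (l\<^sup>2 - la\<^sup>2)\<^sup>2) \<le> L\<^sup>2 * real k * (3 / 2 * (Y\<^sup>2 + 2 * la\<^sup>2 * Y))"
    using sd(2) by (intro mult_left_mono) auto
  then show "\<delta>\<^sup>2 \<le> L\<^sup>2 * real k * (3 / 2 * (Y\<^sup>2 + 2 * la\<^sup>2 * Y))" using * by linarith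
qed

section \<open>Regularity of the entropy function\<close>

lemma gfun_deriv: "N > 0 \<Longrightarrow> (gfun has_real_derivative ln (N + 1) - ln N) (at N)"
proof -
  assume N: "N > 0"
  have "((\<lambda>N. (N + 1) * ln (N + 1) - N * ln N) has_real_derivative ln (N + 1) - ln N) (at N)"
    using N by (auto intro!: derivative_eq_intros simp: field_simps)
  moreover have "\<forall>\<^sub>F x in nhds N. (x + 1) * ln (x + 1) - x * ln x = gfun x"
    using N by (auto simp: gfun_def eventually_nhds intro!: exI[of _ "{0<..}"])
  ultimately show ?thesis by (subst (asm) DERIV_cong_ev) auto
qed

lemma gfun_mono: "0 \<le> N \<Longrightarrow> N \<le> N' \<Longrightarrow> gfun N \<le> gfun N'"
proof (cases "N = 0")
  case True
  assume "N \<le> N'"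
  have "N' * ln N' \<le> (N' + 1) * ln (N' + 1)" if "N' > 0"
  proof -
    have "N' * ln N' \<le> N' * ln (N' + 1)" using that by (intro mult_left_mono) auto
    also have "\<dots> \<le> (N' + 1) * ln (N' + 1)" using that by (intro mult_right_mono) auto
    finally show ?thesis .
  qed
  then show ?thesis using True \<open>N \<le> N'\<close> by (auto simp: gfun_def)
next
  case False
  assume "0 \<le> N" "N \<le> N'"
  with False have N: "N > 0" by simp
  show ?thesis
  proof (rule DERIV_nonneg_imp_nondecreasing[OF \<open>N \<le> N'\<close>])
    fix x assume "N \<le> x"
    then show "\<exists>y. (gfun has_real_derivative y) (at x) \<and> 0 \<le> y"
      using N by (intro exI[of _ "ln (x + 1) - ln x"] conjI gfun_deriv) auto
  qed
qed

text \<open>The derivative of G is unbounded near 1, so G is not Lipschitz on its whole domain. But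
  la stays above \<mu>: when l is near 1, the distance |l - la| is bounded below while the
  difference is at most G(B).\<close>

lemma Gfun_lipschitz:
  assumes "\<mu> > 1"
  shows "\<exists>L>0. \<forall>l\<ge>1. \<forall>la. \<mu> \<le> la \<longrightarrow> la \<le> B \<longrightarrow> \<bar>Gfun l - Gfun la\<bar> \<le> L * \<bar>l - la\<bar>"
proof -
  \<comment> \<open>(l - 1) / 2 = m is the midpoint l = (\<mu> + 1) / 2 of 1 and \<mu>; below it, la
    - l is at least (\<mu> - 1) / 2.\<close>
  define m where "m = (\<mu> - 1) / 4"
  define L1 where "L1 = ln (m + 1) - ln m"
  define L2 where "L2 = 2 * Gfun B / (\<mu> - 1)"
  define L where "L = max 1 (max L1 L2)"
  have m: "m > 0" using assms by (simp add: m_def)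
  have "\<bar>Gfun l - Gfun la\<bar> \<le> L * \<bar>l - la\<bar>" if l: "l \<ge> 1" and la: "\<mu> \<le> la" "la \<le> B" for l la
  proof (cases "(l - 1) / 2 \<ge> m")
    case True
    have "\<bar>gfun ((l - 1) / 2) - gfun ((la - 1) / 2)\<bar> \<le> L1 * \<bar>(l - 1) / 2 - (la - 1) / 2\<bar>"
    proof -
      have "norm (gfun ((l - 1) / 2) - gfun ((la - 1) / 2)) \<le> L1 * norm ((l - 1) / 2 - (la - 1) / 2)"
      proof (rule field_differentiable_bound[of "{m..}" gfun "\<lambda>x. ln (x + 1) - ln x"])
        fix x assume x: "x \<in> {m..}"
        show "(gfun has_field_derivative ln (x + 1) - ln x) (at x within {m..})"
          using x m by (intro has_field_derivative_at_within[OF gfun_deriv]) auto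
        have xm: "x \<ge> m" "x > 0" using x m by auto
        have "1 + 1 / x \<le> 1 + 1 / m" using xm m by (simp add: frac_le)
        moreover have "1 + 1 / x = (x + 1) / x" "1 + 1 / m = (m + 1) / m" using xm m by (simp_all add: add_divide_distrib)
        ultimately have "ln ((x + 1) / x) \<le> ln ((m + 1) / m)" using xm m by (subst ln_le_cancel_iff) auto
        moreover have "ln x \<le> ln (x + 1)" using xm by simp
        ultimately show "norm (ln (x + 1) - ln x) \<le> L1" using xm m by (simp add: L1_def ln_div)
      next
        have "m \<le> (la - 1) / 2" using la(1) assms by (simp add: m_def)
        then show "(la - 1) / 2 \<in> {m..}" by simp
        show "(l - 1) / 2 \<in> {m..}" using True by simp
      qed (rule convex_real_interval)
      then show ?thesis by simp
    qed
    also have "\<dots> = L1 / 2 * \<bar>l - la\<bar>"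
    proof -
      have "(l - 1) / 2 - (la - 1) / 2 = (l - la) / 2" by (simp add: diff_divide_distrib)
      then show ?thesis by (simp only:) simp
    qed
    also have "\<dots> \<le> L * \<bar>l - la\<bar>" by (intro mult_right_mono) (auto simp: L_def)
    finally show ?thesis by (simp add: Gfun_def)
  next
    case False
    have lm: "l \<le> (\<mu> + 1) / 2" using False by (simp add: m_def)
    have 1: "0 \<le> Gfun l" using gfun_mono[of 0 "(l - 1) / 2"] l by (simp add: Gfun_def gfun_def)
    have 2: "Gfun l \<le> Gfun la" unfolding Gfun_def using l la lm assms by (intro gfun_mono) auto
    have 3: "Gfun la \<le> Gfun B" unfolding Gfun_def using la assms by (intro gfun_mono) auto
    have "\<bar>Gfun l - Gfun la\<bar> \<le> Gfun B" using 1 2 3 by simp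
    also have "\<dots> = L2 * ((\<mu> - 1) / 2)" using assms by (simp add: L2_def)
    also have "\<dots> \<le> L * \<bar>l - la\<bar>"
    proof (rule mult_mono)
      show "L2 \<le> L" "0 \<le> L" by (auto simp: L_def)
      have "(\<mu> - 1) / 2 \<le> la - l" using lm la(1) by (simp add: field_simps)
      also have "la - l \<le> \<bar>l - la\<bar>" by (metis abs_ge_self abs_minus_commute)
      finally show "(\<mu> - 1) / 2 \<le> \<bar>l - la\<bar>" .
      show "0 \<le> (\<mu> - 1) / 2" using assms by simp
    qed
    finally show ?thesis .
  qed
  moreover have "L > 0" by (simp add: L_def)
  ultimately show ?thesis by blast
qed

section \<open>Measurability of the entropy event\<close>

lemma continuous_on_det:
  fixes F :: "'a::topological_space \<Rightarrow> nat \<Rightarrow> nat \<Rightarrow> complex"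
  assumes "\<And>i j. i < m \<Longrightarrow> j < m \<Longrightarrow> continuous_on S (\<lambda>U. F U i j)"
  shows "continuous_on S (\<lambda>U. det (mat m m (\<lambda>(i, j). F U i j)))"
proof -
  have "det (mat m m (\<lambda>(i, j). F U i j)) = (\<Sum>p\<in>{p. p permutes {0..<m}}. signof p * (\<Prod>i = 0..<m. F U i (p i)))" for U
    unfolding det_def'[of "mat m m (\<lambda>(i, j). F U i j)" m, OF mat_carrier]
    by (intro sum.cong refl arg_cong2[where f="(*)"] prod.cong) (auto simp: permutes_in_image)
  moreover have "continuous_on S (\<lambda>U. \<Sum>p\<in>{p. p permutes {0..<m}}. signof p * (\<Prod>i = 0..<m. F U i (p i)))"
  proof (intro continuous_on_sum continuous_on_mult continuous_on_const continuous_on_prod)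
    fix p i assume "p \<in> {p. p permutes {0..<m}}" "i \<in> {0..<m}"
    then have "i < m" "p i < m" using permutes_in_image[of p "{0..<m}" i] by auto
    then show "continuous_on S (\<lambda>U. F U i (p i))" by (rule assms)
  qed
  ultimately show ?thesis by simp
qed

lemma continuous_on_eta: "continuous_on UNIV (\<lambda>U. eta n U a b)"
  unfolding eta_def
  by (cases "a < n"; cases "b < n"; cases "a < 2*n"; cases "b < 2*n") (auto intro!: continuous_intros continuous_entry)

lemma continuous_on_msub: "continuous_on UNIV (\<lambda>U. msub z n k U i j)"
  unfolding msub_def Mcov_def by (intro continuous_intros continuous_on_eta)

text \<open>Evaluation at a fixed x avoids a topology on polynomials; the value is a determinant
  that depends continuously on the entries.\<close>

lemma continuous_on_char_poly:
  "continuous_on UNIV (\<lambda>U. poly (char_poly (Jmat k * map_mat complex_of_real (Mcov_sub z n k U))) x)"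
proof -
  define A where "A U = map_mat complex_of_real (mat (2*k) (2*k) (\<lambda>(i, j). jsgn k i * msub z n k U (jidx k i) j))" for U
  have A: "A U \<in> carrier_mat (2*k) (2*k)" for U by (simp add: A_def)
  have e: "poly (char_poly (A U)) x
     = det (mat (2*k) (2*k) (\<lambda>(i, j). (if i = j then x else 0) - complex_of_real (jsgn k i * msub z n k U (jidx k i) j)))" for U
    unfolding char_poly_matrix[OF A]
    by (rule arg_cong[where f=det], rule eq_matI) (auto simp: char_matrix_def A_def)
  show ?thesis unfolding Jmat_mult_real A_def[symmetric] e
    by (intro continuous_on_det continuous_on_diff continuous_on_const continuous_on_of_real continuous_on_mult continuous_on_msub)
qed

lemma continuous_on_Gfun: "continuous_on {1..} Gfun"
proof -
  have "continuous_on {0..} gfun"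
    unfolding continuous_on_def
  proof
    fix x :: real assume x: "x \<in> {0..}"
    show "(gfun \<longlongrightarrow> gfun x) (at x within {0..})"
    proof (cases "x = 0")
      case True
      \<comment> \<open>Since - N ln N = 2 N ln (1 / sqrt N) \<le> 2 sqrt N, the convention
        \<open>gfun 0 = 0\<close> is the continuous extension.\<close>
      have bound: "0 \<le> gfun N" "gfun N \<le> (N + 1) * N + 2 * sqrt N" if N: "N > 0" for N
      proof -
        show "0 \<le> gfun N" using gfun_mono[of 0 N] N by (simp add: gfun_def)
        have "- ln (sqrt N) = ln (inverse (sqrt N))" using N by (simp add: ln_inverse)
        also have "\<dots> \<le> inverse (sqrt N)" using ln_le_minus_one[of "inverse (sqrt N)"] N by simp
        finally have "N * (2 * - ln (sqrt N)) \<le> N * (2 * inverse (sqrt N))" using N by (intro mult_left_mono) auto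
        also have "\<dots> = 2 * sqrt N" using real_div_sqrt[of N] N by (simp add: divide_inverse)
        finally have "- (N * ln N) \<le> 2 * sqrt N" using N by (simp add: ln_sqrt)
        moreover have "(N + 1) * ln (N + 1) \<le> (N + 1) * N"
          using N ln_le_minus_one[of "N + 1"] by (intro mult_left_mono) auto
        moreover have "gfun N = (N + 1) * ln (N + 1) - N * ln N" using N by (simp add: gfun_def)
        ultimately show "gfun N \<le> (N + 1) * N + 2 * sqrt N" by linarith
      qed
      have "(gfun \<longlongrightarrow> 0) (at_right 0)"
      proof (rule tendsto_sandwich)
        show "\<forall>\<^sub>F N in at_right 0. 0 \<le> gfun N" "\<forall>\<^sub>F N in at_right 0. gfun N \<le> (N + 1) * N + 2 * sqrt N"
          using bound by (auto simp: eventually_at_filter)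
        show "((\<lambda>N::real. (N + 1) * N + 2 * sqrt N) \<longlongrightarrow> 0) (at_right 0)"
          by (auto intro!: tendsto_eq_intros)
      qed (rule tendsto_const)
      then show ?thesis using True by (simp add: gfun_def at_within_Ici_at_right)
    next
      case False
      then have "x > 0" using x by simp
      then have "isCont gfun x" using gfun_deriv DERIV_isCont by blast
      then show ?thesis using continuous_at_imp_continuous_at_within continuous_within by blast
    qed
  qed
  then show ?thesis unfolding Gfun_def[abs_def]
    by (rule continuous_on_compose2) (auto intro!: continuous_intros)
qed

text \<open>Tuples in [1, R] with entropy in S form a compact set, and a polynomial is encoded by
  its values at the naturals. The encoding is continuous in the tuple and in U, so the set is the
  preimage of a compact, hence closed, image. Sequences on all naturals stand for tuples, so that
  compactness of the box is Tychonoff's theorem.\<close>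

lemma closed_symplectic_bounded:
  assumes "closed S"
  shows "closed {U. \<exists>f. (\<forall>i. f i \<in> {1..R}) \<and> (\<Sum>i<k. Gfun (f i)) \<in> S \<and>
     char_poly (Jmat k * map_mat complex_of_real (Mcov_sub z n k U)) = (\<Prod>i<k. [:complex_of_real ((f i)\<^sup>2), 0, 1:])}"
proof -
  define p where "p U = char_poly (Jmat k * map_mat complex_of_real (Mcov_sub z n k U))" for U
  define q where "q f = (\<Prod>i<k. [:complex_of_real ((f i)\<^sup>2), 0, 1:])" for f :: "nat \<Rightarrow> real"
  define K where "K = {f :: nat \<Rightarrow> real. \<forall>i. f i \<in> {1..R}}"
  define h where "h f m = poly (q f) (of_nat m)" for f and m :: nat
  have co: "continuous_on K (\<lambda>f. f i)" for i :: nat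
    by (rule continuous_on_subset[OF continuous_on_product_coordinates]) simp
  have "compact K"
  proof -
    have "K = PiE UNIV (\<lambda>_. {1..R})" by (auto simp: K_def PiE_def Pi_def)
    moreover have "compactin (product_topology (\<lambda>_::nat. euclidean) UNIV) (PiE UNIV (\<lambda>_. {1..R}))"
      by (simp add: compactin_PiE compactin_euclidean_iff)
    ultimately show ?thesis by (simp add: euclidean_product_topology compactin_euclidean_iff)
  qed
  have "continuous_on K (\<lambda>f. \<Sum>i<k. Gfun (f i))"
    by (intro continuous_on_sum continuous_on_compose2[OF continuous_on_Gfun co]) (auto simp: K_def)
  then have "closed ((\<lambda>f. \<Sum>i<k. Gfun (f i)) -` S \<inter> K)"
    using continuous_on_closed_vimage[OF compact_imp_closed[OF \<open>compact K\<close>]] assms by blast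
  then have "compact (K \<inter> ((\<lambda>f. \<Sum>i<k. Gfun (f i)) -` S \<inter> K))" by (rule compact_Int_closed[OF \<open>compact K\<close>])
  moreover have "K \<inter> ((\<lambda>f. \<Sum>i<k. Gfun (f i)) -` S \<inter> K) = K \<inter> (\<lambda>f. \<Sum>i<k. Gfun (f i)) -` S" by blast
  ultimately have comp: "compact (K \<inter> (\<lambda>f. \<Sum>i<k. Gfun (f i)) -` S)" by simp
  have "continuous_on K h"
  proof (rule continuous_on_coordinatewise_then_product)
    fix m
    have "h f m = (\<Prod>i<k. complex_of_real (f i) ^ 2 + of_nat m * of_nat m)" for f
      by (simp add: h_def q_def poly_prod)
    moreover have "continuous_on K (\<lambda>f. \<Prod>i<k. complex_of_real (f i) ^ 2 + of_nat m * of_nat m)"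
      by (intro continuous_on_prod continuous_on_add continuous_on_power continuous_on_of_real co continuous_on_const)
    ultimately show "continuous_on K (\<lambda>f. h f m)" by simp
  qed
  then have "continuous_on (K \<inter> (\<lambda>f. \<Sum>i<k. Gfun (f i)) -` S) h" by (rule continuous_on_subset) blast
  then have "compact (h ` (K \<inter> (\<lambda>f. \<Sum>i<k. Gfun (f i)) -` S))" using comp by (rule compact_continuous_image)
  then have cl: "closed (h ` (K \<inter> (\<lambda>f. \<Sum>i<k. Gfun (f i)) -` S))" by (rule compact_imp_closed)
  have cp: "continuous_on UNIV (\<lambda>U m. poly (p U) (of_nat m))"
    unfolding p_def by (rule continuous_on_coordinatewise_then_product) (rule continuous_on_char_poly)
  \<comment> \<open>Agreement at infinitely many points makes the encoding injective.\<close>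
  have eq: "a = b" if "\<And>m::nat. poly a (of_nat m) = poly b (of_nat m)" for a b :: "complex poly"
  proof (rule ccontr)
    assume "a \<noteq> b"
    then have "finite {x. poly (a - b) x = 0}" by (intro poly_roots_finite) simp
    moreover have "range (of_nat :: nat \<Rightarrow> complex) \<subseteq> {x. poly (a - b) x = 0}" using that by auto
    ultimately have "finite (range (of_nat :: nat \<Rightarrow> complex))" using finite_subset by blast
    moreover have "infinite (range (of_nat :: nat \<Rightarrow> complex))" by (rule range_inj_infinite) (simp add: inj_on_def)
    ultimately show False by contradiction
  qed
  have "{U. \<exists>f. (\<forall>i. f i \<in> {1..R}) \<and> (\<Sum>i<k. Gfun (f i)) \<in> S \<and> p U = q f}
     = (\<lambda>U m. poly (p U) (of_nat m)) -` (h ` (K \<inter> (\<lambda>f. \<Sum>i<k. Gfun (f i)) -` S))"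
  proof (intro Set.set_eqI iffI)
    fix U assume "U \<in> {U. \<exists>f. (\<forall>i. f i \<in> {1..R}) \<and> (\<Sum>i<k. Gfun (f i)) \<in> S \<and> p U = q f}"
    then obtain f where "\<forall>i. f i \<in> {1..R}" "(\<Sum>i<k. Gfun (f i)) \<in> S" "p U = q f" by blast
    then show "U \<in> (\<lambda>U m. poly (p U) (of_nat m)) -` (h ` (K \<inter> (\<lambda>f. \<Sum>i<k. Gfun (f i)) -` S))"
      by (auto simp: K_def h_def[abs_def])
  next
    fix U assume "U \<in> (\<lambda>U m. poly (p U) (of_nat m)) -` (h ` (K \<inter> (\<lambda>f. \<Sum>i<k. Gfun (f i)) -` S))"
    then obtain f where f: "f \<in> K" "(\<Sum>i<k. Gfun (f i)) \<in> S" "(\<lambda>m. poly (p U) (of_nat m)) = h f" by blast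
    then have "p U = q f" by (intro eq) (metis h_def)
    then show "U \<in> {U. \<exists>f. (\<forall>i. f i \<in> {1..R}) \<and> (\<Sum>i<k. Gfun (f i)) \<in> S \<and> p U = q f}" using f by (auto simp: K_def)
  qed
  moreover have "closed ((\<lambda>U m. poly (p U) (of_nat m)) -` (h ` (K \<inter> (\<lambda>f. \<Sum>i<k. Gfun (f i)) -` S)))"
    by (rule closed_vimage[OF cl cp])
  ultimately show ?thesis unfolding p_def q_def by simp
qed

text \<open>Exhausting by the bounds R = m writes the set as a countable union of closed
  sets.\<close>

lemma borel_symplectic:
  assumes "closed S"
  shows "{U. \<exists>lams. symplectic_eigenvalues k (Mcov_sub z n k U) lams \<and> (\<Sum>l\<leftarrow>lams. Gfun l) \<in> S} \<in> sets borel"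
proof -
  define T where "T m = {U. \<exists>f. (\<forall>i. f i \<in> {1..real m}) \<and> (\<Sum>i<k. Gfun (f i)) \<in> S \<and>
     char_poly (Jmat k * map_mat complex_of_real (Mcov_sub z n k U)) = (\<Prod>i<k. [:complex_of_real ((f i)\<^sup>2), 0, 1:])}" for m :: nat
  have "{U. \<exists>lams. symplectic_eigenvalues k (Mcov_sub z n k U) lams \<and> (\<Sum>l\<leftarrow>lams. Gfun l) \<in> S} = (\<Union>m. T m)"
  proof (intro Set.set_eqI iffI)
    fix U assume "U \<in> {U. \<exists>lams. symplectic_eigenvalues k (Mcov_sub z n k U) lams \<and> (\<Sum>l\<leftarrow>lams. Gfun l) \<in> S}"
    then obtain lams where l: "symplectic_eigenvalues k (Mcov_sub z n k U) lams" "(\<Sum>l\<leftarrow>lams. Gfun l) \<in> S" by blast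
    \<comment> \<open>The value 1 beyond index k keeps the sequence inside the box.\<close>
    define f where "f i = (if i < k then lams ! i else 1)" for i
    have len: "length lams = k" using l by (simp add: symplectic_eigenvalues_def)
    have ge: "f i \<ge> 1" for i using l(1) len by (auto simp: f_def symplectic_eigenvalues_def)
    obtain m :: nat where m: "real m \<ge> 1 + (\<Sum>i<k. f i)" using real_arch_simple by blast
    have "f i \<le> real m" for i
    proof (cases "i < k")
      case True
      then have "f i \<le> (\<Sum>i<k. f i)" using ge order.trans[OF zero_le_one ge] by (intro member_le_sum) auto
      then show ?thesis using m by linarith
    next
      case False
      moreover have "(\<Sum>i<k. f i) \<ge> 0" using order.trans[OF zero_le_one ge] by (intro sum_nonneg) auto
      ultimately show ?thesis using m by (simp add: f_def)
    qed
    then have 1: "\<forall>i. f i \<in> {1..real m}" using ge by auto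
    have 2: "(\<Sum>i<k. Gfun (f i)) \<in> S" using l(2) len by (simp add: sum_list_sum_nth atLeast0LessThan f_def)
    have 3: "(\<Prod>l\<leftarrow>lams. [:complex_of_real (l\<^sup>2), 0, 1:]) = (\<Prod>i<k. [:complex_of_real ((f i)\<^sup>2), 0, 1:])"
      using len by (simp add: prod.list_conv_set_nth atLeast0LessThan f_def)
    have "char_poly (Jmat k * map_mat complex_of_real (Mcov_sub z n k U)) = (\<Prod>i<k. [:complex_of_real ((f i)\<^sup>2), 0, 1:])"
      using l(1) unfolding symplectic_eigenvalues_def 3[symmetric] by blast
    then have "U \<in> T m" unfolding T_def mem_Collect_eq using 1 2 by (intro exI[of _ f] conjI)
    then show "U \<in> (\<Union>m. T m)" by blast
  next
    fix U assume "U \<in> (\<Union>m. T m)"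
    then obtain f where f: "\<And>i. f i \<ge> 1" "(\<Sum>i<k. Gfun (f i)) \<in> S"
      "char_poly (Jmat k * map_mat complex_of_real (Mcov_sub z n k U)) = (\<Prod>i<k. [:complex_of_real ((f i)\<^sup>2), 0, 1:])"
      unfolding T_def by auto
    define lams where "lams = map f [0..<k]"
    have "(\<Prod>i<k. [:complex_of_real ((f i)\<^sup>2), 0, 1:]) = (\<Prod>l\<leftarrow>lams. [:complex_of_real (l\<^sup>2), 0, 1:])"
      by (simp add: prod.list_conv_set_nth atLeast0LessThan lams_def)
    moreover have "(\<Sum>l\<leftarrow>lams. Gfun l) = (\<Sum>i<k. Gfun (f i))"
      by (simp add: sum_list_sum_nth atLeast0LessThan lams_def)
    ultimately have "symplectic_eigenvalues k (Mcov_sub z n k U) lams \<and> (\<Sum>l\<leftarrow>lams. Gfun l) \<in> S"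
      unfolding symplectic_eigenvalues_def f(3) using f(1,2) by (auto simp: lams_def)
    then show "U \<in> {U. \<exists>lams. symplectic_eigenvalues k (Mcov_sub z n k U) lams \<and> (\<Sum>l\<leftarrow>lams. Gfun l) \<in> S}" by blast
  qed
  moreover have "T m \<in> sets borel" for m
    unfolding T_def by (intro borel_closed closed_symplectic_bounded assms)
  ultimately show ?thesis by auto
qed

text \<open>Without this the event could have measure 0 by convention. It ranges over all matrices,
  including those without symplectic eigenvalues, where the definite description is one fixed
  real.\<close>

lemma borel_entropy_event:
  "{U. \<bar>c - gauss_entropy k (Mcov_sub z n k U)\<bar> \<le> \<epsilon>} \<in> sets borel"
proof -
  let ?sym = "\<lambda>U. symplectic_eigenvalues k (Mcov_sub z n k U)"
  let ?E = "\<lambda>S. {U. \<exists>lams. ?sym U lams \<and> (\<Sum>l\<leftarrow>lams. Gfun l) \<in> S}"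
  \<comment> \<open>the junk value of \<open>gauss_entropy\<close> off the set where symplectic eigenvalues exist\<close>
  define junk :: real where "junk = (THE s. False)"
  have j: "gauss_entropy k (Mcov_sub z n k U) = junk" if "\<not> (\<exists>lams. ?sym U lams)" for U
    using that unfolding gauss_entropy_def junk_def by simp
  have "{U. \<bar>c - gauss_entropy k (Mcov_sub z n k U)\<bar> \<le> \<epsilon>} = ?E {c - \<epsilon>..c + \<epsilon>} \<union> (if \<bar>c - junk\<bar> \<le> \<epsilon> then - ?E UNIV else {})"
  proof (intro Set.set_eqI)
    fix U
    show "U \<in> {U. \<bar>c - gauss_entropy k (Mcov_sub z n k U)\<bar> \<le> \<epsilon>} \<longleftrightarrow> U \<in> ?E {c - \<epsilon>..c + \<epsilon>} \<union> (if \<bar>c - junk\<bar> \<le> \<epsilon> then - ?E UNIV else {})"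
    proof (cases "\<exists>lams. ?sym U lams")
      case True
      then obtain lams where l: "?sym U lams" by blast
      have E: "U \<in> ?E S \<longleftrightarrow> gauss_entropy k (Mcov_sub z n k U) \<in> S" for S
      proof
        assume "U \<in> ?E S"
        then show "gauss_entropy k (Mcov_sub z n k U) \<in> S" using gauss_entropy_eq by force
      next
        assume "gauss_entropy k (Mcov_sub z n k U) \<in> S"
        then show "U \<in> ?E S" using l gauss_entropy_eq[OF l] by auto
      qed
      have "U \<notin> (if \<bar>c - junk\<bar> \<le> \<epsilon> then - ?E UNIV else {})" using E[of UNIV] by (simp split: if_splits)
      then show ?thesis using E[of "{c - \<epsilon>..c + \<epsilon>}"] by (simp only: Un_iff mem_Collect_eq) auto
    next
      case False
      then show ?thesis using j[OF False] by auto
    qed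
  qed
  moreover have "?E {c - \<epsilon>..c + \<epsilon>} \<in> sets borel" "?E UNIV \<in> sets borel" by (intro borel_symplectic; simp)+
  moreover from this have "- ?E UNIV \<in> sets borel" using borel_comp by blast
  ultimately show ?thesis by (cases "\<bar>c - junk\<bar> \<le> \<epsilon>") auto
qed

section \<open>The concentration estimate\<close>

text \<open>The sums of squares are linear in \<Delta>, because p^2 \<le> \<Delta> p and the sum of
  p is n la. The cruder bound n \<Delta>^2 would double the \<zeta> in the threshold for
  \<epsilon>.\<close>

lemma avg_energy_bounds:
  assumes n: "n \<ge> 1" and zz: "\<forall>j<n. 1 \<le> z n j \<and> z n j \<le> \<Delta>"
  defines "la \<equiv> avg_energy z n" and "p \<equiv> \<lambda>j. (z n j + 1 / z n j) / 2" and "q \<equiv> \<lambda>j. (z n j - 1 / z n j) / 2"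
  shows "1 \<le> la" "la \<le> \<Delta>" "\<And>j. j < n \<Longrightarrow> \<bar>p j - la\<bar> \<le> \<Delta>" "\<And>j. j < n \<Longrightarrow> \<bar>q j\<bar> \<le> \<Delta>"
    "(\<Sum>j<n. p j - la) = 0" "(\<Sum>j<n. (p j - la)\<^sup>2) \<le> \<Delta> * real n * la" "(\<Sum>j<n. (q j)\<^sup>2) \<le> \<Delta> * real n * la"
proof -
  have z: "1 \<le> z n j \<and> z n j \<le> \<Delta>" if "j < n" for j using zz that by simp
  have inv: "0 < 1 / z n j" "1 / z n j \<le> 1" if "j < n" for j using z[OF that] by auto
  have p1: "1 \<le> p j" "p j \<le> \<Delta>" if "j < n" for j
  proof -
    have "0 \<le> (z n j - 1)\<^sup>2 / z n j" using z[OF that] by simp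
    also have "\<dots> = z n j + 1 / z n j - 2" using z[OF that] by (simp add: field_simps power2_eq_square)
    finally show "1 \<le> p j" by (simp add: p_def)
    have "z n j \<le> \<Delta>" "1 / z n j \<le> \<Delta>" using z[OF that] inv(2)[OF that] by linarith+
    then have "z n j + 1 / z n j \<le> \<Delta> + \<Delta>" by (rule add_mono)
    then show "p j \<le> \<Delta>" by (simp add: p_def)
  qed
  have q1: "0 \<le> q j" "q j \<le> p j" if "j < n" for j
  proof -
    have "1 / z n j \<le> z n j" using z[OF that] inv(2)[OF that] by linarith
    then show "0 \<le> q j" by (simp add: q_def)
    show "q j \<le> p j" using inv[OF that] by (simp add: p_def q_def field_simps)
  qed
  have sp: "(\<Sum>j<n. p j) = real n * la"
    using n unfolding la_def avg_energy_def p_def by (simp add: sum_divide_distrib[symmetric])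
  have "real n * 1 \<le> (\<Sum>j<n. p j)" using sum_mono[of "{..<n}" "\<lambda>_. 1" p] p1 by simp
  then show la1: "1 \<le> la" unfolding sp using n by simp
  have "(\<Sum>j<n. p j) \<le> real n * \<Delta>" using sum_mono[of "{..<n}" p "\<lambda>_. \<Delta>"] p1 by simp
  then show la2: "la \<le> \<Delta>" unfolding sp using n by simp
  show "\<bar>p j - la\<bar> \<le> \<Delta>" if "j < n" for j using p1[OF that] la1 la2 by (auto simp: abs_le_iff)
  show "\<bar>q j\<bar> \<le> \<Delta>" if "j < n" for j using p1[OF that] q1[OF that] by (auto simp: abs_le_iff)
  show "(\<Sum>j<n. p j - la) = 0" using sp by (simp add: sum_subtractf)
  have pp: "(\<Sum>j<n. (p j)\<^sup>2) \<le> \<Delta> * real n * la"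
  proof -
    have "(\<Sum>j<n. (p j)\<^sup>2) \<le> (\<Sum>j<n. \<Delta> * p j)"
      unfolding power2_eq_square using p1 order.trans[OF zero_le_one p1(1)] by (intro sum_mono mult_right_mono) auto
    then show ?thesis by (simp add: sum_distrib_left[symmetric] sp mult.assoc)
  qed
  have "(\<Sum>j<n. (p j - la)\<^sup>2) = (\<Sum>j<n. (p j)\<^sup>2) - 2 * la * (\<Sum>j<n. p j) + real n * la\<^sup>2"
    by (simp add: power2_diff sum.distrib sum_subtractf sum_distrib_left algebra_simps)
  also have "\<dots> = (\<Sum>j<n. (p j)\<^sup>2) - real n * la\<^sup>2" unfolding sp by (simp add: power2_eq_square algebra_simps)
  also have "\<dots> \<le> (\<Sum>j<n. (p j)\<^sup>2)" by simp
  finally show "(\<Sum>j<n. (p j - la)\<^sup>2) \<le> \<Delta> * real n * la" using pp by linarith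
  have "(\<Sum>j<n. (q j)\<^sup>2) \<le> (\<Sum>j<n. (p j)\<^sup>2)" using q1 by (intro sum_mono power_mono) auto
  then show "(\<Sum>j<n. (q j)\<^sup>2) \<le> \<Delta> * real n * la" using pp by linarith
qed

section \<open>Tail bounds for the Frobenius defect\<close>

lemma borel_sq_defect: "sq_defect z n k la \<in> borel_measurable borel"
  unfolding sq_defect_def
  by (intro borel_measurable_continuous_onI continuous_intros continuous_on_msub)

text \<open>Three scales: a worst-case bound, a first-moment bound that sees the mean of order k^2
  \<Delta> la / n, and an exponential tail that starts only at order k^2 \<Delta>^2 / n.\<close>

lemma sq_defect_concentration:
  assumes P: "haar_unitary n P" and k: "1 \<le> k" "k \<le> n" and z: "\<And>j. j < n \<Longrightarrow> 1 \<le> z n j \<and> z n j \<le> \<Delta>"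
  defines "la \<equiv> avg_energy z n"
  shows "\<And>U. U \<in> unitary_group n \<Longrightarrow> sq_defect z n k la U \<le> 4 * real k * \<Delta>\<^sup>2"
    "T > 0 \<Longrightarrow> measure P {U. sq_defect z n k la U \<ge> T} \<le> 8 * (real k)\<^sup>2 * \<Delta> * la / (real n * T)"
    "T \<ge> 384 * \<Delta>\<^sup>2 * (real k)\<^sup>2 / real n \<Longrightarrow> measure P {U. sq_defect z n k la U \<ge> T} \<le> exp (- T * real n / (384 * \<Delta>\<^sup>2))"
proof -
  interpret prob_space P using haar_AE_unitary[OF P] by simp
  have s: "sets P = sets borel" using haar_AE_unitary[OF P] by simp
  have sp: "space P = UNIV" using sets_eq_imp_space_eq[OF s] by simp
  have n: "n \<ge> 1" using k by simp
  define d where "d j = (z n j + 1 / z n j) / 2 - la" for j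
  define q where "q j = (z n j - 1 / z n j) / 2" for j
  have zz: "\<forall>j<n. 1 \<le> z n j \<and> z n j \<le> \<Delta>" using z by simp
  note b = avg_energy_bounds[where z=z, OF n zz, folded la_def, folded d_def q_def]
  have \<Delta>: "\<Delta> > 0" using b(1,2) by linarith
  define F where "F U = (\<Sum>s<k. \<Sum>t<k. (cmod (herm_quad n d U s t))\<^sup>2)" for U
  define H where "H U = (\<Sum>s<k. \<Sum>t<k. (cmod (sym_quad n q U s t))\<^sup>2)" for U
  have Y: "sq_defect z n k la U = 2 * (F U + H U)" if "U \<in> unitary_group n" for U
    unfolding F_def H_def d_def[abs_def] q_def[abs_def] by (rule sq_defect_eq[OF that k(2)])
  note hc = herm_quad_concentration[where d=d and \<Delta>=\<Delta>, OF P k b(3) \<Delta> b(5), folded F_def]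
  note sc = sym_quad_concentration[where d=q and \<Delta>=\<Delta>, OF P k b(4) \<Delta>, folded H_def]
  have iF: "integrable P F" and iH: "integrable P H" by (rule hc(1), assumption) (rule sc(1), assumption)
  have mF: "(\<integral>U. F U \<partial>P) \<le> 2 * (real k)\<^sup>2 / (real n)\<^sup>2 * (\<Sum>j<n. (d j)\<^sup>2)" by (rule hc(2))
  have mH: "(\<integral>U. H U \<partial>P) \<le> 2 * (real k)\<^sup>2 / (real n)\<^sup>2 * (\<Sum>j<n. (q j)\<^sup>2)" by (rule sc(2))
  show "sq_defect z n k la U \<le> 4 * real k * \<Delta>\<^sup>2" if U: "U \<in> unitary_group n" for U
  proof -
    have sub: "(\<Sum>t<k. g t) \<le> (\<Sum>t<n. g t)" if "\<And>t. g t \<ge> 0" for g :: "nat \<Rightarrow> real"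
      using k that by (intro sum_mono2) auto
    have sq: "x\<^sup>2 \<le> \<Delta>\<^sup>2" if "\<bar>x\<bar> \<le> \<Delta>" for x using that \<Delta> by (simp add: abs_le_square_iff[symmetric])
    have "F U \<le> (\<Sum>s<k. \<Delta>\<^sup>2)" unfolding F_def
    proof (intro sum_mono)
      fix s assume "s \<in> {..<k}"
      then have s: "s < n" using k by auto
      have "(\<Sum>t<k. (cmod (herm_quad n d U s t))\<^sup>2) \<le> (\<Sum>t<n. (cmod (herm_quad n d U s t))\<^sup>2)" by (rule sub) simp
      also have "\<dots> \<le> \<Delta>\<^sup>2" unfolding herm_quad_row[OF U s] by (rule row_weight_le[OF U s]) (rule sq, rule b(3))
      finally show "(\<Sum>t<k. (cmod (herm_quad n d U s t))\<^sup>2) \<le> \<Delta>\<^sup>2" .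
    qed
    moreover have "H U \<le> (\<Sum>s<k. \<Delta>\<^sup>2)" unfolding H_def
    proof (intro sum_mono)
      fix s assume "s \<in> {..<k}"
      then have s: "s < n" using k by auto
      have "(\<Sum>t<k. (cmod (sym_quad n q U s t))\<^sup>2) \<le> (\<Sum>t<n. (cmod (sym_quad n q U s t))\<^sup>2)" by (rule sub) simp
      also have "\<dots> \<le> \<Delta>\<^sup>2" unfolding sym_quad_row[OF U s] by (rule row_weight_le[OF U s]) (rule sq, rule b(4))
      finally show "(\<Sum>t<k. (cmod (sym_quad n q U s t))\<^sup>2) \<le> \<Delta>\<^sup>2" .
    qed
    ultimately show ?thesis unfolding Y[OF U] by simp
  qed
  have np: "real n > 0" using n by simp
  have ms: "{U. sq_defect z n k la U \<ge> T} \<in> sets P" for T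
  proof -
    have "{U \<in> space borel. T \<le> sq_defect z n k la U} \<in> sets borel"
      using borel_sq_defect by (intro borel_measurable_le borel_measurable_const) auto
    then show ?thesis using s by simp
  qed
  have Ynn: "sq_defect z n k la U \<ge> 0" for U unfolding sq_defect_def by (intro sum_nonneg) auto
  show "measure P {U. sq_defect z n k la U \<ge> T} \<le> 8 * (real k)\<^sup>2 * \<Delta> * la / (real n * T)" if T: "T > 0"
  proof -
    have AE: "AE U in P. sq_defect z n k la U = 2 * (F U + H U)" using haar_AE_unitary(1)[OF P] Y by auto
    have bm: "sq_defect z n k la \<in> borel_measurable P" using borel_sq_defect measurable_cong_sets[OF s refl] by blast
    have bFH: "(\<lambda>U. 2 * (F U + H U)) \<in> borel_measurable P"
      using iF iH by (intro borel_measurable_integrable) simp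
    have int: "integrable P (sq_defect z n k la)"
      using integrable_cong_AE[OF bm bFH AE] iF iH by simp
    have "(\<integral>U. sq_defect z n k la U \<partial>P) = (\<integral>U. 2 * (F U + H U) \<partial>P)" by (rule integral_cong_AE[OF bm bFH AE])
    also have "\<dots> = 2 * ((\<integral>U. F U \<partial>P) + (\<integral>U. H U \<partial>P))" using iF iH by simp
    also have "\<dots> \<le> 2 * (2 * (real k)\<^sup>2 / (real n)\<^sup>2 * (\<Delta> * real n * la) + 2 * (real k)\<^sup>2 / (real n)\<^sup>2 * (\<Delta> * real n * la))"
    proof -
      have 1: "2 * (real k)\<^sup>2 / (real n)\<^sup>2 * (\<Sum>j<n. (d j)\<^sup>2) \<le> 2 * (real k)\<^sup>2 / (real n)\<^sup>2 * (\<Delta> * real n * la)"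
        using b(6) by (intro mult_left_mono) auto
      have 2: "2 * (real k)\<^sup>2 / (real n)\<^sup>2 * (\<Sum>j<n. (q j)\<^sup>2) \<le> 2 * (real k)\<^sup>2 / (real n)\<^sup>2 * (\<Delta> * real n * la)"
        using b(7) by (intro mult_left_mono) auto
      show ?thesis
        by (rule mult_left_mono[OF add_mono[OF order.trans[OF mF 1] order.trans[OF mH 2]]]) simp
    qed
    also have "\<dots> = 8 * (real k)\<^sup>2 * \<Delta> * la / real n" using np by (simp add: field_simps power2_eq_square)
    finally have E: "(\<integral>U. sq_defect z n k la U \<partial>P) \<le> 8 * (real k)\<^sup>2 * \<Delta> * la / real n" .
    have "prob {U \<in> space P. sq_defect z n k la U \<ge> T} \<le> (\<integral>U. sq_defect z n k la U \<partial>P) / T"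
      using integral_Markov_inequality_measure[OF int, of "{}" T] T Ynn by simp
    also have "\<dots> \<le> (8 * (real k)\<^sup>2 * \<Delta> * la / real n) / T" using E T by (intro divide_right_mono) auto
    finally show ?thesis by (simp add: sp)
  qed
  assume T: "T \<ge> 384 * \<Delta>\<^sup>2 * (real k)\<^sup>2 / real n"
  \<comment> \<open>Y = 2 (F + H) \<ge> T forces F or H above T / 4, each with probability at most
    exp (- y). The factor 2 of the union bound is absorbed by halving y, which y \<ge> 2 permits; so
    384 is 48 times 4 times 2.\<close>
  define y where "y = T * real n / (192 * \<Delta>\<^sup>2)"
  have d2: "\<Delta>\<^sup>2 > 0" using \<Delta> by simp
  have y2: "y \<ge> 2"
  proof -
    have "T * real n \<ge> 384 * \<Delta>\<^sup>2 * (real k)\<^sup>2" using T np by (simp add: field_simps)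
    moreover have "384 * \<Delta>\<^sup>2 * (real k)\<^sup>2 \<ge> 384 * \<Delta>\<^sup>2 * 1" using k by (intro mult_left_mono) auto
    ultimately have "T * real n \<ge> 2 * (192 * \<Delta>\<^sup>2)" by linarith
    then show ?thesis unfolding y_def using d2 by (simp add: le_divide_eq)
  qed
  have T4: "T / 4 \<ge> 48 * \<Delta>\<^sup>2 * (real k)\<^sup>2 / real n"
  proof -
    define r where "r = \<Delta>\<^sup>2 * (real k)\<^sup>2 / real n"
    have "r \<ge> 0" using np by (simp add: r_def)
    moreover have "384 * r \<le> T" using T by (simp add: r_def mult.assoc)
    ultimately have "48 * r \<le> T / 4" by linarith
    then show ?thesis by (simp add: r_def mult.assoc)
  qed
  have ye: "- (T / 4) * real n / (48 * \<Delta>\<^sup>2) = - y" by (simp add: y_def)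
  have setF: "{U. F U \<ge> T / 4} \<in> sets P" "{U. H U \<ge> T / 4} \<in> sets P"
  proof -
    have "{U \<in> space P. T / 4 \<le> F U} \<in> sets P" "{U \<in> space P. T / 4 \<le> H U} \<in> sets P"
      using borel_measurable_integrable[OF iF] borel_measurable_integrable[OF iH] by measurable
    then show "{U. F U \<ge> T / 4} \<in> sets P" "{U. H U \<ge> T / 4} \<in> sets P" by (simp_all add: sp)
  qed
  have "prob {U. sq_defect z n k la U \<ge> T} \<le> prob ({U. F U \<ge> T / 4} \<union> {U. H U \<ge> T / 4})"
  proof (rule finite_measure_mono_AE)
    show "AE U in P. U \<in> {U. sq_defect z n k la U \<ge> T} \<longrightarrow> U \<in> {U. F U \<ge> T / 4} \<union> {U. H U \<ge> T / 4}"
      using haar_AE_unitary(1)[OF P] by eventually_elim (auto simp: Y)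
    show "{U. F U \<ge> T / 4} \<union> {U. H U \<ge> T / 4} \<in> events" using setF by auto
  qed
  also have "\<dots> \<le> prob {U. F U \<ge> T / 4} + prob {U. H U \<ge> T / 4}" using setF by (rule measure_Un_le)
  also have "\<dots> \<le> exp (- y) + exp (- y)"
  proof (rule add_mono)
    have "prob {U. F U \<ge> T / 4} \<le> exp (- (T / 4) * real n / (48 * \<Delta>\<^sup>2))" by (rule hc(3)[OF _ T4])
    then show "prob {U. F U \<ge> T / 4} \<le> exp (- y)" unfolding ye .
    have "prob {U. H U \<ge> T / 4} \<le> exp (- (T / 4) * real n / (48 * \<Delta>\<^sup>2))" by (rule sc(3)[OF _ T4])
    then show "prob {U. H U \<ge> T / 4} \<le> exp (- y)" unfolding ye .
  qed
  also have "\<dots> \<le> exp (- y / 2)"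
  proof -
    have "2 \<le> exp (y / 2)" using y2 exp_ge_add_one_self[of "y / 2"] by linarith
    then have "2 * exp (- y) \<le> exp (y / 2) * exp (- y)" by (intro mult_right_mono) auto
    also have "\<dots> = exp (- y / 2)" by (simp add: exp_add[symmetric])
    finally show ?thesis by simp
  qed
  also have "- y / 2 = - T * real n / (384 * \<Delta>\<^sup>2)" by (simp add: y_def)
  finally show "measure P {U. sq_defect z n k la U \<ge> T} \<le> exp (- T * real n / (384 * \<Delta>\<^sup>2))" .
qed

text \<open>At the crossover \<epsilon> = N^((6\<zeta>+3\<kappa>)/4) the claimed exponent equals
  N^(1-2\<zeta>), the tail rate at T = 1 up to constants. Below it the claim is also dominated by
  the rate at T = \<epsilon>^2 / k.\<close>

lemma exponent_case_small:
  fixes N \<epsilon> \<zeta> \<kappa> :: real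
  assumes N: "N \<ge> 1" and e: "0 < \<epsilon>" "\<epsilon> \<le> N powr ((6*\<zeta> + 3*\<kappa>) / 4)" and "\<zeta> \<ge> 0" "\<kappa> \<ge> 0"
  shows "\<epsilon> ^ 4 * N powr (1 - 8*\<zeta> - 3*\<kappa>) \<le> N powr (1 - 2*\<zeta>)"
    "\<epsilon> ^ 4 * N powr (1 - 8*\<zeta> - 3*\<kappa>) \<le> \<epsilon>\<^sup>2 * N powr (1 - 2*\<zeta> - \<kappa>)"
proof -
  have pw: "(N powr a) ^ m = N powr (real m * a)" for a m using N by (simp add: powr_realpow[symmetric] powr_powr mult.commute)
  have "\<epsilon> ^ 4 \<le> (N powr ((6*\<zeta> + 3*\<kappa>) / 4)) ^ 4" using e by (intro power_mono) auto
  also have "\<dots> = N powr (6*\<zeta> + 3*\<kappa>)" unfolding pw by (rule arg_cong[where f="(powr) N"]) (simp add: field_simps)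
  finally have "\<epsilon> ^ 4 * N powr (1 - 8*\<zeta> - 3*\<kappa>) \<le> N powr (6*\<zeta> + 3*\<kappa>) * N powr (1 - 8*\<zeta> - 3*\<kappa>)" by (intro mult_right_mono) auto
  also have "\<dots> = N powr (1 - 2*\<zeta>)" unfolding powr_add[symmetric] by (rule arg_cong[where f="(powr) N"]) simp
  finally show "\<epsilon> ^ 4 * N powr (1 - 8*\<zeta> - 3*\<kappa>) \<le> N powr (1 - 2*\<zeta>)" .
  have "\<epsilon>\<^sup>2 \<le> (N powr ((6*\<zeta> + 3*\<kappa>) / 4))\<^sup>2" using e by (intro power_mono) auto
  also have "\<dots> = N powr (3*\<zeta> + 3/2*\<kappa>)" unfolding pw by (rule arg_cong[where f="(powr) N"]) (simp add: field_simps)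
  finally have "\<epsilon>\<^sup>2 * (\<epsilon>\<^sup>2 * N powr (1 - 8*\<zeta> - 3*\<kappa>)) \<le> \<epsilon>\<^sup>2 * (N powr (3*\<zeta> + 3/2*\<kappa>) * N powr (1 - 8*\<zeta> - 3*\<kappa>))"
    by (intro mult_left_mono mult_right_mono) auto
  also have "\<dots> \<le> \<epsilon>\<^sup>2 * N powr (1 - 2*\<zeta> - \<kappa>)"
    unfolding powr_add[symmetric] using N assms(4,5) by (intro mult_left_mono powr_mono) auto
  also have "\<epsilon>\<^sup>2 * (\<epsilon>\<^sup>2 * N powr (1 - 8*\<zeta> - 3*\<kappa>)) = \<epsilon> ^ 4 * N powr (1 - 8*\<zeta> - 3*\<kappa>)"
    by (simp add: power2_eq_square power4_eq_xxxx)
  finally show "\<epsilon> ^ 4 * N powr (1 - 8*\<zeta> - 3*\<kappa>) \<le> \<epsilon>\<^sup>2 * N powr (1 - 2*\<zeta> - \<kappa>)" .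
qed

text \<open>The hypothesis excludes \<epsilon> beyond the worst-case deviation. The right-hand side
  is, up to constants, the tail rate at T = \<epsilon>^2 / (k N^(2\<zeta>)).\<close>

lemma exponent_case_large:
  fixes N \<epsilon> \<zeta> \<kappa> A :: real
  assumes N: "N \<ge> 1" and e: "\<epsilon>\<^sup>2 \<le> A * N powr (4*\<zeta> + 2*\<kappa>)"
  shows "\<epsilon> ^ 4 * N powr (1 - 8*\<zeta> - 3*\<kappa>) \<le> A * \<epsilon>\<^sup>2 * N powr (1 - 4*\<zeta> - \<kappa>)"
proof -
  have "\<epsilon>\<^sup>2 * (\<epsilon>\<^sup>2 * N powr (1 - 8*\<zeta> - 3*\<kappa>)) \<le> \<epsilon>\<^sup>2 * (A * N powr (4*\<zeta> + 2*\<kappa>) * N powr (1 - 8*\<zeta> - 3*\<kappa>))"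
    using e by (intro mult_left_mono mult_right_mono) auto
  also have "A * N powr (4*\<zeta> + 2*\<kappa>) * N powr (1 - 8*\<zeta> - 3*\<kappa>) = A * N powr (1 - 4*\<zeta> - \<kappa>)"
    unfolding mult.assoc powr_add[symmetric] by (simp add: algebra_simps)
  finally show ?thesis by (simp add: power2_eq_square power4_eq_xxxx mult_ac)
qed

text \<open>The product of the two lower bounds on \<epsilon>. It puts T = \<epsilon>^2 / (k
  N^(2\<zeta>)) above the start N^(2\<zeta>+2\<kappa>-1) of the exponential tail.\<close>

lemma exponent_threshold_large:
  fixes N \<epsilon> \<zeta> \<kappa> D :: real
  assumes N: "N \<ge> 1" and e: "\<epsilon> \<ge> N powr ((6*\<zeta> + 3*\<kappa>) / 4)" "\<epsilon> \<ge> D * N powr ((\<zeta> + 3*\<kappa> - 1) / 2)" and D: "D \<ge> 0"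
    and lt: "8*\<zeta> + 3*\<kappa> < 1"
  shows "D * N powr (4*\<zeta> + 3*\<kappa> - 1) \<le> \<epsilon>\<^sup>2"
proof -
  have "D * N powr (4*\<zeta> + 3*\<kappa> - 1) \<le> D * N powr ((6*\<zeta> + 3*\<kappa>) / 4 + (\<zeta> + 3*\<kappa> - 1) / 2)"
    using D N lt by (intro mult_left_mono powr_mono) (auto simp: field_simps)
  also have "\<dots> = N powr ((6*\<zeta> + 3*\<kappa>) / 4) * (D * N powr ((\<zeta> + 3*\<kappa> - 1) / 2))" by (simp add: powr_add)
  also have "\<dots> \<le> \<epsilon> * \<epsilon>" using e D by (intro mult_mono) (auto intro: order.trans[OF _ e(1)])
  finally show ?thesis by (simp add: power2_eq_square)
qed

text \<open>If the threshold for \<epsilon> lies below the crossover, then N is so large that the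
  exponential tail starts below T = 1; for smaller N, a large D leaves no admissible \<epsilon>
  there. The cube of G gives room when comparing exponents.\<close>

lemma exponent_threshold_small:
  fixes N \<zeta> \<kappa> D G :: real
  assumes N: "N \<ge> 1" and e: "D * N powr ((\<zeta> + 3*\<kappa> - 1) / 2) < N powr ((6*\<zeta> + 3*\<kappa>) / 4)" and G: "G \<ge> 1" "D \<ge> G ^ 3"
    and lt: "8*\<zeta> + 3*\<kappa> < 1" "\<zeta> + 3*\<kappa> < 1" "\<zeta> \<ge> 0" "\<kappa> \<ge> 0"
  shows "G \<le> N powr (1 - 2*\<zeta> - 2*\<kappa>)"
proof -
  have "D = D * N powr ((\<zeta> + 3*\<kappa> - 1) / 2) * N powr ((1 - \<zeta> - 3*\<kappa>) / 2)"
  proof -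
    have "N powr ((\<zeta> + 3*\<kappa> - 1) / 2) * N powr ((1 - \<zeta> - 3*\<kappa>) / 2) = 1"
      unfolding powr_add[symmetric] using N by (simp add: field_simps)
    then show ?thesis by simp
  qed
  also have "\<dots> \<le> N powr ((6*\<zeta> + 3*\<kappa>) / 4) * N powr ((1 - \<zeta> - 3*\<kappa>) / 2)"
    using e by (intro mult_right_mono) auto
  also have "\<dots> \<le> N powr (3 * (1 - 2*\<zeta> - 2*\<kappa>))"
    unfolding powr_add[symmetric] using N lt by (intro powr_mono) (auto simp: field_simps)
  also have "\<dots> = (N powr (1 - 2*\<zeta> - 2*\<kappa>)) ^ 3" using N by (simp add: powr_realpow[symmetric] powr_powr mult.commute)
  finally have "G ^ 3 \<le> (N powr (1 - 2*\<zeta> - 2*\<kappa>)) ^ 3" using G by linarith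
  then show ?thesis using G power_mono_iff[of G "N powr (1 - 2*\<zeta> - 2*\<kappa>)" 3] by simp
qed


text \<open>The conclusion is wanted for every n \<ge> 1, so the finitely many exceptional n are
  absorbed into the constant; this works because n^a \<ge> 1. The index range m serves both uses:
  all j < n for z, a single index for k.\<close>

lemma eventually_powr_bound_uniform:
  fixes g :: "nat \<Rightarrow> nat \<Rightarrow> real"
  assumes "\<exists>C>0. \<forall>\<^sub>F n in sequentially. \<forall>j<m n. g n j \<le> C * real n powr a" and a: "a \<ge> 0"
  shows "\<exists>C\<ge>1. \<forall>n\<ge>1. \<forall>j<m n. g n j \<le> C * real n powr a"
proof -
  obtain C N where C: "C > 0" "\<And>n j. n \<ge> N \<Longrightarrow> j < m n \<Longrightarrow> g n j \<le> C * real n powr a"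
    using assms(1) unfolding eventually_sequentially by blast
  define S where "S = (\<Sum>n<N. \<Sum>j<m n. \<bar>g n j\<bar>)"
  have S: "S \<ge> 0" unfolding S_def by (intro sum_nonneg) auto
  have "g n j \<le> (1 + C + S) * real n powr a" if "n \<ge> 1" "j < m n" for n j
  proof -
    have p: "real n powr a \<ge> 1" using that a by (intro ge_one_powr_ge_zero) auto
    show ?thesis
    proof (cases "n \<ge> N")
      case True
      have "g n j \<le> C * real n powr a" by (rule C(2)[OF True that(2)])
      also have "\<dots> \<le> (1 + C + S) * real n powr a" using S by (intro mult_right_mono) auto
      finally show ?thesis .
    next
      case False
      have "g n j \<le> \<bar>g n j\<bar>" by simp
      also have "\<dots> \<le> (\<Sum>j<m n. \<bar>g n j\<bar>)" using that by (intro member_le_sum) auto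
      also have "\<dots> \<le> S" unfolding S_def using False
        by (intro member_le_sum[of n "{..<N}" "\<lambda>n. \<Sum>j<m n. \<bar>g n j\<bar>"]) (auto intro: sum_nonneg)
      also have "S \<le> (1 + C + S) * 1" using C by simp
      also have "\<dots> \<le> (1 + C + S) * real n powr a" using p C S by (intro mult_left_mono) auto
      finally show ?thesis .
    qed
  qed
  then show ?thesis using C S by (intro exI[of _ "1 + C + S"]) auto
qed

section \<open>Assembly of the bound with explicit constants\<close>

lemma le_divide_of_mult_le: "(a::real) * b \<le> d \<Longrightarrow> b > 0 \<Longrightarrow> a \<le> d / b"
  by (simp add: pos_le_divide_eq)

lemma mult_divide_cancel_pos: "(b::real) > 0 \<Longrightarrow> b * (d / b) = d" "(b::real) > 0 \<Longrightarrow> b * d / b = d"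
  by simp_all

text \<open>A collects the constants of the deviation bounds \<open>dev1\<close> to
  \<open>dev3\<close>, and G that of the start of the exponential tail. A level T is chosen such
  that Y < T implies a deviation of at most \<epsilon>, and the tail at T is compared with the
  claim; the cases differ in the deviation bound that determines T.\<close>

lemma entropy_concentration:
  fixes \<zeta> \<kappa> C1 K B L \<epsilon> :: real
  assumes exps: "\<zeta> \<ge> 0" "\<kappa> \<ge> 0" "8 * \<zeta> + 3 * \<kappa> < 1" "\<zeta> + 3 * \<kappa> < 1"
    and P: "haar_unitary n P" and k: "1 \<le> k" "k \<le> n"
    and C1: "C1 \<ge> 1" and z: "\<And>j. j < n \<Longrightarrow> 1 \<le> z n j \<and> z n j \<le> C1 * real n powr \<zeta>"
    and K: "K \<ge> 1" "real k \<le> K * real n powr \<kappa>"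
    and B: "avg_energy z n \<le> B"
    and L: "\<And>l. l \<ge> 1 \<Longrightarrow> \<bar>Gfun l - Gfun (avg_energy z n)\<bar> \<le> L * \<bar>l - avg_energy z n\<bar>"
  defines "A \<equiv> 1 + 2 * L\<^sup>2 * C1\<^sup>2 + L\<^sup>2 * (3 / 2 * (1 + 2 * B\<^sup>2)) + 8 * L\<^sup>2 * K\<^sup>2 * C1 ^ 4"
    and "G \<equiv> 384 * C1\<^sup>2 * K\<^sup>2"
  assumes D: "D \<ge> A * K * G" "D \<ge> G ^ 3" "D \<ge> 1" "D \<ge> 16 * K ^ 3 * C1 * B * A"
    and c: "c > 0" "c * (384 * C1\<^sup>2 * A\<^sup>2 * K) \<le> 1" "c * (2 * (A * K * G)\<^sup>2) \<le> 1"
    and e: "\<epsilon> > 0" "D * real n powr ((\<zeta> + 3 * \<kappa> - 1) / 2) < \<epsilon>"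
  shows "1 - exp (- (c * (\<epsilon> ^ 4 * real n powr (1 - 8 * \<zeta> - 3 * \<kappa>))))
    \<le> measure P {U. \<bar>real k * Gfun (avg_energy z n) - gauss_entropy k (Mcov_sub z n k U)\<bar> \<le> \<epsilon>}"
proof -
  interpret prob_space P using haar_AE_unitary[OF P] by simp
  have s: "sets P = sets borel" using haar_AE_unitary[OF P] by simp
  have sp: "space P = UNIV" using sets_eq_imp_space_eq[OF s] by simp
  define N where "N = real n"
  have N: "N \<ge> 1" using k by (simp add: N_def)
  define la where "la = avg_energy z n"
  define \<Delta> where "\<Delta> = C1 * N powr \<zeta>"
  define Y where "Y = sq_defect z n k la"
  define \<delta> where "\<delta> U = real k * Gfun la - gauss_entropy k (Mcov_sub z n k U)" for U
  define x where "x = c * (\<epsilon> ^ 4 * N powr (1 - 8 * \<zeta> - 3 * \<kappa>))"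
  have zz: "\<forall>j<n. 1 \<le> z n j \<and> z n j \<le> \<Delta>" using z by (simp add: \<Delta>_def N_def)
  then have z': "\<And>j. j < n \<Longrightarrow> 1 \<le> z n j \<and> z n j \<le> \<Delta>" by simp
  have n: "n \<ge> 1" using k by simp
  have la1: "1 \<le> la" and la\<Delta>: "la \<le> \<Delta>" unfolding la_def using avg_energy_bounds(1,2)[where z=z, OF n zz] by auto
  have laB: "la \<le> B" using B by (simp add: la_def)
  have pos: "\<Delta> > 0" "B \<ge> 1" using la1 la\<Delta> laB by linarith+
  have A1: "A \<ge> 1" and A2: "2 * L\<^sup>2 * C1\<^sup>2 \<le> A" and A3: "L\<^sup>2 * (3 / 2 * (1 + 2 * B\<^sup>2)) \<le> A" and A4: "8 * L\<^sup>2 * K\<^sup>2 * C1 ^ 4 \<le> A"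
  proof -
    have "2 * L\<^sup>2 * C1\<^sup>2 \<ge> 0" "L\<^sup>2 * (3 / 2 * (1 + 2 * B\<^sup>2)) \<ge> 0" "8 * L\<^sup>2 * K\<^sup>2 * C1 ^ 4 \<ge> 0" by auto
    then show "A \<ge> 1" "2 * L\<^sup>2 * C1\<^sup>2 \<le> A" "L\<^sup>2 * (3 / 2 * (1 + 2 * B\<^sup>2)) \<le> A" "8 * L\<^sup>2 * K\<^sup>2 * C1 ^ 4 \<le> A"
      unfolding A_def by linarith+
  qed
  have G1: "G \<ge> 1"
  proof -
    have "1 * 1 \<le> C1\<^sup>2 * K\<^sup>2" using C1 K by (intro mult_mono) (auto simp: one_le_power)
    then show ?thesis by (simp add: G_def)
  qed
  have pw: "(N powr a) ^ m = N powr (real m * a)" for a m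
    using N by (simp add: powr_realpow[symmetric] powr_powr mult.commute)
  have \<Delta>2: "\<Delta>\<^sup>2 = C1\<^sup>2 * N powr (2 * \<zeta>)" by (simp add: \<Delta>_def power_mult_distrib pw)
  have kK: "real k \<le> K * N powr \<kappa>" using K by (simp add: N_def)
  have kpos: "real k > 0" using k by simp
  have Ynn: "Y U \<ge> 0" for U unfolding Y_def sq_defect_def by (intro sum_nonneg) auto
  note sd = sq_defect_concentration[where z=z and \<Delta>=\<Delta>, OF P k z', folded la_def, folded Y_def]
  have dev1: "(\<delta> U)\<^sup>2 \<le> A * real k * N powr (2 * \<zeta>) * Y U" if U: "U \<in> unitary_group n" for U
  proof -
    have "(\<delta> U)\<^sup>2 \<le> L\<^sup>2 * real k * (\<Delta>\<^sup>2 + la\<^sup>2) * Y U"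
      unfolding \<delta>_def Y_def by (rule entropy_deviation(1)[where z=z, OF U k(2) z' la1 L[folded la_def]])
    also have "\<dots> \<le> L\<^sup>2 * real k * (\<Delta>\<^sup>2 + \<Delta>\<^sup>2) * Y U"
      using la1 la\<Delta> Ynn by (intro mult_right_mono mult_left_mono add_mono power_mono) auto
    also have "\<dots> = (2 * L\<^sup>2 * C1\<^sup>2) * (real k * N powr (2 * \<zeta>) * Y U)" by (simp add: \<Delta>2)
    also have "\<dots> \<le> A * (real k * N powr (2 * \<zeta>) * Y U)" using A2 Ynn by (intro mult_right_mono) auto
    finally show ?thesis by (simp add: mult.assoc)
  qed
  have dev2: "(\<delta> U)\<^sup>2 \<le> A * real k * Y U" if U: "U \<in> unitary_group n" and Y1: "Y U \<le> 1" for U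
  proof -
    have "(\<delta> U)\<^sup>2 \<le> L\<^sup>2 * real k * (3 / 2 * ((Y U)\<^sup>2 + 2 * la\<^sup>2 * Y U))"
      unfolding \<delta>_def Y_def by (rule entropy_deviation(2)[where z=z, OF U k(2) z' la1 L[folded la_def]])
    also have "\<dots> \<le> L\<^sup>2 * real k * (3 / 2 * (1 * Y U + 2 * B\<^sup>2 * Y U))"
    proof -
      have "(Y U)\<^sup>2 \<le> 1 * Y U" unfolding power2_eq_square using Y1 Ynn by (intro mult_right_mono) auto
      moreover have "2 * la\<^sup>2 * Y U \<le> 2 * B\<^sup>2 * Y U"
        using la1 laB Ynn by (intro mult_right_mono mult_left_mono power_mono) auto
      ultimately show ?thesis by (intro mult_left_mono add_mono) auto
    qed
    also have "\<dots> = (L\<^sup>2 * (3 / 2 * (1 + 2 * B\<^sup>2))) * (real k * Y U)" by (simp add: algebra_simps)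
    also have "\<dots> \<le> A * (real k * Y U)" using A3 Ynn by (intro mult_right_mono) auto
    finally show ?thesis by (simp add: mult.assoc)
  qed
  have dev3: "(\<delta> U)\<^sup>2 \<le> A * N powr (4 * \<zeta> + 2 * \<kappa>)" if U: "U \<in> unitary_group n" for U
  proof -
    have "(\<delta> U)\<^sup>2 \<le> L\<^sup>2 * real k * (\<Delta>\<^sup>2 + la\<^sup>2) * Y U"
      unfolding \<delta>_def Y_def by (rule entropy_deviation(1)[where z=z, OF U k(2) z' la1 L[folded la_def]])
    also have "\<dots> \<le> L\<^sup>2 * real k * (\<Delta>\<^sup>2 + \<Delta>\<^sup>2) * (4 * real k * \<Delta>\<^sup>2)"
    proof (intro mult_mono)
      show "Y U \<le> 4 * real k * \<Delta>\<^sup>2" using sd(1)[of U] U by simp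
    qed (use la1 la\<Delta> Ynn in \<open>auto intro!: power_mono\<close>)
    also have "\<dots> = 8 * L\<^sup>2 * (real k)\<^sup>2 * (\<Delta>\<^sup>2)\<^sup>2" by (simp add: power2_eq_square)
    also have "\<dots> \<le> 8 * L\<^sup>2 * (K * N powr \<kappa>)\<^sup>2 * (\<Delta>\<^sup>2)\<^sup>2"
      using kK by (intro mult_right_mono mult_left_mono power_mono) auto
    also have "\<dots> = (8 * L\<^sup>2 * K\<^sup>2 * C1 ^ 4) * N powr (4 * \<zeta> + 2 * \<kappa>)"
      unfolding \<Delta>2 power_mult_distrib pw by (simp add: powr_add power2_eq_square power4_eq_xxxx)
    also have "\<dots> \<le> A * N powr (4 * \<zeta> + 2 * \<kappa>)" using A4 by (intro mult_right_mono) auto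
    finally show ?thesis .
  qed
  define good where "good = {U. \<bar>\<delta> U\<bar> \<le> \<epsilon>}"
  have good: "good \<in> sets P" unfolding good_def \<delta>_def s by (rule borel_entropy_event)
  have goodI: "U \<in> good" if "(\<delta> U)\<^sup>2 \<le> \<epsilon>\<^sup>2" for U
    using that e(1) unfolding good_def by (simp add: abs_le_square_iff[symmetric])
  have red: "1 - prob {U. Y U \<ge> T} \<le> prob good" if "\<And>U. U \<in> unitary_group n \<Longrightarrow> Y U < T \<Longrightarrow> U \<in> good" for T
  proof -
    have m: "{U. Y U \<ge> T} \<in> sets P"
    proof -
      have "{U \<in> space borel. T \<le> Y U} \<in> sets borel"
        unfolding Y_def using borel_sq_defect by (intro borel_measurable_le borel_measurable_const) auto
      then show ?thesis using s by simp
    qed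
    have "1 - prob {U. Y U \<ge> T} = prob (space P - {U. Y U \<ge> T})" using m by (simp add: prob_compl)
    also have "\<dots> \<le> prob good"
    proof (rule finite_measure_mono_AE[OF _ good])
      show "AE U in P. U \<in> space P - {U. Y U \<ge> T} \<longrightarrow> U \<in> good"
        using haar_AE_unitary(1)[OF P] by eventually_elim (auto intro: that)
    qed
    finally show ?thesis .
  qed
  \<comment> \<open>Leaves three conditions on T in each exponential case: smallness of the
    deviation, being past the start of the tail, and a sufficient rate.\<close>
  have tail: "1 - exp (- x) \<le> prob good"
    if imp: "\<And>U. U \<in> unitary_group n \<Longrightarrow> Y U < T \<Longrightarrow> U \<in> good"
      and T: "T \<ge> G * N powr (2 * \<zeta> + 2 * \<kappa> - 1)" and xT: "x \<le> T * N powr (1 - 2 * \<zeta>) / (384 * C1\<^sup>2)" for T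
  proof -
    have "384 * \<Delta>\<^sup>2 * (real k)\<^sup>2 / real n \<le> 384 * \<Delta>\<^sup>2 * (K * N powr \<kappa>)\<^sup>2 / real n"
      using kK by (intro divide_right_mono mult_left_mono power_mono) auto
    also have "\<dots> = G * (N powr (2 * \<zeta>) * N powr (2 * \<kappa>) / N powr 1)"
      unfolding \<Delta>2 power_mult_distrib pw G_def using N by (simp add: N_def)
    also have "\<dots> = G * N powr (2 * \<zeta> + 2 * \<kappa> - 1)" unfolding powr_add[symmetric] powr_diff[symmetric] ..
    finally have T': "384 * \<Delta>\<^sup>2 * (real k)\<^sup>2 / real n \<le> T" using T by linarith
    have "prob {U. Y U \<ge> T} \<le> exp (- T * real n / (384 * \<Delta>\<^sup>2))" by (rule sd(3)[OF _ T'])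
    also have "- T * real n / (384 * \<Delta>\<^sup>2) = - (T * (N powr 1 / N powr (2 * \<zeta>)) / (384 * C1\<^sup>2))"
      unfolding \<Delta>2 using N by (simp add: N_def)
    also have "\<dots> = - (T * N powr (1 - 2 * \<zeta>) / (384 * C1\<^sup>2))" unfolding powr_diff[symmetric] ..
    also have "exp \<dots> \<le> exp (- x)" using xT by simp
    finally have "prob {U. Y U \<ge> T} \<le> exp (- x)" .
    moreover have "1 - prob {U. Y U \<ge> T} \<le> prob good" by (rule red) (rule imp)
    ultimately show ?thesis by linarith
  qed
  have x0: "x \<ge> 0" unfolding x_def using c e by simp
  have c1: "c * 384 * C1\<^sup>2 * A * K * A \<le> 1" using c(2) by (simp add: power2_eq_square mult_ac)
  have cA: "c * (384 * C1\<^sup>2 * (A * K)) \<le> 1"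
  proof -
    have "c * (384 * C1\<^sup>2 * (A * K)) = c * 384 * C1\<^sup>2 * A * K * 1" by (simp only: mult.assoc mult_1_right)
    also have "\<dots> \<le> c * 384 * C1\<^sup>2 * A * K * A" using c A1 K by (intro mult_left_mono) auto
    finally show ?thesis using c1 by linarith
  qed
  have cC: "c * (384 * C1\<^sup>2) \<le> 1"
  proof -
    have "1 * 1 \<le> A * K" using A1 K by (intro mult_mono) auto
    then have "c * (384 * C1\<^sup>2) * 1 \<le> c * (384 * C1\<^sup>2) * (A * K)" using c by (intro mult_left_mono) auto
    also have "\<dots> = c * (384 * C1\<^sup>2 * (A * K))" by (simp only: mult.assoc)
    finally show ?thesis using cA by linarith
  qed
  have KNp: "K * N powr \<kappa> > 0" using K N by simp
  have C1p: "384 * C1\<^sup>2 > 0" using C1 by simp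
  have AKp: "A * K > 0" using A1 K by simp
  have main: "1 - exp (- x) \<le> prob good"
  proof (cases "A * N powr (4 * \<zeta> + 2 * \<kappa>) \<le> \<epsilon>\<^sup>2")
    case True
    \<comment> \<open>Even the worst-case deviation is at most \<epsilon> here, so the event is
      almost sure.\<close>
    have "AE U in P. U \<in> good" using haar_AE_unitary(1)[OF P] by eventually_elim (use dev3 True goodI order.trans in blast)
    then have "prob good = 1" using good prob_eq_1 by blast
    then show ?thesis by simp
  next
    case small: False
    show ?thesis
    proof (cases "\<epsilon> \<le> N powr ((6*\<zeta> + 3*\<kappa>) / 4)")
      case False
      \<comment> \<open>The level allowed by \<open>dev1\<close>. It may exceed 1, where
        \<open>dev2\<close> does not apply.\<close>
      define T where "T = \<epsilon>\<^sup>2 / (A * real k * N powr (2 * \<zeta>))"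
      have den: "A * real k * N powr (2 * \<zeta>) > 0" using A1 kpos N by simp
      have T_lower: "T \<ge> \<epsilon>\<^sup>2 / (A * (K * N powr \<kappa>) * N powr (2 * \<zeta>))"
        unfolding T_def using den kK A1 KNp N K(1) kpos by (intro divide_left_mono mult_right_mono mult_left_mono mult_pos_pos) auto
      have T_low2: "T \<ge> \<epsilon>\<^sup>2 * N powr (- 2 * \<zeta> - \<kappa>) / (A * K)"
      proof -
        have "\<epsilon>\<^sup>2 / (A * (K * N powr \<kappa>) * N powr (2 * \<zeta>)) = \<epsilon>\<^sup>2 * N powr (- 2 * \<zeta> - \<kappa>) / (A * K)"
          using N A1 K by (simp add: powr_diff powr_minus divide_simps)
        then show ?thesis using T_lower by simp
      qed
      show ?thesis
      proof (rule tail[of T])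
        fix U assume U: "U \<in> unitary_group n" "Y U < T"
        have "(\<delta> U)\<^sup>2 \<le> A * real k * N powr (2 * \<zeta>) * Y U" by (rule dev1[OF U(1)])
        also have "\<dots> \<le> A * real k * N powr (2 * \<zeta>) * T" using U den by (intro mult_left_mono) auto
        also have "\<dots> = \<epsilon>\<^sup>2" unfolding T_def by (rule mult_divide_cancel_pos(1)[OF den])
        finally show "U \<in> good" by (rule goodI)
      next
        have "D * N powr (4*\<zeta> + 3*\<kappa> - 1) \<le> \<epsilon>\<^sup>2"
          using False e D exps N by (intro exponent_threshold_large) (auto simp: N_def)
        then have "A * K * G * N powr (4*\<zeta> + 3*\<kappa> - 1) \<le> \<epsilon>\<^sup>2"
          using D(1) by (meson mult_right_mono order.trans powr_ge_zero)
        then have "A * K * G * N powr (4*\<zeta> + 3*\<kappa> - 1) * N powr (- 2 * \<zeta> - \<kappa>) / (A * K) \<le> \<epsilon>\<^sup>2 * N powr (- 2 * \<zeta> - \<kappa>) / (A * K)"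
          using AKp by (intro divide_right_mono mult_right_mono) auto
        also have "A * K * G * N powr (4*\<zeta> + 3*\<kappa> - 1) * N powr (- 2 * \<zeta> - \<kappa>) / (A * K) = G * (N powr (4*\<zeta> + 3*\<kappa> - 1) * N powr (- 2 * \<zeta> - \<kappa>))"
          using mult_divide_cancel_pos(2)[OF AKp, of "G * (N powr (4*\<zeta> + 3*\<kappa> - 1) * N powr (- 2 * \<zeta> - \<kappa>))"]
          by (simp only: mult.assoc)
        also have "\<dots> = G * N powr (2 * \<zeta> + 2 * \<kappa> - 1)" unfolding powr_add[symmetric] by (simp add: algebra_simps)
        finally show "G * N powr (2 * \<zeta> + 2 * \<kappa> - 1) \<le> T" using T_low2 by linarith
      next
        have "x \<le> c * (A * \<epsilon>\<^sup>2 * N powr (1 - 4*\<zeta> - \<kappa>))"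
          unfolding x_def using small c N by (intro mult_left_mono exponent_case_large) auto
        also have "\<dots> \<le> \<epsilon>\<^sup>2 * N powr (1 - 4*\<zeta> - \<kappa>) / (384 * C1\<^sup>2 * (A * K))"
        proof -
          have "c * (A * \<epsilon>\<^sup>2 * N powr (1 - 4*\<zeta> - \<kappa>)) * (384 * C1\<^sup>2 * (A * K)) = (c * 384 * C1\<^sup>2 * A * K * A) * (\<epsilon>\<^sup>2 * N powr (1 - 4*\<zeta> - \<kappa>))"
            by (simp add: mult_ac)
          also have "\<dots> \<le> 1 * (\<epsilon>\<^sup>2 * N powr (1 - 4*\<zeta> - \<kappa>))" using c1 by (intro mult_right_mono) auto
          finally show ?thesis using C1p AKp by (intro le_divide_of_mult_le) auto
        qed
        also have "\<dots> = \<epsilon>\<^sup>2 * N powr (- 2 * \<zeta> - \<kappa>) / (A * K) * N powr (1 - 2 * \<zeta>) / (384 * C1\<^sup>2)"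
        proof -
          have "N powr (1 - 4*\<zeta> - \<kappa>) = N powr (- 2 * \<zeta> - \<kappa>) * N powr (1 - 2 * \<zeta>)" unfolding powr_add[symmetric] by (simp add: algebra_simps)
          then show ?thesis using C1p AKp by (simp add: divide_simps)
        qed
        also have "\<dots> \<le> T * N powr (1 - 2 * \<zeta>) / (384 * C1\<^sup>2)"
          using T_low2 C1p by (intro divide_right_mono mult_right_mono) auto
        finally show "x \<le> T * N powr (1 - 2 * \<zeta>) / (384 * C1\<^sup>2)" .
      qed
    next
      case True
      note es = exponent_case_small[OF N e(1) True exps(1,2)]
      have Gle: "G * N powr (2 * \<zeta> + 2 * \<kappa> - 1) \<le> 1"
      proof -
        have "G \<le> N powr (1 - 2*\<zeta> - 2*\<kappa>)"
          using e True D exps G1 N by (intro exponent_threshold_small[where D=D]) (auto simp: N_def)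
        then have "G * N powr (2 * \<zeta> + 2 * \<kappa> - 1) \<le> N powr (1 - 2*\<zeta> - 2*\<kappa>) * N powr (2 * \<zeta> + 2 * \<kappa> - 1)"
          by (intro mult_right_mono) auto
        also have "\<dots> = 1" unfolding powr_add[symmetric] using N by simp
        finally show ?thesis .
      qed
      show ?thesis
      proof (cases "A * real k \<le> \<epsilon>\<^sup>2")
        case big: True
        show ?thesis
        \<comment> \<open>\<open>dev2\<close> needs Y \<le> 1, so the level is capped at 1 even when
          \<epsilon> would admit a larger one.\<close>
        proof (rule tail[of 1])
          fix U assume U: "U \<in> unitary_group n" "Y U < 1"
          have "(\<delta> U)\<^sup>2 \<le> A * real k * Y U" using U by (intro dev2) auto
          also have "\<dots> \<le> A * real k * 1" using U A1 by (intro mult_left_mono) auto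
          finally show "U \<in> good" using big by (intro goodI) simp
        next
          show "G * N powr (2 * \<zeta> + 2 * \<kappa> - 1) \<le> 1" by (rule Gle)
          have "x \<le> c * N powr (1 - 2*\<zeta>)" unfolding x_def using es(1) c by (intro mult_left_mono) auto
          also have "\<dots> \<le> 1 * N powr (1 - 2 * \<zeta>) / (384 * C1\<^sup>2)"
          proof -
            have "c * N powr (1 - 2*\<zeta>) * (384 * C1\<^sup>2) = c * (384 * C1\<^sup>2) * N powr (1 - 2*\<zeta>)" by (simp only: mult_ac)
            also have "\<dots> \<le> 1 * N powr (1 - 2*\<zeta>)" using cC by (intro mult_right_mono) auto
            finally show ?thesis using C1p by (intro le_divide_of_mult_le) auto
          qed
          finally show "x \<le> 1 * N powr (1 - 2 * \<zeta>) / (384 * C1\<^sup>2)" .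
        qed
      next
        case nbig: False
        define T where "T = \<epsilon>\<^sup>2 / (A * real k)"
        have Ak: "A * real k > 0" using A1 kpos by simp
        have Tpos: "T > 0" unfolding T_def using Ak e by simp
        have T1: "T < 1" unfolding T_def using nbig Ak by simp
        have imp: "U \<in> good" if U: "U \<in> unitary_group n" "Y U < T" for U
        proof -
          have "(\<delta> U)\<^sup>2 \<le> A * real k * Y U" using U T1 by (intro dev2) auto
          also have "\<dots> \<le> A * real k * T" using U Ak by (intro mult_left_mono) auto
          also have "\<dots> = \<epsilon>\<^sup>2" unfolding T_def by (rule mult_divide_cancel_pos(1)[OF Ak])
          finally show ?thesis by (rule goodI)
        qed
        have T_low: "T \<ge> \<epsilon>\<^sup>2 * N powr (- \<kappa>) / (A * K)"
        proof -
          have "T \<ge> \<epsilon>\<^sup>2 / (A * (K * N powr \<kappa>))"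
            unfolding T_def using Ak kK A1 KNp kpos K(1) by (intro divide_left_mono mult_left_mono mult_pos_pos) auto
          moreover have "\<epsilon>\<^sup>2 / (A * (K * N powr \<kappa>)) = \<epsilon>\<^sup>2 * N powr (- \<kappa>) / (A * K)"
            using N A1 K by (simp add: powr_minus divide_simps)
          ultimately show ?thesis by simp
        qed
        show ?thesis
        proof (cases "G * N powr (2 * \<zeta> + 2 * \<kappa> - 1) \<le> T")
          case ok: True
          show ?thesis
          proof (rule tail[OF imp ok])
            have "x \<le> c * (\<epsilon>\<^sup>2 * N powr (1 - 2*\<zeta> - \<kappa>))" unfolding x_def using es(2) c by (intro mult_left_mono) auto
            also have "\<dots> \<le> \<epsilon>\<^sup>2 * N powr (1 - 2*\<zeta> - \<kappa>) / (384 * C1\<^sup>2 * (A * K))"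
            proof -
              have "c * (\<epsilon>\<^sup>2 * N powr (1 - 2*\<zeta> - \<kappa>)) * (384 * C1\<^sup>2 * (A * K)) = c * (384 * C1\<^sup>2 * (A * K)) * (\<epsilon>\<^sup>2 * N powr (1 - 2*\<zeta> - \<kappa>))"
                by (simp only: mult_ac)
              also have "\<dots> \<le> 1 * (\<epsilon>\<^sup>2 * N powr (1 - 2*\<zeta> - \<kappa>))"
                using cA by (intro mult_right_mono) auto
              finally show ?thesis using C1p AKp by (intro le_divide_of_mult_le) auto
            qed
            also have "\<dots> = \<epsilon>\<^sup>2 * N powr (- \<kappa>) / (A * K) * N powr (1 - 2 * \<zeta>) / (384 * C1\<^sup>2)"
            proof -
              have "N powr (1 - 2*\<zeta> - \<kappa>) = N powr (- \<kappa>) * N powr (1 - 2 * \<zeta>)" unfolding powr_add[symmetric] by (simp add: algebra_simps)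
              then show ?thesis using C1p AKp by (simp add: divide_simps)
            qed
            also have "\<dots> \<le> T * N powr (1 - 2 * \<zeta>) / (384 * C1\<^sup>2)"
              using T_low C1p by (intro divide_right_mono mult_right_mono) auto
            finally show "x \<le> T * N powr (1 - 2 * \<zeta>) / (384 * C1\<^sup>2)" .
          qed
        next
          case fail: False
          \<comment> \<open>The level lies below the start of the exponential tail. Then \<epsilon>
            is so small that the claimed 1 - exp (- x) is at most 1/2, which the first moment can
            deliver.\<close>
          have e2: "\<epsilon>\<^sup>2 \<le> A * K * G * N powr (2 * \<zeta> + 3 * \<kappa> - 1)"
          proof -
            have "\<epsilon>\<^sup>2 * N powr (- \<kappa>) / (A * K) \<le> G * N powr (2 * \<zeta> + 2 * \<kappa> - 1)" using T_low fail by linarith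
            then have "\<epsilon>\<^sup>2 * N powr (- \<kappa>) \<le> G * N powr (2 * \<zeta> + 2 * \<kappa> - 1) * (A * K)" using AKp by (simp add: pos_divide_le_eq)
            then have "\<epsilon>\<^sup>2 * N powr (- \<kappa>) * N powr \<kappa> \<le> G * N powr (2 * \<zeta> + 2 * \<kappa> - 1) * (A * K) * N powr \<kappa>" by (intro mult_right_mono) auto
            moreover have "\<epsilon>\<^sup>2 * N powr (- \<kappa>) * N powr \<kappa> = \<epsilon>\<^sup>2" unfolding mult.assoc powr_add[symmetric] using N by simp
            moreover have "G * N powr (2 * \<zeta> + 2 * \<kappa> - 1) * (A * K) * N powr \<kappa> = A * K * G * (N powr (2 * \<zeta> + 2 * \<kappa> - 1) * N powr \<kappa>)" by (simp add: mult_ac)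
            moreover have "N powr (2 * \<zeta> + 2 * \<kappa> - 1) * N powr \<kappa> = N powr (2 * \<zeta> + 3 * \<kappa> - 1)" unfolding powr_add[symmetric] by (simp add: algebra_simps)
            ultimately show ?thesis by simp
          qed
          have "x \<le> 1 / 2"
          proof -
            have "(\<epsilon>\<^sup>2)\<^sup>2 \<le> (A * K * G * N powr (2 * \<zeta> + 3 * \<kappa> - 1))\<^sup>2" using e2 by (intro power_mono) auto
            also have "\<dots> = (A * K * G)\<^sup>2 * N powr (4 * \<zeta> + 6 * \<kappa> - 2)" unfolding power_mult_distrib pw by (simp add: algebra_simps)
            finally have "\<epsilon> ^ 4 * N powr (1 - 8 * \<zeta> - 3 * \<kappa>) \<le> (A * K * G)\<^sup>2 * N powr (4 * \<zeta> + 6 * \<kappa> - 2) * N powr (1 - 8 * \<zeta> - 3 * \<kappa>)"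
              by (intro mult_right_mono) (auto simp: power2_eq_square power4_eq_xxxx)
            also have "\<dots> = (A * K * G)\<^sup>2 * N powr (- 4 * \<zeta> + 3 * \<kappa> - 1)" unfolding mult.assoc powr_add[symmetric] by simp
            also have "\<dots> \<le> (A * K * G)\<^sup>2 * N powr 0" using N exps by (intro mult_left_mono powr_mono) auto
            also have "\<dots> = (A * K * G)\<^sup>2" using N by simp
            finally have "x \<le> c * (A * K * G)\<^sup>2" unfolding x_def using c by (intro mult_left_mono) auto
            then show ?thesis using c(3) by simp
          qed
          then have "1 - exp (- x) \<le> 1 / 2" using exp_ge_add_one_self[of "- x"] by linarith
          moreover have "prob {U. Y U \<ge> T} \<le> 1 / 2"
          proof -
            have "prob {U. Y U \<ge> T} \<le> 8 * (real k)\<^sup>2 * \<Delta> * la / (real n * T)" by (rule sd(2)[OF _ Tpos])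
            also have "\<dots> = 8 * (real k) ^ 3 * \<Delta> * la * A / (N * \<epsilon>\<^sup>2)"
              unfolding T_def using Ak by (simp add: N_def power2_eq_square power3_eq_cube)
            also have "\<dots> \<le> 8 * (K * N powr \<kappa>) ^ 3 * \<Delta> * B * A / (N * \<epsilon>\<^sup>2)"
              using kK pos laB la1 A1 N by (intro divide_right_mono mult_right_mono mult_mono power_mono) auto
            also have "\<dots> = 8 * K ^ 3 * C1 * B * A * (N powr (3 * \<kappa>) * N powr \<zeta> / N powr 1) / \<epsilon>\<^sup>2"
              unfolding power_mult_distrib pw \<Delta>_def using N by simp
            also have "\<dots> = 8 * K ^ 3 * C1 * B * A * N powr (\<zeta> + 3 * \<kappa> - 1) / \<epsilon>\<^sup>2"
              unfolding powr_add[symmetric] powr_diff[symmetric] by (simp add: algebra_simps)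
            also have "\<dots> \<le> 1 / 2"
            proof -
              \<comment> \<open>The power of N is that of the squared threshold for \<epsilon>, so
                the hypothesis on \<epsilon> controls exactly this quotient. D \<ge> 1 allows D to
                be replaced by D^2.\<close>
              have "8 * K ^ 3 * C1 * B * A * N powr (\<zeta> + 3 * \<kappa> - 1) \<le> D / 2 * N powr (\<zeta> + 3 * \<kappa> - 1)"
                using D(4) by (intro mult_right_mono) auto
              also have "\<dots> \<le> D\<^sup>2 / 2 * N powr (\<zeta> + 3 * \<kappa> - 1)"
                using D(3) by (intro mult_right_mono divide_right_mono) (auto simp: power2_eq_square)
              also have "\<dots> = (D * N powr ((\<zeta> + 3 * \<kappa> - 1) / 2))\<^sup>2 / 2"
              proof -
                have h: "real 2 * ((\<zeta> + 3 * \<kappa> - 1) / 2) = \<zeta> + 3 * \<kappa> - 1" by simp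
                show ?thesis unfolding power_mult_distrib pw h by simp
              qed
              also have "\<dots> \<le> \<epsilon>\<^sup>2 / 2" using e D(3) by (intro divide_right_mono power_mono) (auto simp: N_def)
              finally show ?thesis using e by (simp add: divide_simps)
            qed
            finally show ?thesis .
          qed
          moreover have "1 - prob {U. Y U \<ge> T} \<le> prob good" by (rule red) (rule imp)
          ultimately show ?thesis by linarith
        qed
      qed
    qed
  qed
  then show ?thesis unfolding x_def good_def \<delta>_def la_def N_def .
qed


theorem theorem3:
  fixes \<zeta> \<kappa> \<mu> :: real and z :: "nat \<Rightarrow> nat \<Rightarrow> real" and k :: "nat \<Rightarrow> nat"
  assumes "\<zeta> \<ge> 0" and "\<kappa> \<ge> 0"
    and "8 * \<zeta> + 3 * \<kappa> < 1" and "\<zeta> + 3 * \<kappa> < 1"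
    and z_ge1: "\<And>n j. 1 \<le> n \<Longrightarrow> j < n \<Longrightarrow> 1 \<le> z n j"
    and squeezing: "\<exists>C>0. \<forall>\<^sub>F n in sequentially. \<forall>j<n. z n j \<le> C * real n powr \<zeta>"
    and energy_bdd: "\<exists>B. \<forall>n\<ge>1. avg_energy z n \<le> B"
    and "\<mu> > 1" and energy_lower: "\<And>n. 1 \<le> n \<Longrightarrow> avg_energy z n \<ge> \<mu>"
    and k_range: "\<And>n. 1 \<le> n \<Longrightarrow> 1 \<le> k n \<and> k n \<le> n"
    and k_bdd: "\<exists>K>0. \<forall>\<^sub>F n in sequentially. real (k n) \<le> K * real n powr \<kappa>"
  shows "\<exists>C>0. \<exists>c>0. \<forall>n\<ge>1. \<forall>\<epsilon>>0. \<forall>P.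
           haar_unitary n P \<longrightarrow>
           C * beta \<mu> * real n powr ((\<zeta> + 3 * \<kappa> - 1) / 2) < \<epsilon> \<longrightarrow>
           measure P {U. \<bar>real (k n) * Gfun (avg_energy z n)
                          - gauss_entropy (k n) (Mcov_sub z n (k n) U)\<bar> \<le> \<epsilon>}
             \<ge> 1 - exp (- c * \<epsilon> ^ 4 / beta \<mu> ^ 4 * real n powr (1 - 8 * \<zeta> - 3 * \<kappa>))"
proof -
  obtain C1 where C1: "C1 \<ge> 1" "\<And>n j. n \<ge> 1 \<Longrightarrow> j < n \<Longrightarrow> z n j \<le> C1 * real n powr \<zeta>"
    using eventually_powr_bound_uniform[of "\<lambda>n. n" z \<zeta>, OF squeezing assms(1)] by blast
  obtain K where K: "K \<ge> 1" "\<And>n. n \<ge> 1 \<Longrightarrow> real (k n) \<le> K * real n powr \<kappa>"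
    using eventually_powr_bound_uniform[of "\<lambda>_. 1" "\<lambda>n _. real (k n)" \<kappa>] k_bdd assms(2) by auto
  obtain B where B: "\<And>n. n \<ge> 1 \<Longrightarrow> avg_energy z n \<le> B" using energy_bdd by blast
  obtain L where L: "\<And>l la. l \<ge> 1 \<Longrightarrow> \<mu> \<le> la \<Longrightarrow> la \<le> B \<Longrightarrow> \<bar>Gfun l - Gfun la\<bar> \<le> L * \<bar>l - la\<bar>"
    using Gfun_lipschitz[OF \<open>\<mu> > 1\<close>, of B] by blast
  define A where "A = 1 + 2 * L\<^sup>2 * C1\<^sup>2 + L\<^sup>2 * (3 / 2 * (1 + 2 * B\<^sup>2)) + 8 * L\<^sup>2 * K\<^sup>2 * C1 ^ 4"
  define G where "G = 384 * C1\<^sup>2 * K\<^sup>2"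
  \<comment> \<open>A sum of absolute values meets all required lower bounds whatever the signs of
    its terms; c is built in the same way from its upper bounds.\<close>
  define D where "D = 1 + \<bar>A * K * G\<bar> + \<bar>G ^ 3\<bar> + \<bar>16 * K ^ 3 * C1 * B * A\<bar>"
  define c where "c = 1 / (1 + \<bar>384 * C1\<^sup>2 * A\<^sup>2 * K\<bar> + \<bar>2 * (A * K * G)\<^sup>2\<bar>)"
  have b: "beta \<mu> > 0" using \<open>\<mu> > 1\<close> by (simp add: beta_def)
  have D: "D \<ge> A * K * G" "D \<ge> G ^ 3" "D \<ge> 1" "D \<ge> 16 * K ^ 3 * C1 * B * A" unfolding D_def by linarith+
  have c_le: "c * y \<le> 1" if "y \<le> 1 + \<bar>384 * C1\<^sup>2 * A\<^sup>2 * K\<bar> + \<bar>2 * (A * K * G)\<^sup>2\<bar>" for y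
  proof -
    have "1 + \<bar>384 * C1\<^sup>2 * A\<^sup>2 * K\<bar> + \<bar>2 * (A * K * G)\<^sup>2\<bar> > 0" by linarith
    then show ?thesis using that unfolding c_def by (simp add: pos_divide_le_eq)
  qed
  have c: "c > 0" "c * (384 * C1\<^sup>2 * A\<^sup>2 * K) \<le> 1" "c * (2 * (A * K * G)\<^sup>2) \<le> 1"
  proof -
    have "1 + \<bar>384 * C1\<^sup>2 * A\<^sup>2 * K\<bar> + \<bar>2 * (A * K * G)\<^sup>2\<bar> > 0" by linarith
    then show "c > 0" unfolding c_def by simp
    show "c * (384 * C1\<^sup>2 * A\<^sup>2 * K) \<le> 1" "c * (2 * (A * K * G)\<^sup>2) \<le> 1" by (rule c_le, linarith)+
  qed
  have pos: "D / beta \<mu> > 0" "c * beta \<mu> ^ 4 > 0" using D(3) b c(1) by simp_all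
  show ?thesis
  \<comment> \<open>As \<mu> is fixed, the powers of \<open>beta \<mu>\<close> in the claim are
    compensated by the choice of the two constants.\<close>
  proof (rule exI[of _ "D / beta \<mu>"], rule conjI[OF pos(1)], rule exI[of _ "c * beta \<mu> ^ 4"], rule conjI[OF pos(2)],
      intro allI impI)
    fix n :: nat and \<epsilon> :: real and P
    assume n: "n \<ge> 1" and \<epsilon>: "\<epsilon> > 0" and P: "haar_unitary n P"
      and "D / beta \<mu> * beta \<mu> * real n powr ((\<zeta> + 3 * \<kappa> - 1) / 2) < \<epsilon>"
    then have e: "D * real n powr ((\<zeta> + 3 * \<kappa> - 1) / 2) < \<epsilon>" using b by simp
    have k: "1 \<le> k n" "k n \<le> n" using k_range[OF n] by auto
    have "1 - exp (- (c * (\<epsilon> ^ 4 * real n powr (1 - 8 * \<zeta> - 3 * \<kappa>))))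
       \<le> measure P {U. \<bar>real (k n) * Gfun (avg_energy z n) - gauss_entropy (k n) (Mcov_sub z n (k n) U)\<bar> \<le> \<epsilon>}"
    proof (rule entropy_concentration[OF assms(1-4) P k C1(1) _ K(1) K(2)[OF n] B[OF n]])
      show "1 \<le> z n j \<and> z n j \<le> C1 * real n powr \<zeta>" if "j < n" for j using z_ge1[OF n that] C1(2)[OF n that] by simp
      show "\<bar>Gfun l - Gfun (avg_energy z n)\<bar> \<le> L * \<bar>l - avg_energy z n\<bar>" if "l \<ge> 1" for l
        by (rule L[OF that energy_lower[OF n] B[OF n]])
    qed (use D c \<epsilon> e in \<open>simp_all only: A_def G_def\<close>)
    moreover have "- (c * beta \<mu> ^ 4) * \<epsilon> ^ 4 / beta \<mu> ^ 4 * real n powr (1 - 8 * \<zeta> - 3 * \<kappa>)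
        = - (c * (\<epsilon> ^ 4 * real n powr (1 - 8 * \<zeta> - 3 * \<kappa>)))"
      using b by simp
    ultimately show "1 - exp (- (c * beta \<mu> ^ 4) * \<epsilon> ^ 4 / beta \<mu> ^ 4 * real n powr (1 - 8 * \<zeta> - 3 * \<kappa>))
       \<le> measure P {U. \<bar>real (k n) * Gfun (avg_energy z n) - gauss_entropy (k n) (Mcov_sub z n (k n) U)\<bar> \<le> \<epsilon>}"
      by (simp only:)
  qed
qed

end
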